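(* Let $d\geq 3$ and $2\leq m\leq d-1$, and let $G^{(d,m)}$ be the spinal Hanoi towers group of type $(d,m)$. Then $G^{(d,m)}$ is strongly fractal and regular branch over its commutator subgroup. Moreover, $J\leq G^{(d,m)}$ holds if and only if $d\geq 4$, and $G^{(d,m)}$ is just infinite if and only if $d\geq 4$.
   Context: Tree and conventions. $\mathcal T_d$ is the $d$-regular rooted tree whose vertices are the finite words over $X=\{1,\dots,d\}$. Automorphisms and permutations act on the right and products are read from left to right. For $g\in\mathrm{Aut}(\mathcal T_d)$ and a vertex $v$, the section $g|_v$ is defined by $(vw)^g=v^g\,w^{g|_v}$. We write $\psi(g)=(g|_1,\dots,g|_d)\tau$, where $\tau\in\mathrm{Sym}(d)$ is the action of $g$ on the first level. $\mathrm{St}(1)$ is the pointwise stabilizer of the first level in $\mathrm{Aut}(\mathcal T_d)$ and $\mathrm{St}_G(1)=G\cap\mathrm{St}(1)$. Groups of type $(d,m)$. $G^{(d,m)}=\langle a_1,\dots,a_d\rangle\le\mathrm{Aut}(\mathcal T_d)$, where $\psi(a_i)=(1,\dots,1,a_i,1,\dots,1)\sigma_i$ (with $a_i$ in the $i$-th coordinate) and $\sigma_i$ is the $m$-cycle $(i+1\ \ i+2\ \cdots\ i+m)$, indices taken modulo $d$. The subgroup $J$. For $G=G^{(d,m)}$, $J$ is the subgroup of $\mathrm{Aut}(\mathcal T_d)$ generated by all $g\in\mathrm{St}(1)$ for which there are $h\in G$ and two distinct coordinates $p,q$ such that $\psi(g)$ has $h$ in coordinate $p$, $h^{-1}$ in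 coordinate $q$, and trivial entries elsewhere. Properties. A self-similar $G$ (all sections of elements of $G$ lie in $G$) is strongly fractal if $\{g|_x:g\in\mathrm{St}_G(1)\}=G$ for every $x\in X$. $G$ is regular branch over $K\le G$ if $G$ acts transitively on each level of the tree, $|G:K|<\infty$, and $K\times\cdots\times K$ ($d$ factors) is contained in $\psi(K\cap\mathrm{St}(1))$. A group is just infinite if it is infinite and all its proper quotients are finite. *)

theory Defs
  imports "HOL-Algebra.Sym_Groups"
begin

section \<open>Automorphisms of the regular rooted tree\<close>

definition vertices :: "nat \<Rightarrow> nat list set" where
  "vertices d = lists {1..d}"

definition is_child :: "nat list \<Rightarrow> nat list \<Rightarrow> bool" where
  "is_child u v \<longleftrightarrow> (\<exists>x. v = u @ [x])"

text \<open>An automorphism is extended by the identity to lists that are not vertices, so that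
  equality of automorphisms is equality of functions.  Automorphisms act on the right: the product
  of \<open>g\<close> and \<open>h\<close> is \<open>g\<close> followed by \<open>h\<close>.\<close>

definition tree_aut :: "nat \<Rightarrow> (nat list \<Rightarrow> nat list) monoid" where
  "tree_aut d =
    \<lparr>carrier = {g. g permutes vertices d \<and> g [] = [] \<and>
       (\<forall>u\<in>vertices d. \<forall>v\<in>vertices d. is_child u v \<longleftrightarrow> is_child (g u) (g v))},
     mult = (\<lambda>g h. h \<circ> g),
     one = id\<rparr>"

definition tree_section :: "(nat list \<Rightarrow> nat list) \<Rightarrow> nat list \<Rightarrow> nat list \<Rightarrow> nat list" where
  "tree_section g v = (\<lambda>w. drop (length v) (g (v @ w)))"

text \<open>A pair \<open>(f, \<tau>)\<close> stands for \<open>(f 1, \<dots>, f d) \<tau>\<close>.\<close>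

definition psi ::
  "nat \<Rightarrow> (nat list \<Rightarrow> nat list) \<Rightarrow> (nat \<Rightarrow> nat list \<Rightarrow> nat list) \<times> (nat \<Rightarrow> nat)" where
  "psi d g = (\<lambda>x\<in>{1..d}. tree_section g [x], \<lambda>x. hd (g [x]))"

definition level_one_stab :: "nat \<Rightarrow> (nat list \<Rightarrow> nat list) set" where
  "level_one_stab d = {g \<in> carrier (tree_aut d). \<forall>x\<in>{1..d}. g [x] = [x]}"

section \<open>The groups of type \<open>(d, m)\<close>\<close>

text \<open>The representative of \<open>k\<close> modulo \<open>d\<close> in \<open>{1..d}\<close>.\<close>

definition letter_mod :: "nat \<Rightarrow> nat \<Rightarrow> nat" where
  "letter_mod d k = (if k mod d = 0 then d else k mod d)"

definition hanoi_cycle :: "nat \<Rightarrow> nat \<Rightarrow> nat \<Rightarrow> nat \<Rightarrow> nat" where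
  "hanoi_cycle d m i = cycle_of_list (map (\<lambda>j. letter_mod d (i + j)) [1..<m + 1])"

primrec hanoi_action :: "nat \<Rightarrow> nat \<Rightarrow> nat \<Rightarrow> nat list \<Rightarrow> nat list" where
  "hanoi_action d m i [] = []"
| "hanoi_action d m i (x # w) =
     hanoi_cycle d m i x # (if x = i then hanoi_action d m i w else w)"

text \<open>These are the generators \<open>a\<^sub>i\<close>; the recursion \<open>\<psi>(a\<^sub>i) = (1, \<dots>, 1, a\<^sub>i, 1, \<dots>, 1) \<sigma>\<^sub>i\<close> is
  \<open>psi_hanoi_gen\<close> below.\<close>

definition hanoi_gen :: "nat \<Rightarrow> nat \<Rightarrow> nat \<Rightarrow> nat list \<Rightarrow> nat list" where
  "hanoi_gen d m i w = (if w \<in> vertices d then hanoi_action d m i w else w)"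

definition hanoi :: "nat \<Rightarrow> nat \<Rightarrow> (nat list \<Rightarrow> nat list) set" where
  "hanoi d m = generate (tree_aut d) (hanoi_gen d m ` {1..d})"

definition hanoi_J :: "nat \<Rightarrow> nat \<Rightarrow> (nat list \<Rightarrow> nat list) set" where
  "hanoi_J d m = generate (tree_aut d)
     {g \<in> level_one_stab d. \<exists>h\<in>hanoi d m. \<exists>p\<in>{1..d}. \<exists>q\<in>{1..d}. p \<noteq> q \<and>
        psi d g = (\<lambda>x\<in>{1..d}. if x = p then h else if x = q then inv\<^bsub>tree_aut d\<^esub> h else id, id)}"

section \<open>Properties of groups acting on the tree\<close>

definition self_similar :: "nat \<Rightarrow> (nat list \<Rightarrow> nat list) set \<Rightarrow> bool" where
  "self_similar d G \<longleftrightarrow> subgroup G (tree_aut d) \<and>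
     (\<forall>g\<in>G. \<forall>v\<in>vertices d. tree_section g v \<in> G)"

definition strongly_fractal :: "nat \<Rightarrow> (nat list \<Rightarrow> nat list) set \<Rightarrow> bool" where
  "strongly_fractal d G \<longleftrightarrow> self_similar d G \<and>
     (\<forall>x\<in>{1..d}. {tree_section g [x] | g. g \<in> G \<inter> level_one_stab d} = G)"

definition level_transitive :: "nat \<Rightarrow> (nat list \<Rightarrow> nat list) set \<Rightarrow> bool" where
  "level_transitive d G \<longleftrightarrow>
     (\<forall>u\<in>vertices d. \<forall>v\<in>vertices d. length u = length v \<longrightarrow> (\<exists>g\<in>G. g u = v))"

definition regular_branch_over ::
  "nat \<Rightarrow> (nat list \<Rightarrow> nat list) set \<Rightarrow> (nat list \<Rightarrow> nat list) set \<Rightarrow> bool" where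
  "regular_branch_over d G K \<longleftrightarrow>
     subgroup G (tree_aut d) \<and> subgroup K (tree_aut d\<lparr>carrier := G\<rparr>) \<and>
     level_transitive d G \<and>
     finite (rcosets\<^bsub>tree_aut d\<lparr>carrier := G\<rparr>\<^esub> K) \<and>
     ({1..d} \<rightarrow>\<^sub>E K) \<times> {id} \<subseteq> psi d ` (K \<inter> level_one_stab d)"

definition just_infinite :: "('a, 'b) monoid_scheme \<Rightarrow> bool" where
  "just_infinite G \<longleftrightarrow> infinite (carrier G) \<and>
     (\<forall>N. N \<lhd> G \<longrightarrow> N \<noteq> {\<one>\<^bsub>G\<^esub>} \<longrightarrow> finite (carrier (G Mod N)))"

section \<open>Well-definedness\<close>

lemma group_tree_aut: "group (tree_aut d)"
proof (rule groupI)
  fix g h assume "g \<in> carrier (tree_aut d)" "h \<in> carrier (tree_aut d)"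
  then have g: "g permutes vertices d" "g [] = []"
      "\<And>u v. u \<in> vertices d \<Longrightarrow> v \<in> vertices d \<Longrightarrow> is_child u v \<longleftrightarrow> is_child (g u) (g v)"
    and h: "h permutes vertices d" "h [] = []"
      "\<And>u v. u \<in> vertices d \<Longrightarrow> v \<in> vertices d \<Longrightarrow> is_child u v \<longleftrightarrow> is_child (h u) (h v)"
    by (auto simp: tree_aut_def)
  have "is_child u v \<longleftrightarrow> is_child (h (g u)) (h (g v))"
    if "u \<in> vertices d" "v \<in> vertices d" for u v
  proof -
    have "g u \<in> vertices d" "g v \<in> vertices d"
      using that permutes_in_image[OF g(1)] by blast+
    then show ?thesis using g(3)[OF that] h(3) by blast
  qed
  then show "g \<otimes>\<^bsub>tree_aut d\<^esub> h \<in> carrier (tree_aut d)"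
    using permutes_compose[OF g(1) h(1)] g(2) h(2) by (simp add: tree_aut_def)
next
  fix g assume g: "g \<in> carrier (tree_aut d)"
  then have p: "g permutes vertices d" and r: "g [] = []"
    and c: "\<And>u v. u \<in> vertices d \<Longrightarrow> v \<in> vertices d \<Longrightarrow> is_child u v \<longleftrightarrow> is_child (g u) (g v)"
    by (auto simp: tree_aut_def)
  have i: "inv_into UNIV g permutes vertices d" using p by (rule permutes_inv)
  have in_V: "inv_into UNIV g u \<in> vertices d" if "u \<in> vertices d" for u
    using permutes_in_image[OF i] that by simp
  have "is_child u v \<longleftrightarrow> is_child (inv_into UNIV g u) (inv_into UNIV g v)"
    if "u \<in> vertices d" "v \<in> vertices d" for u v
    using c[OF in_V[OF that(1)] in_V[OF that(2)]] permutes_inverses(1)[OF p] by simp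
  moreover have "inv_into UNIV g [] = []" using r permutes_inverses(2)[OF p] by metis
  ultimately have "inv_into UNIV g \<in> carrier (tree_aut d)" using i by (simp add: tree_aut_def)
  moreover have "inv_into UNIV g \<otimes>\<^bsub>tree_aut d\<^esub> g = \<one>\<^bsub>tree_aut d\<^esub>"
    using permutes_inv_o(1)[OF p] by (simp add: tree_aut_def)
  ultimately show "\<exists>h\<in>carrier (tree_aut d). h \<otimes>\<^bsub>tree_aut d\<^esub> g = \<one>\<^bsub>tree_aut d\<^esub>" by blast
qed (auto simp: tree_aut_def permutes_id o_assoc)

lemma letter_mod_in: "0 < d \<Longrightarrow> letter_mod d k \<in> {1..d}"
  using mod_less_divisor[of d k] by (auto simp: letter_mod_def)

lemma distinct_hanoi_cycle:
  assumes "m < d"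
  shows "distinct (map (\<lambda>j. letter_mod d (i + j)) [1..<m + 1])"
proof -
  have "j = k" if "letter_mod d (i + j) = letter_mod d (i + k)" "j \<in> {1..m}" "k \<in> {1..m}" for j k
  proof -
    have "(i + j) mod d < d" "(i + k) mod d < d" using assms by auto
    then have "(i + j) mod d = (i + k) mod d"
      using that(1) unfolding letter_mod_def by (metis less_irrefl)
    then have "int d dvd int (i + j) - int (i + k)"
      by (metis mod_eq_dvd_iff of_nat_mod)
    then have "int d dvd int j - int k" by simp
    moreover have "\<bar>int j - int k\<bar> < int d" using that assms by auto
    ultimately show ?thesis using dvd_imp_le_int[of "int j - int k" "int d"] by fastforce
  qed
  then show ?thesis by (auto simp: distinct_map inj_on_def)
qed

lemma hanoi_cycle_permutes:
  assumes "m < d"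
  shows "hanoi_cycle d m i permutes {1..d}"
proof -
  have "hanoi_cycle d m i permutes set (map (\<lambda>j. letter_mod d (i + j)) [1..<m + 1])"
    unfolding hanoi_cycle_def by (rule cycle_permutes)
  moreover have "set (map (\<lambda>j. letter_mod d (i + j)) [1..<m + 1]) \<subseteq> {1..d}"
    using assms letter_mod_in[of d] by auto
  ultimately show ?thesis by (rule permutes_subset)
qed

lemma hanoi_cycle_apply:
  assumes "m < d" "1 \<le> j" "j \<le> m"
  shows "hanoi_cycle d m i (letter_mod d (i + j)) =
    (if j = m then letter_mod d (i + 1) else letter_mod d (i + (j + 1)))"
proof -
  define cs where "cs = map (\<lambda>j. letter_mod d (i + j)) [1..<m + 1]"
  have len: "length cs = m" by (simp add: cs_def)
  have nth: "cs ! k = letter_mod d (i + (k + 1))" if "k < m" for k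
    using that by (simp add: cs_def del: upt_Suc)
  have rot: "map (cycle_of_list cs) cs = rotate1 cs"
    using cyclic_rotation[of cs 1] distinct_hanoi_cycle[OF assms(1)] by (simp add: cs_def)
  have "cycle_of_list cs (cs ! (j - 1)) = rotate1 cs ! (j - 1)"
    using rot len assms nth_map[of "j - 1" cs "cycle_of_list cs"] by simp
  also have "\<dots> = cs ! (j mod m)"
    using nth_rotate1[of "j - 1" cs] len assms by simp
  finally show ?thesis
    using nth[of "j - 1"] nth[of "j mod m"] assms by (auto simp: hanoi_cycle_def cs_def)
qed

lemma hanoi_action_vertices:
  assumes "m < d"
  shows "hanoi_action d m i w \<in> vertices d \<longleftrightarrow> w \<in> vertices d"
  using permutes_in_image[OF hanoi_cycle_permutes[OF assms]]
  by (induction w) (auto simp: vertices_def)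

lemma length_hanoi_action [simp]: "length (hanoi_action d m i w) = length w"
  by (induction w) auto

lemma inj_hanoi_action:
  assumes "m < d"
  shows "hanoi_action d m i v = hanoi_action d m i w \<Longrightarrow> v = w"
proof (induction v arbitrary: w)
  case Nil
  then show ?case by (cases w) auto
next
  case (Cons x v)
  then show ?case
    using permutes_inj[OF hanoi_cycle_permutes[OF assms, of i]]
    by (cases w) (auto dest: injD split: if_splits)
qed

lemma surj_hanoi_action:
  assumes "m < d"
  shows "\<exists>v. hanoi_action d m i v = w"
proof (induction w)
  case Nil
  have "hanoi_action d m i [] = []" by simp
  then show ?case by blast
next
  case (Cons y w)
  then obtain v where v: "hanoi_action d m i v = w" by blast
  obtain x where x: "hanoi_cycle d m i x = y"
    using permutes_surj[OF hanoi_cycle_permutes[OF assms, of i]] by (metis surjD)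
  have "hanoi_action d m i (x # (if x = i then v else w)) = y # w" using v x by simp
  then show ?case by blast
qed

lemma is_child_hanoi_action:
  assumes "m < d"
  shows "is_child (hanoi_action d m i u) (hanoi_action d m i v) \<longleftrightarrow> is_child u v"
proof (induction u arbitrary: v)
  case Nil
  show ?case
    by (cases v) (auto simp: is_child_def length_Suc_conv simp flip: length_0_conv)
next
  case (Cons x u)
  have cons: "is_child (a # s) (b # t) \<longleftrightarrow> a = b \<and> is_child s t" for a b and s t :: "nat list"
    by (auto simp: is_child_def)
  have nil: "\<not> is_child s []" for s by (simp add: is_child_def)
  show ?case
    using Cons permutes_inj[OF hanoi_cycle_permutes[OF assms, of i]]
    by (cases v) (auto simp: cons nil dest: injD)
qed

lemma hanoi_gen_in_tree_aut:
  assumes "m < d"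
  shows "hanoi_gen d m i \<in> carrier (tree_aut d)"
proof -
  have "bij_betw (hanoi_gen d m i) (vertices d) (vertices d)"
    unfolding bij_betw_def
  proof
    show "inj_on (hanoi_gen d m i) (vertices d)"
      using inj_hanoi_action[OF assms] by (auto simp: inj_on_def hanoi_gen_def)
    show "hanoi_gen d m i ` vertices d = vertices d"
    proof
      show "hanoi_gen d m i ` vertices d \<subseteq> vertices d"
        using hanoi_action_vertices[OF assms] by (auto simp: hanoi_gen_def)
      show "vertices d \<subseteq> hanoi_gen d m i ` vertices d"
      proof
        fix w assume "w \<in> vertices d"
        moreover obtain v where "hanoi_action d m i v = w" using surj_hanoi_action[OF assms] by blast
        ultimately show "w \<in> hanoi_gen d m i ` vertices d"
          using hanoi_action_vertices[OF assms, of i v] by (auto simp: hanoi_gen_def image_iff)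
      qed
    qed
  qed
  then have "hanoi_gen d m i permutes vertices d"
    by (rule bij_imp_permutes) (simp add: hanoi_gen_def)
  then show ?thesis
    using is_child_hanoi_action[OF assms] by (simp add: tree_aut_def hanoi_gen_def)
qed

lemma psi_hanoi_gen:
  assumes "m < d"
  shows "psi d (hanoi_gen d m i) =
    (\<lambda>x\<in>{1..d}. if x = i then hanoi_gen d m i else id, hanoi_cycle d m i)"
proof -
  have "hd (hanoi_gen d m i [x]) = hanoi_cycle d m i x" for x
    using permutes_not_in[OF hanoi_cycle_permutes[OF assms], of x i]
    by (auto simp: hanoi_gen_def vertices_def)
  then show ?thesis
    by (auto simp: psi_def tree_section_def hanoi_gen_def vertices_def fun_eq_iff restrict_def)
qed

end

theory Submission
  imports Defs "HOL-Algebra.FiniteProduct"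
begin

text \<open>Write \<open>G\<close> for \<open>hanoi d m\<close>, \<open>K\<close> for its commutator subgroup, \<open>G\<^sub>1\<close> for its first level
  stabilizer, and \<open>(k at x)\<close> for the automorphism that fixes the first level, has section \<open>k\<close> at \<open>x\<close>
  and trivial sections elsewhere.

  Strong fractality rests on two observations.  The generator \<open>a\<^sub>i\<close> fixes \<open>i\<close>, the only letter where
  its section is nontrivial; so letters can be moved to each other with trivial section
  (\<open>transport_trivially\<close>), and the set of sections of \<open>G\<^sub>1\<close> at \<open>x\<close> does not depend on \<open>x\<close>.  Hence it
  suffices to find, for each \<open>j\<close>, one element of \<open>G\<^sub>1\<close> that has \<open>a\<^sub>j\<close> or its inverse as a section
  somewhere.  The quotient of two consecutive generators acts on the letters as a three-cycle.
  For \<open>d \<ge> 5\<close> the cube of such a quotient, or the square of a product of two, is an element of this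
  kind; for \<open>d = 3\<close> and \<open>d = 4\<close> explicit words are.  For \<open>d \<ge> 4\<close> these elements have \<open>a\<^sub>j\<close> (or its
  inverse) at two letters \<open>p\<close>, \<open>q\<close> and the trivial section at a third letter \<open>s\<close> (\<open>seeds\<close>), and they
  carry the rest of the argument.

  The three-cycles generate all three-cycles (\<open>all_three_cycles\<close>).  Comparing a seed with its conjugate
  by an element that acts as the three-cycle \<open>(p q s)\<close> gives an element whose sections are, modulo
  \<open>K\<close>, \<open>a\<^sub>j\<close> and its inverse at two letters and trivial elsewhere (\<open>all_opposite_pairs\<close>).
  To make the word "modulo" disappear, let \<open>F(x, Y)\<close> be the group of all sections at \<open>x\<close> of elements
  of \<open>G\<^sub>1\<close> with trivial sections on \<open>Y\<close>.  Seeds give \<open>F(x, {y}) = G\<close>, and commutators give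
  \<open>[F(x, Y), F(x, Z)] \<le> F(x, Y \<union> Z)\<close>.  If \<open>F(x, Y) = G\<close> for all \<open>Y\<close> of size \<open>k\<close>, then \<open>K \<le> F(x, Y)\<close>
  for all \<open>Y\<close> of size \<open>k + 1\<close>; this is enough to clear the sections of an opposite pair on \<open>Y\<close>, so
  \<open>F(x, Y) = G\<close> for these \<open>Y\<close> too as long as a letter outside \<open>Y\<close> and \<open>x\<close> is left over, that is up to
  size \<open>d - 2\<close> (\<open>sections_free_of_others\<close>).  One more commutator yields \<open>([g, h] at x) \<in> K\<close> for all
  \<open>g, h \<in> G\<close>, which is branching over \<open>K\<close>.  For \<open>d = 3\<close> branching follows from three explicit
  commutators.  The index of \<open>K\<close> is finite since \<open>a\<^sub>i\<^sup>m = 1\<close>.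

  For \<open>d \<ge> 4\<close>, opposite pairs can now be corrected by elements of \<open>K \<times> \<dots> \<times> K\<close>, so the generators of
  \<open>J\<close> lie in \<open>K\<close> (\<open>opposite_in_K\<close>).  Commutators of two of them show that the derived subgroup of
  \<open>K\<close> contains \<open>K \<times> \<dots> \<times> K\<close>.  A nontrivial normal subgroup therefore contains an iterated power
  \<open>K \<times> \<dots> \<times> K\<close>, which has finite index: this is the usual argument for branch groups, carried out
  in \<open>normal_contains_delta_pow\<close> by induction on the depth of a moved vertex.

  For \<open>d = 3\<close> the group maps onto the infinite dihedral group: \<open>a\<^sub>1\<close> acts on the integers by
  \<open>n \<mapsto> -n\<close>, \<open>a\<^sub>2\<close> by \<open>n \<mapsto> 1 - n\<close> and \<open>a\<^sub>3\<close> trivially.  This is well defined because the form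
  \<open>x\<^sub>1 + x\<^sub>2 - x\<^sub>3\<close> intertwines the action of a word with the actions of its three sections
  (\<open>balance_equivariant\<close>), and sections of a word are shorter unless the word is a power of a letter.
  The kernel is a nontrivial normal subgroup of infinite index.  The same identity shows that the
  element with sections \<open>a\<^sub>1\<close>, \<open>a\<^sub>1\<close>, \<open>1\<close> is not in \<open>G\<close>, so \<open>J\<close> is not contained in \<open>G\<close>.\<close>

section \<open>Automorphisms through their first level\<close>

abbreviation sec :: "(nat list \<Rightarrow> nat list) \<Rightarrow> nat \<Rightarrow> nat list \<Rightarrow> nat list" where
  "sec g x \<equiv> tree_section g [x]"

definition root_perm :: "(nat list \<Rightarrow> nat list) \<Rightarrow> nat \<Rightarrow> nat" where
  "root_perm g x = hd (g [x])"

fun diag :: "(nat \<Rightarrow> nat list \<Rightarrow> nat list) \<Rightarrow> nat list \<Rightarrow> nat list" where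
  "diag f [] = []"
| "diag f (x # w) = x # f x w"

abbreviation single :: "nat \<Rightarrow> (nat list \<Rightarrow> nat list) \<Rightarrow> nat list \<Rightarrow> nat list" where
  "single x k \<equiv> diag (\<lambda>y. if y = x then k else id)"

lemma sec_diag [simp]: "sec (diag f) x = f x"
  by (simp add: tree_section_def)

lemma root_perm_diag [simp]: "root_perm (diag f) x = x"
  by (simp add: root_perm_def)

locale rooted_tree =
  fixes d :: nat
begin

abbreviation T where "T \<equiv> tree_aut d"

definition X where "X = {1..d}"

sublocale T: group T
  by (rule group_tree_aut)

text \<open>The equation \<open>mult_T\<close> stays out of the simplifier: eta-contracted, it would rewrite every
  product to a composition of functions.\<close>

lemma mult_T: "(g \<otimes>\<^bsub>T\<^esub> h) w = h (g w)"
  by (simp add: tree_aut_def)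

lemma one_T: "\<one>\<^bsub>T\<^esub> = id"
  by (simp add: tree_aut_def)

lemma id_in_T [simp]: "id \<in> carrier T"
  using T.one_closed by (simp add: one_T)

lemma id_mult [simp]: "g \<otimes>\<^bsub>T\<^esub> id = g" "id \<otimes>\<^bsub>T\<^esub> g = g"
  by (simp_all add: tree_aut_def)

lemma inv_id [simp]: "inv\<^bsub>T\<^esub> id = id"
  using T.inv_one by (simp add: one_T)

lemma inv_apply: "g \<in> carrier T \<Longrightarrow> (inv\<^bsub>T\<^esub> g) (g w) = w" "g \<in> carrier T \<Longrightarrow> g ((inv\<^bsub>T\<^esub> g) w) = w"
  using T.r_inv[of g] T.l_inv[of g] by (metis mult_T one_T id_apply)+

lemma in_T:
  assumes "g \<in> carrier T"
  shows "g permutes vertices d" "g [] = []"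
    "u \<in> vertices d \<Longrightarrow> v \<in> vertices d \<Longrightarrow> is_child (g u) (g v) \<longleftrightarrow> is_child u v"
  using assms by (auto simp: tree_aut_def)

lemma aut_eq_Nil: "g \<in> carrier T \<Longrightarrow> g w = [] \<longleftrightarrow> w = []"
  using in_T(2) inv_apply(1) by metis

lemma aut_in_vertices: "g \<in> carrier T \<Longrightarrow> g w \<in> vertices d \<longleftrightarrow> w \<in> vertices d"
  using permutes_in_image[OF in_T(1)] by blast

lemma Cons_in_vertices [simp]: "x # w \<in> vertices d \<longleftrightarrow> x \<in> X \<and> w \<in> vertices d"
  by (auto simp: vertices_def X_def)

lemma Nil_in_vertices [simp]: "[] \<in> vertices d"
  by (simp add: vertices_def)

lemma aut_not_vertex: "g \<in> carrier T \<Longrightarrow> w \<notin> vertices d \<Longrightarrow> g w = w"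
  using permutes_not_in[OF in_T(1)] by blast

lemma aut_snoc:
  assumes "g \<in> carrier T" "u @ [x] \<in> vertices d"
  shows "\<exists>y. g (u @ [x]) = g u @ [y]"
proof -
  have "u \<in> vertices d" using assms(2) by (auto simp: vertices_def)
  then show ?thesis
    using in_T(3)[OF assms(1) _ assms(2), of u] by (auto simp: is_child_def)
qed

text \<open>The restriction to vertices \<open>w\<close> matters: if \<open>w\<close> is not a vertex, then \<open>g\<close> fixes \<open>x # w\<close> although it
  may move the letter \<open>x\<close>.\<close>

lemma aut_Cons:
  assumes g: "g \<in> carrier T" and w: "w \<in> vertices d"
  shows "g (x # w) = root_perm g x # sec g x w"
proof (cases "x \<in> X")
  case True
  have "\<exists>v. g (x # w) = g [x] @ v"
    using w
  proof (induction w rule: rev_induct)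
    case (snoc y w)
    then have "w \<in> vertices d" "(x # w) @ [y] \<in> vertices d" using True by (auto simp: vertices_def X_def)
    then show ?case using aut_snoc[OF g, of "x # w" y] snoc.IH by auto
  qed simp
  then obtain v where v: "g (x # w) = g [x] @ v" by blast
  obtain y where "g [x] = [y]" using aut_snoc[OF g, of "[]" x] True in_T(2)[OF g] by auto
  then show ?thesis using v by (simp add: root_perm_def tree_section_def)
next
  case False
  then show ?thesis
    using aut_not_vertex[OF g, of "[x]"] aut_not_vertex[OF g, of "x # w"]
    by (auto simp: root_perm_def tree_section_def)
qed

lemma sec_not_vertex: "g \<in> carrier T \<Longrightarrow> x \<notin> X \<or> w \<notin> vertices d \<Longrightarrow> sec g x w = w"
  using aut_not_vertex[of g "x # w"] by (auto simp: tree_section_def)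

lemma sec_outside: "g \<in> carrier T \<Longrightarrow> x \<notin> X \<Longrightarrow> sec g x = id"
  using sec_not_vertex by fastforce

lemma root_outside: "g \<in> carrier T \<Longrightarrow> x \<notin> X \<Longrightarrow> root_perm g x = x"
  using aut_not_vertex[of g "[x]"] by (simp add: root_perm_def)

lemma sec_root_in_vertices:
  assumes "g \<in> carrier T" "w \<in> vertices d"
  shows "sec g x w \<in> vertices d" "root_perm g x \<in> X \<longleftrightarrow> x \<in> X"
proof -
  have *: "root_perm g x # sec g x w \<in> vertices d \<longleftrightarrow> x # w \<in> vertices d" for x
    using aut_in_vertices[OF assms(1), of "x # w"] aut_Cons[OF assms] by simp
  show "sec g x w \<in> vertices d"
    using *[of x] assms sec_outside[OF assms(1), of x] by (cases "x \<in> X") auto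
  show "root_perm g x \<in> X \<longleftrightarrow> x \<in> X"
    using *[of x] assms root_outside[OF assms(1), of x] by (cases "x \<in> X") auto
qed

lemma root_in_X: "g \<in> carrier T \<Longrightarrow> root_perm g x \<in> X \<longleftrightarrow> x \<in> X"
  using sec_root_in_vertices(2)[of g "[]"] by simp

lemma root_in_X': "g \<in> carrier T \<Longrightarrow> x \<in> X \<Longrightarrow> root_perm g x \<in> X"
  using root_in_X by blast

lemma root_perm_mult:
  assumes "g \<in> carrier T" "h \<in> carrier T"
  shows "root_perm (g \<otimes>\<^bsub>T\<^esub> h) x = root_perm h (root_perm g x)"
  using aut_Cons[OF assms(1), of "[]" x]  aut_Cons[OF assms(2), of "sec g x []" "root_perm g x"]
    sec_root_in_vertices(1)[OF assms(1), of "[]" x]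
  by (simp add: root_perm_def mult_T)

lemma sec_mult:
  assumes "g \<in> carrier T" "h \<in> carrier T"
  shows "sec (g \<otimes>\<^bsub>T\<^esub> h) x = sec g x \<otimes>\<^bsub>T\<^esub> sec h (root_perm g x)"
proof
  fix w
  show "sec (g \<otimes>\<^bsub>T\<^esub> h) x w = (sec g x \<otimes>\<^bsub>T\<^esub> sec h (root_perm g x)) w"
  proof (cases "w \<in> vertices d")
    case True
    then show ?thesis
      using aut_Cons[OF assms(1), of w x] aut_Cons[OF assms(2), of "sec g x w" "root_perm g x"]
        sec_root_in_vertices(1)[OF assms(1), of w x]
      by (simp add: tree_section_def mult_T)
  qed (use assms in \<open>simp add: sec_not_vertex mult_T\<close>)
qed

lemma sec_id [simp]: "sec id x = id"
  by (auto simp: tree_section_def)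

lemma root_perm_id [simp]: "root_perm id x = x"
  by (simp add: root_perm_def)

lemma root_perm_inv_left [simp]: "g \<in> carrier T \<Longrightarrow> root_perm (inv\<^bsub>T\<^esub> g) (root_perm g x) = x"
  using root_perm_mult[of g "inv\<^bsub>T\<^esub> g" x] by (simp add: one_T)

lemma root_perm_inv_right [simp]: "g \<in> carrier T \<Longrightarrow> root_perm g (root_perm (inv\<^bsub>T\<^esub> g) x) = x"
  using root_perm_mult[of "inv\<^bsub>T\<^esub> g" g x] by (simp add: one_T)

lemma root_perm_inj: "g \<in> carrier T \<Longrightarrow> root_perm g x = root_perm g y \<longleftrightarrow> x = y"
  by (metis root_perm_inv_left)

lemma root_perm_inv_eq: "g \<in> carrier T \<Longrightarrow> root_perm g x = y \<Longrightarrow> root_perm (inv\<^bsub>T\<^esub> g) y = x"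
  by auto

lemma is_child_Cons [simp]: "is_child (x # u) (x # v) \<longleftrightarrow> is_child u v"
  by (auto simp: is_child_def)

text \<open>The section of the inverse is an inverse of the section, which gives bijectivity.\<close>

lemma sec_in_T [simp]:
  assumes g: "g \<in> carrier T"
  shows "sec g x \<in> carrier T"
proof (cases "x \<in> X")
  case True
  define h where "h = sec (inv\<^bsub>T\<^esub> g) (root_perm g x)"
  have g': "inv\<^bsub>T\<^esub> g \<in> carrier T" using g by simp
  have "sec g x \<otimes>\<^bsub>T\<^esub> h = id" "h \<otimes>\<^bsub>T\<^esub> sec g x = id"
    using sec_mult[OF g g', of x] sec_mult[OF g' g, of "root_perm g x"] g
    by (simp_all add: h_def one_T)
  then have inv: "h (sec g x w) = w" "sec g x (h w) = w" for w
    by (metis mult_T id_apply)+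
  have "bij (sec g x)" using inv by (intro bij_betw_byWitness[of _ h]) auto
  then have "sec g x permutes vertices d"
    using sec_not_vertex[OF g] by (auto simp: permutes_def bij_iff)
  moreover have "root_perm g x # sec g x [] = g [x]" using aut_Cons[OF g, of "[]" x] by simp
  moreover have "is_child (sec g x u) (sec g x v) \<longleftrightarrow> is_child u v"
    if "u \<in> vertices d" "v \<in> vertices d" for u v
    using in_T(3)[OF g, of "x # u" "x # v"] that True by (simp add: aut_Cons[OF g])
  moreover have "sec g x [] = []"
    using aut_snoc[OF g, of "[]" x] True in_T(2)[OF g] by (auto simp: tree_section_def)
  ultimately show ?thesis by (simp add: tree_aut_def)
qed (use g sec_outside in simp)

lemma sec_inv:
  assumes "g \<in> carrier T" "root_perm g x = y"
  shows "sec (inv\<^bsub>T\<^esub> g) y = inv\<^bsub>T\<^esub> (sec g x)"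
proof -
  have "sec g x \<otimes>\<^bsub>T\<^esub> sec (inv\<^bsub>T\<^esub> g) y = \<one>\<^bsub>T\<^esub>"
    using sec_mult[of g "inv\<^bsub>T\<^esub> g" x] assms by (simp add: one_T)
  then show ?thesis using assms T.inv_comm T.inv_equality sec_in_T T.inv_closed by metis
qed

text \<open>This is how identities between elements of the group are checked below.\<close>

lemma T_eqI:
  assumes "g \<in> carrier T" "h \<in> carrier T"
    and "\<And>x. x \<in> X \<Longrightarrow> root_perm g x = root_perm h x"
    and "\<And>x. x \<in> X \<Longrightarrow> sec g x = sec h x"
  shows "g = h"
proof
  fix w
  show "g w = h w"
  proof (cases w)
    case Nil
    then show ?thesis using in_T(2)[OF assms(1)] in_T(2)[OF assms(2)] by simp
  next
    case (Cons x v)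
    show ?thesis
    proof (cases "w \<in> vertices d")
      case True
      then show ?thesis using assms Cons by (simp add: aut_Cons)
    next
      case False
      then show ?thesis using assms(1,2) by (simp add: aut_not_vertex)
    qed
  qed
qed

lemma level_one_stab_iff:
  "g \<in> level_one_stab d \<longleftrightarrow> g \<in> carrier T \<and> (\<forall>x. root_perm g x = x)"
proof -
  have "g [x] = [x] \<longleftrightarrow> root_perm g x = x" if "g \<in> carrier T" "x \<in> X" for x
    using aut_snoc[OF that(1), of "[]" x] that in_T(2)[OF that(1)] by (auto simp: root_perm_def)
  then show ?thesis
    unfolding level_one_stab_def X_def[symmetric] using root_outside by blast
qed

lemma diag_in_T:
  assumes f: "\<And>x. x \<in> X \<Longrightarrow> f x \<in> carrier T" and f': "\<And>x. x \<notin> X \<Longrightarrow> f x = id"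
  shows "diag f \<in> carrier T"
proof -
  have f: "f x \<in> carrier T" for x using f f' by (cases "x \<in> X") auto
  have 1: "diag (\<lambda>x. inv\<^bsub>T\<^esub> (f x)) (diag f w) = w" "diag f (diag (\<lambda>x. inv\<^bsub>T\<^esub> (f x)) w) = w" for w
    using f by (cases w; simp add: inv_apply)+
  have "bij (diag f)" using 1 by (intro bij_betw_byWitness[of _ "diag (\<lambda>x. inv\<^bsub>T\<^esub> (f x))"]) auto
  moreover have "diag f w = w" if "w \<notin> vertices d" for w
  proof (cases w)
    case (Cons x v)
    then show ?thesis using that f' aut_not_vertex[OF f, of v x] by auto
  qed simp
  ultimately have "diag f permutes vertices d" by (auto simp: permutes_def bij_iff)
  moreover have "is_child (diag f u) (diag f v) \<longleftrightarrow> is_child u v"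
    if "u \<in> vertices d" "v \<in> vertices d" for u v
    using that
  proof (cases u)
    case Nil
    then show ?thesis
      using that aut_eq_Nil[OF f] by (cases v) (auto simp: is_child_def)
  next
    case (Cons x u')
    then show ?thesis
      using that f[THEN in_T(3), of u' _ x] by (cases v) (auto simp: is_child_def)
  qed
  ultimately show ?thesis by (simp add: tree_aut_def)
qed

lemma single_in_T [simp]: "x \<in> X \<Longrightarrow> k \<in> carrier T \<Longrightarrow> single x k \<in> carrier T"
  by (rule diag_in_T) auto

lemma finite_X: "finite X"
  by (simp add: X_def)

lemma card_X: "card X = d"
  by (simp add: X_def)

lemma letter_outside:
  assumes "finite Y" "card Y < d"
  shows "\<exists>z\<in>X. z \<notin> Y"
  using card_mono[OF assms(1), of X] assms(2) card_X by fastforce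

lemma diag_in_subgroup:
  assumes H: "subgroup H T" and f: "\<And>x. x \<in> X \<Longrightarrow> f x \<in> carrier T" "\<And>x. x \<notin> X \<Longrightarrow> f x = id"
    and single: "\<And>x. x \<in> X \<Longrightarrow> single x (f x) \<in> H"
  shows "diag f \<in> H"
proof -
  define P where "P Y \<longleftrightarrow> diag (\<lambda>x. if x \<in> Y then f x else id) \<in> H" for Y
  have "P Y" if "finite Y" "Y \<subseteq> X" for Y
    using that
  proof (induction rule: finite_induct)
    case empty
    have "diag (\<lambda>x. if x \<in> {} then f x else id) w = id w" for w
      by (cases w) simp_all
    then have "diag (\<lambda>x. if x \<in> {} then f x else id) = id" by blast
    then show ?case using subgroup.one_closed[OF H] by (simp only: P_def one_T)
  next
    case (insert y Y)
    let ?g = "\<lambda>Y x. if x \<in> Y then f x else id"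
    have y: "y \<in> X" "Y \<subseteq> X" "y \<notin> Y" using insert by auto
    have "diag (?g (insert y Y)) w = (diag (?g Y) \<otimes>\<^bsub>T\<^esub> single y (f y)) w" for w
      using y by (cases w) (auto simp: mult_T)
    then have "diag (?g (insert y Y)) = diag (?g Y) \<otimes>\<^bsub>T\<^esub> single y (f y)" by blast
    moreover have "diag (?g Y) \<in> H" using insert y by (simp add: P_def)
    ultimately show ?case
      using subgroup.m_closed[OF H _ single[OF y(1)]] by (simp only: P_def)
  qed
  from this[OF finite_X] have "diag (\<lambda>x. if x \<in> X then f x else id) \<in> H" by (simp add: P_def)
  moreover have "(\<lambda>x. if x \<in> X then f x else id) = f" using f by auto
  ultimately show ?thesis by simp
qed

lemma eq_diag:
  assumes "g \<in> level_one_stab d"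
  shows "g = diag (sec g)"
proof (rule T_eqI)
  have g: "g \<in> carrier T" using assms by (simp add: level_one_stab_iff)
  then show "diag (sec g) \<in> carrier T" by (intro diag_in_T) (simp_all add: sec_outside)
qed (use assms in \<open>simp_all add: level_one_stab_iff\<close>)

abbreviation comm where "comm g h \<equiv> g \<otimes>\<^bsub>T\<^esub> h \<otimes>\<^bsub>T\<^esub> inv\<^bsub>T\<^esub> g \<otimes>\<^bsub>T\<^esub> inv\<^bsub>T\<^esub> h"

lemma cancel [simp]:
  assumes "g \<in> carrier T" "h \<in> carrier T"
  shows "inv\<^bsub>T\<^esub> g \<otimes>\<^bsub>T\<^esub> (g \<otimes>\<^bsub>T\<^esub> h) = h" "g \<otimes>\<^bsub>T\<^esub> (inv\<^bsub>T\<^esub> g \<otimes>\<^bsub>T\<^esub> h) = h"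
  using assms by (simp_all add: T.m_assoc[symmetric])

lemma single_mult:
  assumes "x \<in> X" "k \<in> carrier T" "l \<in> carrier T"
  shows "single x k \<otimes>\<^bsub>T\<^esub> single x l = single x (k \<otimes>\<^bsub>T\<^esub> l)"
proof
  fix w show "(single x k \<otimes>\<^bsub>T\<^esub> single x l) w = single x (k \<otimes>\<^bsub>T\<^esub> l) w"
    by (cases w) (simp_all add: mult_T)
qed

lemma single_id: "single x id = id"
proof
  fix w show "single x id w = id w" by (cases w) simp_all
qed

lemma single_inv:
  assumes "x \<in> X" "k \<in> carrier T"
  shows "inv\<^bsub>T\<^esub> (single x k) = single x (inv\<^bsub>T\<^esub> k)"
proof (rule T.inv_equality)
  show "single x (inv\<^bsub>T\<^esub> k) \<otimes>\<^bsub>T\<^esub> single x k = \<one>\<^bsub>T\<^esub>"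
    using single_mult[OF assms(1), of "inv\<^bsub>T\<^esub> k" k] assms(2) single_id[of x]
    by (simp only: T.l_inv one_T T.inv_closed)
qed (use assms in simp_all)

lemma comm_single:
  assumes x: "x \<in> X" and k: "k \<in> carrier T" and u: "u \<in> carrier T" "root_perm u x = x"
  shows "comm u (single x k) = single x (comm (sec u x) k)"
proof (rule T_eqI)
  note s = single_in_T[OF x k]
  show "single x (comm (sec u x) k) \<in> carrier T" using u k by (intro single_in_T[OF x]) simp
  show "root_perm (comm u (single x k)) z = root_perm (single x (comm (sec u x) k)) z" for z
    using u s single_in_T[OF x T.inv_closed[OF k]] by (simp add: root_perm_mult single_inv[OF x k])
  fix z
  have ru: "root_perm u z = x \<longleftrightarrow> z = x" using root_perm_inj[OF u(1), of z x] u(2) by simp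
  have "sec (comm u (single x k)) z
      = sec u z \<otimes>\<^bsub>T\<^esub> (if z = x then k else id) \<otimes>\<^bsub>T\<^esub> inv\<^bsub>T\<^esub> (sec u z) \<otimes>\<^bsub>T\<^esub> (if z = x then inv\<^bsub>T\<^esub> k else id)"
    using u s single_in_T[OF x, of "inv\<^bsub>T\<^esub> k"] k sec_inv[OF u(1) refl, of z] ru
    by (simp add: root_perm_mult sec_mult single_inv[OF x k])
  also have "\<dots> = (if z = x then comm (sec u x) k else id)"
    using u(1) by (simp add: one_T)
  finally show "sec (comm u (single x k)) z = sec (single x (comm (sec u x) k)) z"
    by (simp only: sec_diag)
qed (use assms in simp_all)

text \<open>With this, to show that a subgroup contains \<open>single x k\<close> for all \<open>k\<close> in a group, it is enough to do so
  for generators \<open>k\<close>.\<close>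

lemma single_preimage_subgroup:
  assumes H: "subgroup H T" and x: "x \<in> X"
  shows "subgroup {k \<in> carrier T. single x k \<in> H} T"
proof (rule T.subgroupI)
  have "id \<in> {k \<in> carrier T. single x k \<in> H}"
    using subgroup.one_closed[OF H] single_id[of x] by (simp only: mem_Collect_eq one_T) simp
  then show "{k \<in> carrier T. single x k \<in> H} \<noteq> {}" by blast
  show "inv\<^bsub>T\<^esub> k \<in> {k \<in> carrier T. single x k \<in> H}" if "k \<in> {k \<in> carrier T. single x k \<in> H}" for k
    using that subgroup.m_inv_closed[OF H, of "single x k"] single_inv[OF x, of k] by simp
  show "k \<otimes>\<^bsub>T\<^esub> l \<in> {k \<in> carrier T. single x k \<in> H}"
    if "k \<in> {k \<in> carrier T. single x k \<in> H}" "l \<in> {k \<in> carrier T. single x k \<in> H}" for k l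
    using that subgroup.m_closed[OF H, of "single x k" "single x l"] single_mult[OF x, of k l] by simp
qed blast

lemma single_conj:
  assumes "x \<in> X" "k \<in> carrier T" "s \<in> carrier T" "root_perm s x = y"
  shows "inv\<^bsub>T\<^esub> s \<otimes>\<^bsub>T\<^esub> single x k \<otimes>\<^bsub>T\<^esub> s = single y (inv\<^bsub>T\<^esub> (sec s x) \<otimes>\<^bsub>T\<^esub> k \<otimes>\<^bsub>T\<^esub> sec s x)"
proof -
  have y: "y \<in> X" using assms(4) root_in_X'[OF assms(3,1)] by simp
  note sT = assms(3)
  note k = single_in_T[OF assms(1,2)]
  have sec: "sec (inv\<^bsub>T\<^esub> s \<otimes>\<^bsub>T\<^esub> single x k \<otimes>\<^bsub>T\<^esub> s) (root_perm s z)
      = inv\<^bsub>T\<^esub> (sec s z) \<otimes>\<^bsub>T\<^esub> (if z = x then k else id) \<otimes>\<^bsub>T\<^esub> sec s z" for z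
    using sT k sec_inv[OF sT refl, of z] by (simp add: sec_mult root_perm_mult)
  show ?thesis
  proof (rule T_eqI)
    show "root_perm (inv\<^bsub>T\<^esub> s \<otimes>\<^bsub>T\<^esub> single x k \<otimes>\<^bsub>T\<^esub> s) z
      = root_perm (single y (inv\<^bsub>T\<^esub> (sec s x) \<otimes>\<^bsub>T\<^esub> k \<otimes>\<^bsub>T\<^esub> sec s x)) z" for z
      using sT k by (simp add: root_perm_mult)
    fix z
    define z' where "z' = root_perm (inv\<^bsub>T\<^esub> s) z"
    have z: "z = root_perm s z'" using sT by (simp add: z'_def)
    show "sec (inv\<^bsub>T\<^esub> s \<otimes>\<^bsub>T\<^esub> single x k \<otimes>\<^bsub>T\<^esub> s) z
      = sec (single y (inv\<^bsub>T\<^esub> (sec s x) \<otimes>\<^bsub>T\<^esub> k \<otimes>\<^bsub>T\<^esub> sec s x)) z"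
    proof (cases "z' = x")
      case True
      then show ?thesis using sec[of z'] z assms(4) by simp
    next
      case False
      then have "z \<noteq> y" using z assms(4) root_perm_inj[OF sT] by auto
      have "sec (inv\<^bsub>T\<^esub> s \<otimes>\<^bsub>T\<^esub> single x k \<otimes>\<^bsub>T\<^esub> s) z = id"
        using sec[of z'] z False sT by (simp add: one_T)
      also have "id = sec (single y (inv\<^bsub>T\<^esub> (sec s x) \<otimes>\<^bsub>T\<^esub> k \<otimes>\<^bsub>T\<^esub> sec s x)) z"
        unfolding sec_diag using \<open>z \<noteq> y\<close> by (rule if_not_P[symmetric])
      finally show ?thesis .
    qed
  qed (use assms sT k y in simp_all)
qed

end

section \<open>The generators and the action on the first level\<close>

locale hanoi_group = rooted_tree d for d :: nat +
  fixes m :: nat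
  assumes d_ge: "3 \<le> d" and m_ge: "2 \<le> m" and m_less: "m < d"
begin

abbreviation a where "a \<equiv> hanoi_gen d m"
abbreviation G where "G \<equiv> hanoi d m"
abbreviation lm where "lm \<equiv> letter_mod d"
definition G1 where "G1 = G \<inter> level_one_stab d"

lemma lm_in_X [simp]: "lm k \<in> X"
  using letter_mod_in[of d k] d_ge by (simp add: X_def)

lemma lm_id: "x \<in> X \<Longrightarrow> lm x = x"
  by (cases "x = d") (auto simp: letter_mod_def X_def)

lemma lm_eq_iff: "lm k = lm l \<longleftrightarrow> k mod d = l mod d"
proof -
  have "k mod d \<noteq> d" "l mod d \<noteq> d"
    using mod_less_divisor[of d k] mod_less_divisor[of d l] d_ge by linarith+
  then show ?thesis by (auto simp: letter_mod_def)
qed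

lemma lm_add: "lm (lm k + j) = lm (k + j)"
proof -
  have "lm k mod d = k mod d" using lm_eq_iff lm_id[OF lm_in_X] by metis
  then show ?thesis by (metis lm_eq_iff mod_add_left_eq)
qed

lemma lm_wrap: "lm (k + d) = lm k"
  by (simp add: lm_eq_iff)

text \<open>Letters are written relative to a fixed index \<open>i\<close> as \<open>lm (i + j)\<close> with \<open>0 \<le> j < d\<close> or \<open>1 \<le> j \<le> d\<close>, so that
  statements for all \<open>i\<close> do not have to distinguish where the numbering wraps around.\<close>

lemma lm_shift_eq_iff:
  assumes "i < d" "j < d"
  shows "lm (k + i) = lm (k + j) \<longleftrightarrow> i = j"
proof
  assume "lm (k + i) = lm (k + j)"
  then have "int d dvd int (k + i) - int (k + j)"
    unfolding lm_eq_iff by (metis mod_eq_dvd_iff of_nat_mod)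
  then have "int d dvd int i - int j" by simp
  moreover have "\<bar>int i - int j\<bar> < int d" using assms by auto
  ultimately show "i = j" using dvd_imp_le_int[of "int i - int j" "int d"] by fastforce
qed simp

lemma hanoi_cycle_lm: "hanoi_cycle d m (lm i) = hanoi_cycle d m i"
  by (simp add: hanoi_cycle_def lm_add cong: map_cong)

lemma a_in_T [simp]: "a i \<in> carrier T"
  by (rule hanoi_gen_in_tree_aut[OF m_less])

lemma root_a: "root_perm (a i) x = hanoi_cycle d m i x"
  using psi_hanoi_gen[OF m_less, of i] by (auto simp: psi_def root_perm_def dest: fun_cong)

lemma sec_a:
  assumes "i \<in> X"
  shows "sec (a i) x = (if x = i then a i else id)"
proof (cases "x \<in> X")
  case True
  have "(\<lambda>x\<in>X. sec (a i) x) x = (\<lambda>x\<in>X. if x = i then a i else id) x"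
    using psi_hanoi_gen[OF m_less, of i] by (simp only: psi_def prod.inject X_def)
  then show ?thesis using True by simp
qed (use assms sec_outside in auto)

lemma sec_a_lm [simp]: "sec (a (lm i)) x = (if x = lm i then a (lm i) else id)"
  by (rule sec_a[OF lm_in_X])

lemma root_a_step: "1 \<le> j \<Longrightarrow> j < m \<Longrightarrow> root_perm (a (lm i)) (lm (i + j)) = lm (i + (j + 1))"
  using hanoi_cycle_apply[OF m_less, of j i] by (simp add: root_a hanoi_cycle_lm)

lemma root_a_last: "root_perm (a (lm i)) (lm (i + m)) = lm (i + 1)"
  using hanoi_cycle_apply[OF m_less, of m i] m_ge by (simp add: root_a hanoi_cycle_lm)

lemma root_a_fix:
  assumes "m < j" "j \<le> d"
  shows "root_perm (a (lm i)) (lm (i + j)) = lm (i + j)"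
proof -
  have "lm (i + j) \<noteq> lm (i + k)" if "1 \<le> k" "k \<le> m" for k
    using that assms lm_shift_eq_iff[of j k i] lm_shift_eq_iff[of 0 k i] m_less lm_wrap[of i]
    by (cases "j = d") auto
  then have "lm (i + j) \<notin> set (map (\<lambda>j. letter_mod d (i + j)) [1..<m + 1])"
    by (fastforce simp del: upt_Suc)
  then show ?thesis
    unfolding root_a hanoi_cycle_lm unfolding hanoi_cycle_def by (rule id_outside_supp)
qed

lemma root_a_self:
  assumes "i \<in> X"
  shows "root_perm (a i) i = i"
proof -
  have "root_perm (a (lm i)) (lm (i + d)) = lm (i + d)"
    using m_less by (intro root_a_fix) auto
  then show ?thesis using assms by (simp add: lm_wrap lm_id)
qed

text \<open>As \<open>a\<^sub>i\<close> fixes the letter \<open>i\<close>, inverse generators have the same simple shape as generators.\<close>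

lemma sec_inv_a:
  assumes "i \<in> X"
  shows "sec (inv\<^bsub>T\<^esub> (a i)) x = (if x = i then inv\<^bsub>T\<^esub> (a i) else id)"
proof -
  define y where "y = root_perm (inv\<^bsub>T\<^esub> (a i)) x"
  have x: "root_perm (a i) y = x" by (simp add: y_def)
  have "x = i \<longleftrightarrow> y = i" using x root_perm_inj[of "a i" y i] root_a_self[OF assms] by auto
  then show ?thesis using sec_inv[OF a_in_T x] assms by (simp add: sec_a)
qed

lemma G_subgroup: "subgroup G T"
  unfolding hanoi_def by (rule T.generate_is_subgroup) auto

lemma G_in_T [simp]: "g \<in> G \<Longrightarrow> g \<in> carrier T"
  using subgroup.mem_carrier[OF G_subgroup] .

lemma G_closed [simp, intro]:
  "g \<in> G \<Longrightarrow> h \<in> G \<Longrightarrow> g \<otimes>\<^bsub>T\<^esub> h \<in> G"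
  "g \<in> G \<Longrightarrow> inv\<^bsub>T\<^esub> g \<in> G" "id \<in> G"
  using subgroup.m_closed[OF G_subgroup] subgroup.m_inv_closed[OF G_subgroup]
    subgroup.one_closed[OF G_subgroup] by (auto simp: one_T)

lemma a_in_G [simp]: "i \<in> X \<Longrightarrow> a i \<in> G"
  unfolding hanoi_def X_def by (auto intro: generate.incl)

lemma G_induct [consumes 1, case_names id gen inv mult]:
  assumes "g \<in> G" "P id" "\<And>i. i \<in> X \<Longrightarrow> P (a i)" "\<And>i. i \<in> X \<Longrightarrow> P (inv\<^bsub>T\<^esub> (a i))"
    and "\<And>g h. g \<in> G \<Longrightarrow> h \<in> G \<Longrightarrow> P g \<Longrightarrow> P h \<Longrightarrow> P (g \<otimes>\<^bsub>T\<^esub> h)"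
  shows "P g"
  using assms(1) unfolding hanoi_def
proof (induction rule: generate.induct)
  case one
  then show ?case using assms(2) one_T by metis
next
  case (eng h1 h2)
  then show ?case using assms(5) by (simp add: hanoi_def)
qed (use assms(3,4) in \<open>auto simp: X_def\<close>)

lemma G_subset:
  assumes "subgroup H T" "\<And>i. i \<in> X \<Longrightarrow> a i \<in> H"
  shows "G \<subseteq> H"
  unfolding hanoi_def using assms by (intro T.generate_subgroup_incl) (auto simp: X_def)

lemma sec_in_G [simp]: "g \<in> G \<Longrightarrow> sec g x \<in> G"
proof (induction arbitrary: x rule: G_induct)
  case (mult g h)
  then show ?case by (simp add: sec_mult)
qed (auto simp: sec_a sec_inv_a)

lemma self_similar_G: "self_similar d G"
proof -
  have "tree_section g v \<in> G" if "g \<in> G" "v \<in> vertices d" for g v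
    using that
  proof (induction v arbitrary: g)
    case Nil
    have "tree_section g [] = g" by (auto simp: tree_section_def)
    then show ?case using Nil by simp
  next
    case (Cons x v)
    have "tree_section g (x # v) = tree_section (sec g x) v"
      by (auto simp: tree_section_def fun_eq_iff)
    then show ?case using Cons by simp
  qed
  then show ?thesis using G_subgroup by (auto simp: self_similar_def)
qed

lemma G1_iff: "g \<in> G1 \<longleftrightarrow> g \<in> G \<and> (\<forall>x. root_perm g x = x)"
  by (auto simp: G1_def level_one_stab_iff)

text \<open>A generator moves only letters at which its section is trivial, and \<open>a\<^sub>i\<close> moves \<open>i + 1\<close> to \<open>i + 2\<close>.
  Because of this lemma, sections at different letters can be compared without conjugating them.\<close>

lemma transport_trivially:
  assumes "x \<in> X" "y \<in> X"
  shows "\<exists>s\<in>G. root_perm s x = y \<and> sec s x = id"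
proof -
  have step: "\<exists>s\<in>G. root_perm s (lm k) = lm (k + 1) \<and> sec s (lm k) = id" for k
  proof -
    define i where "i = k + d - 1"
    have "lm (i + 1) = lm k" "lm (i + (1 + 1)) = lm (k + 1)"
      using d_ge lm_wrap[of k] lm_wrap[of "k + 1"] by (auto simp: i_def)
    moreover have "lm (i + 1) \<noteq> lm (i + 0)" using d_ge lm_shift_eq_iff[of 1 0 i] by simp
    ultimately show ?thesis using root_a_step[of 1 i] m_ge by (intro bexI[of _ "a (lm i)"]) auto
  qed
  have "\<exists>s\<in>G. root_perm s (lm k) = lm (k + n) \<and> sec s (lm k) = id" for k n
  proof (induction n)
    case 0
    have "root_perm id (lm k) = lm (k + 0)" "sec id (lm k) = id" by simp_all
    then show ?case using G_closed(3) by blast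
  next
    case (Suc n)
    then obtain s t where "s \<in> G" "root_perm s (lm k) = lm (k + n)" "sec s (lm k) = id"
      "t \<in> G" "root_perm t (lm (k + n)) = lm (k + n + 1)" "sec t (lm (k + n)) = id"
      using step by blast
    then have "s \<otimes>\<^bsub>T\<^esub> t \<in> G" "root_perm (s \<otimes>\<^bsub>T\<^esub> t) (lm k) = lm (k + Suc n)"
      "sec (s \<otimes>\<^bsub>T\<^esub> t) (lm k) = id" by (simp_all add: root_perm_mult sec_mult)
    then show ?case by blast
  qed
  from this[of x "y + d - x"] show ?thesis
    using assms lm_wrap[of y] lm_id[of x] lm_id[of y] by (auto simp: X_def)
qed

text \<open>Whether a three-cycle lies in the group of first level actions does not depend on its
  orientation, so this is a predicate of the set of its three letters.\<close>

definition three_cycle :: "nat \<Rightarrow> nat \<Rightarrow> nat \<Rightarrow> (nat list \<Rightarrow> nat list) \<Rightarrow> bool" where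
  "three_cycle x y z g \<longleftrightarrow> g \<in> G \<and> root_perm g x = y \<and> root_perm g y = z \<and> root_perm g z = x \<and>
     (\<forall>u. u \<notin> {x, y, z} \<longrightarrow> root_perm g u = u)"

definition has_three_cycle :: "nat \<Rightarrow> nat \<Rightarrow> nat \<Rightarrow> bool" where
  "has_three_cycle x y z \<longleftrightarrow> x \<in> X \<and> y \<in> X \<and> z \<in> X \<and> distinct [x, y, z] \<and> (\<exists>g. three_cycle x y z g)"

lemma three_cycle_inv:
  assumes "three_cycle x y z g"
  shows "three_cycle z y x (inv\<^bsub>T\<^esub> g)"
proof -
  have g: "g \<in> G" "root_perm g x = y" "root_perm g y = z" "root_perm g z = x"
    "\<And>u. u \<notin> {x, y, z} \<Longrightarrow> root_perm g u = u"
    using assms by (auto simp: three_cycle_def)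
  note inv_eq = root_perm_inv_eq[OF G_in_T[OF g(1)]]
  have "root_perm (inv\<^bsub>T\<^esub> g) y = x" "root_perm (inv\<^bsub>T\<^esub> g) z = y"
    "root_perm (inv\<^bsub>T\<^esub> g) x = z" "\<And>u. u \<notin> {x, y, z} \<Longrightarrow> root_perm (inv\<^bsub>T\<^esub> g) u = u"
    using inv_eq[OF g(2)] inv_eq[OF g(3)] inv_eq[OF g(4)] inv_eq[OF g(5)] by simp_all
  then show ?thesis using g(1) by (simp add: three_cycle_def)
qed

lemma three_cycle_conj:
  assumes "three_cycle x y z g" "h \<in> G"
  shows "three_cycle (root_perm h x) (root_perm h y) (root_perm h z) (inv\<^bsub>T\<^esub> h \<otimes>\<^bsub>T\<^esub> g \<otimes>\<^bsub>T\<^esub> h)"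
proof -
  have "root_perm h (root_perm g (root_perm (inv\<^bsub>T\<^esub> h) u)) = u"
    if "u \<notin> {root_perm h x, root_perm h y, root_perm h z}" for u
  proof -
    have "root_perm (inv\<^bsub>T\<^esub> h) u \<notin> {x, y, z}"
      using that assms(2) root_perm_inv_right[of h u] by force
    then show ?thesis using assms by (simp add: three_cycle_def)
  qed
  then show ?thesis
    using assms by (auto simp: three_cycle_def root_perm_mult)
qed

lemma has_three_cycle_perm:
  "has_three_cycle x y z \<Longrightarrow> has_three_cycle y z x"
  "has_three_cycle x y z \<Longrightarrow> has_three_cycle z y x"
proof -
  assume *: "has_three_cycle x y z"
  then obtain g where "three_cycle x y z g" by (auto simp: has_three_cycle_def)
  moreover from this have "three_cycle y z x g" by (auto simp: three_cycle_def)
  ultimately have "\<exists>g. three_cycle y z x g" "\<exists>g. three_cycle z y x g"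
    using three_cycle_inv by blast+
  then show "has_three_cycle y z x" "has_three_cycle z y x"
    using * by (auto simp: has_three_cycle_def)
qed

lemma has_three_cycleD:
  assumes "has_three_cycle x y z"
  shows "x \<in> X" "y \<in> X" "z \<in> X" "x \<noteq> y" "x \<noteq> z" "y \<noteq> z"
  using assms by (auto simp: has_three_cycle_def)

lemma has_three_cycle_conj:
  assumes "has_three_cycle x y z" "three_cycle p q r g"
  shows "has_three_cycle (root_perm g x) (root_perm g y) (root_perm g z)"
proof -
  have g: "g \<in> G" using assms(2) by (simp add: three_cycle_def)
  have "\<exists>k. three_cycle (root_perm g x) (root_perm g y) (root_perm g z) k"
    using assms(1) three_cycle_conj[OF _ g] unfolding has_three_cycle_def by blast
  then show ?thesis
    using assms(1) root_in_X'[OF G_in_T[OF g]] root_perm_inj[OF G_in_T[OF g]]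
    unfolding has_three_cycle_def by simp
qed

text \<open>Conjugating \<open>(x y u)\<close> by \<open>(y z u)\<close> gives \<open>(x z y)\<close>.\<close>

lemma three_cycle_share_two:
  assumes "has_three_cycle x y u" "has_three_cycle y z u" "x \<noteq> z"
  shows "has_three_cycle x y z"
proof -
  obtain g where g: "three_cycle y z u g" using assms(2) by (auto simp: has_three_cycle_def)
  have "root_perm g x = x" "root_perm g y = z" "root_perm g u = y"
    using g assms by (auto simp: three_cycle_def has_three_cycle_def)
  then have "has_three_cycle x z y" using has_three_cycle_conj[OF assms(1) g] by simp
  then show ?thesis using has_three_cycle_perm by blast
qed

text \<open>Three-cycles whose supports overlap generate all three-cycles on the union of the supports.  Two
  of its letters are singled out here, because in this form the lemma says that lying in a common
  three-cycle is transitive.\<close>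

lemma three_cycle_merge:
  assumes "has_three_cycle x y u" "has_three_cycle y z v" "x \<noteq> z"
  shows "has_three_cycle x y z"
proof -
  note D = has_three_cycleD[OF assms(1)] has_three_cycleD[OF assms(2)]
  consider "u = z" | "v = x" | "u = v" | "u \<noteq> z" "v \<noteq> x" "u \<noteq> v" by blast
  then show ?thesis
  proof cases
    case 1
    then show ?thesis using assms(1) by simp
  next
    case 2
    then show ?thesis using assms(2) has_three_cycle_perm(1)[of y z x] has_three_cycle_perm(1)[of z x y] by simp
  next
    case 3
    then show ?thesis using three_cycle_share_two[of x y u z] assms by simp
  next
    case 4
    obtain g where g: "three_cycle x y u g" using assms(1) by (auto simp: has_three_cycle_def)
    have "root_perm g y = u" "root_perm g z = z" "root_perm g v = v"
      using g D 4 assms(3) by (auto simp: three_cycle_def)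
    \<comment> \<open>The supports share only \<open>y\<close>.  Conjugation makes them share two letters.\<close>
    then have "has_three_cycle u z v" using has_three_cycle_conj[OF assms(2) g] by simp
    then have "has_three_cycle z u v" using has_three_cycle_perm by meson
    then have "has_three_cycle y z u"
      using three_cycle_share_two[of y z v u] assms(2) D by simp
    then show ?thesis using three_cycle_share_two[of x y u z] assms(1,3) by simp
  qed
qed

text \<open>The cycles of \<open>a\<^sub>i\<close> and \<open>a\<^sub>i\<^sub>+\<^sub>1\<close> are \<open>(i + 1 \<dots> i + m)\<close> and \<open>(i + 2 \<dots> i + m + 1)\<close>, and their quotient is
  the three-cycle \<open>(i + 1, i + m + 1, i + m)\<close> for every \<open>m\<close>.\<close>

definition quot :: "nat \<Rightarrow> nat list \<Rightarrow> nat list" where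
  "quot i = a (lm i) \<otimes>\<^bsub>T\<^esub> inv\<^bsub>T\<^esub> (a (lm (i + 1)))"

lemma quot_in_G [simp]: "quot i \<in> G"
  by (simp add: quot_def)

lemma root_inv_a_step: "1 \<le> j \<Longrightarrow> j < m \<Longrightarrow> root_perm (inv\<^bsub>T\<^esub> (a (lm (i + 1)))) (lm (i + (j + 2))) = lm (i + (j + 1))"
  using root_a_step[of j "i + 1"] by (intro root_perm_inv_eq) (auto simp: add_ac)

lemma root_inv_a_last: "root_perm (inv\<^bsub>T\<^esub> (a (lm (i + 1)))) (lm (i + 2)) = lm (i + (m + 1))"
  using root_a_last[of "i + 1"] by (intro root_perm_inv_eq) (auto simp: add_ac)

lemma root_inv_a_fix:
  assumes "j = 1 \<or> m + 1 < j \<and> j \<le> d"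
  shows "root_perm (inv\<^bsub>T\<^esub> (a (lm (i + 1)))) (lm (i + j)) = lm (i + j)"
proof (intro root_perm_inv_eq)
  show "root_perm (a (lm (i + 1))) (lm (i + j)) = lm (i + j)"
    using root_a_fix[of "if j = 1 then d else j - 1" "i + 1"] assms m_less lm_wrap[of "i + 1"]
    by (auto simp: add_ac split: if_splits)
qed simp

lemma root_quot:
  shows "root_perm (quot i) (lm (i + 1)) = lm (i + (m + 1))"
    and "root_perm (quot i) (lm (i + m)) = lm (i + 1)"
    and "root_perm (quot i) (lm (i + (m + 1))) = lm (i + m)"
    and "2 \<le> j \<Longrightarrow> j < m \<or> m + 1 < j \<and> j \<le> d \<Longrightarrow> root_perm (quot i) (lm (i + j)) = lm (i + j)"
proof -
  have *: "root_perm (quot i) x = root_perm (inv\<^bsub>T\<^esub> (a (lm (i + 1)))) (root_perm (a (lm i)) x)" for x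
    by (simp add: quot_def root_perm_mult)
  show "root_perm (quot i) (lm (i + 1)) = lm (i + (m + 1))"
    using root_a_step[of 1 i] root_inv_a_last[of i] m_ge by (simp add: * numeral_2_eq_2)
  show "root_perm (quot i) (lm (i + m)) = lm (i + 1)"
    using root_a_last[of i] root_inv_a_fix[of 1 i] by (simp add: *)
  show "root_perm (quot i) (lm (i + (m + 1))) = lm (i + m)"
    using root_a_fix[of "m + 1" i] root_inv_a_step[of "m - 1" i] m_ge m_less by (auto simp: *)
  show "root_perm (quot i) (lm (i + j)) = lm (i + j)" if "2 \<le> j" "j < m \<or> m + 1 < j \<and> j \<le> d"
  proof (cases "j < m")
    case True
    then show ?thesis using root_a_step[of j i] root_inv_a_step[of "j - 1" i] that
      by (auto simp: *)
  next
    case False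
    then show ?thesis using root_a_fix[of j i] root_inv_a_fix[of j i] that by (auto simp: *)
  qed
qed

lemma sec_quot:
  "sec (quot i) x = (if x = lm i then a (lm i) else id) \<otimes>\<^bsub>T\<^esub>
     (if root_perm (a (lm i)) x = lm (i + 1) then inv\<^bsub>T\<^esub> (a (lm (i + 1))) else id)"
  by (simp add: quot_def sec_mult sec_inv_a)

lemma lm_cover:
  assumes "x \<in> X"
  shows "\<exists>j. 1 \<le> j \<and> j \<le> d \<and> x = lm (i + j)"
proof -
  define j where "j = (x + d * i - i) mod d"
  define j' where "j' = (if j = 0 then d else j)"
  have "1 * i \<le> d * i" using d_ge by (intro mult_right_mono) auto
  then have e: "x + d * i = i + (x + d * i - i)" by linarith
  have "lm (i + j') = lm (i + j)" by (simp add: j'_def lm_wrap)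
  also have "\<dots> = lm (x + d * i)"
    unfolding lm_eq_iff j_def by (subst (2) e) (simp add: mod_simps)
  also have "\<dots> = x" using assms lm_id lm_eq_iff[of "x + d * i" x] by simp
  finally have "x = lm (i + j')" by simp
  moreover have "1 \<le> j'" "j' \<le> d" using d_ge mod_less_divisor[of d] by (auto simp: j'_def j_def less_imp_le)
  ultimately show ?thesis by blast
qed

lemma three_cycle_quot: "has_three_cycle (lm (i + m)) (lm (i + 1)) (lm (i + (m + 1)))"
proof -
  have "lm (i + (m + 1)) \<noteq> lm (i + j)" if "1 \<le> j" "j \<le> m" for j
    using lm_shift_eq_iff[of "m + 1" j i] lm_shift_eq_iff[of 0 j i] that m_less lm_wrap[of i]
    by (cases "m + 1 = d") auto
  then have "lm (i + (m + 1)) \<noteq> lm (i + 1)" "lm (i + (m + 1)) \<noteq> lm (i + m)"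
    using m_ge by (metis one_le_numeral order.refl order_trans)+
  moreover have "lm (i + 1) \<noteq> lm (i + m)" using lm_shift_eq_iff[of 1 m i] m_ge m_less by auto
  moreover have "root_perm (quot i) u = u"
    if u: "u \<notin> {lm (i + m), lm (i + 1), lm (i + (m + 1))}" for u
  proof (cases "u \<in> X")
    case True
    then obtain j where j: "1 \<le> j" "j \<le> d" "u = lm (i + j)" using lm_cover by blast
    then have "j \<noteq> 1" "j \<noteq> m" "j \<noteq> m + 1" using u by auto
    then have "2 \<le> j" "j < m \<or> m + 1 < j \<and> j \<le> d" using j by auto
    then show ?thesis using root_quot(4)[of j i] j by simp
  qed (use root_outside in auto)
  ultimately show ?thesis
    using root_quot(1-3)[of i] m_ge unfolding has_three_cycle_def three_cycle_def
    by (intro conjI exI[of _ "quot i"]) auto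
qed

text \<open>The support of \<open>quot i\<close> contains the consecutive letters \<open>i + m\<close> and \<open>i + m + 1\<close>.  So any two letters
  lie in a common three-cycle, and \<open>three_cycle_merge\<close> does the rest.\<close>

lemma all_three_cycles:
  assumes "x \<in> X" "y \<in> X" "z \<in> X" "distinct [x, y, z]"
  shows "has_three_cycle x y z"
proof -
  define E where "E u v \<longleftrightarrow> u = v \<or> (\<exists>w. has_three_cycle u v w)" for u v
  have E_trans: "E u w" if "E u v" "E v w" for u v w
  proof (cases "u = v \<or> v = w \<or> u = w")
    case False
    then have "has_three_cycle u v w" using that three_cycle_merge by (auto simp: E_def)
    then have "has_three_cycle u w v" using has_three_cycle_perm by meson
    then show ?thesis by (auto simp: E_def)
  qed (use that in \<open>auto simp: E_def\<close>)
  have step: "E (lm k) (lm (k + 1))" for k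
  proof -
    define i where "i = k + d - m"
    have "lm (i + m) = lm k" "lm (i + (m + 1)) = lm (k + 1)"
      using m_less lm_wrap[of k] lm_wrap[of "k + 1"] by (auto simp: i_def)
    then show ?thesis
      using has_three_cycle_perm(1)[OF has_three_cycle_perm(1)[OF has_three_cycle_perm(2)[OF three_cycle_quot[of i]]]]
      unfolding E_def by auto
  qed
  have "E (lm k) (lm (k + n))" for k n
    by (induction n) (use step E_trans in \<open>auto simp: E_def\<close>)
  then have "E (lm u) (lm (u + (v + d - u)))" for u v by blast
  moreover have "lm (u + (v + d - u)) = v" "lm u = u" if "u \<in> X" "v \<in> X" for u v
    using that lm_wrap[of v] lm_id by (auto simp: X_def)
  ultimately have E: "E u v" if "u \<in> X" "v \<in> X" for u v
    using that by metis
  then obtain u v where "has_three_cycle x y u" "has_three_cycle y z v"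
    using assms unfolding E_def by (metis distinct_length_2_or_more)
  then show ?thesis using three_cycle_merge assms(4) by simp
qed

section \<open>Elements of the first level stabilizer with prescribed sections\<close>

lemma sec_quot_lm:
  assumes "1 \<le> j" "j \<le> d"
  shows "sec (quot i) (lm (i + j)) =
    (if j = m then inv\<^bsub>T\<^esub> (a (lm (i + 1))) else if j = d then a (lm i) else id)"
proof -
  have "lm (i + j) = lm i \<longleftrightarrow> j = d"
    using lm_shift_eq_iff[of j 0 i] assms lm_wrap[of i] by (cases "j = d") auto
  moreover have "root_perm (a (lm i)) (lm (i + j)) = lm (i + 1) \<longleftrightarrow> j = m"
  proof -
    have "root_perm (a (lm i)) (lm (i + j)) = lm (i + 1) \<longleftrightarrow> lm (i + j) = lm (i + m)"
      using root_perm_inj[OF a_in_T, of "lm i"] root_a_last by metis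
    also have "\<dots> \<longleftrightarrow> j = m"
      using lm_shift_eq_iff[of j m i] lm_shift_eq_iff[of 0 m i] assms lm_wrap[of i] m_less m_ge
      by (cases "j = d") auto
    finally show ?thesis .
  qed
  ultimately show ?thesis unfolding sec_quot using m_less by auto
qed

lemma hanoi_cycle_pow: "(hanoi_cycle d m i ^^ m) x = x"
proof -
  define cs where "cs = map (\<lambda>j. lm (i + j)) [1..<m + 1]"
  have len: "length cs = m" by (simp add: cs_def)
  have cs: "hanoi_cycle d m i = cycle_of_list cs" by (simp add: hanoi_cycle_def cs_def)
  show ?thesis
  proof (cases "x \<in> set cs")
    case True
    then obtain k where "k < length cs" "x = cs ! k" by (metis in_set_conv_nth)
    moreover have "map (cycle_of_list cs ^^ m) cs = cs"
      using cyclic_rotation[of cs m] distinct_hanoi_cycle[OF m_less] len by (simp add: cs_def)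
    ultimately show ?thesis unfolding cs by (metis nth_map)
  next
    case False
    then have "cycle_of_list cs x = x" by (rule id_outside_supp)
    then have "(cycle_of_list cs ^^ n) x = x" for n by (induction n) auto
    then show ?thesis unfolding cs by blast
  qed
qed

text \<open>The power has trivial action on the letters and itself as its only section that could be
  nontrivial, so it fixes every word by induction on the length.\<close>

lemma a_pow_m:
  assumes i: "i \<in> X"
  shows "a i [^]\<^bsub>T\<^esub> m = id"
proof
  have root: "root_perm (a i [^]\<^bsub>T\<^esub> n) x = (hanoi_cycle d m i ^^ n) x" for n :: nat and x
    by (induction n arbitrary: x) (simp_all add: root_perm_mult root_a one_T)
  have fixed: "(hanoi_cycle d m i ^^ n) i = i" for n
    using root_a_self[OF i] by (induction n) (simp_all add: root_a)
  have fixed_iff: "(hanoi_cycle d m i ^^ n) x = i \<longleftrightarrow> x = i" for n x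
    using fixed[of n] root[of n] root_perm_inj[of "a i [^]\<^bsub>T\<^esub> n" x i] by simp
  have sec: "sec (a i [^]\<^bsub>T\<^esub> n) x = (if x = i then a i [^]\<^bsub>T\<^esub> n else id)" for n :: nat and x
    by (induction n) (simp_all add: sec_mult root sec_a[OF i] fixed_iff one_T sec_id[unfolded id_def])
  fix w
  show "(a i [^]\<^bsub>T\<^esub> m) w = id w"
  proof (induction w rule: list.induct)
    case Nil
    then show ?case using in_T(2)[of "a i [^]\<^bsub>T\<^esub> m"] by simp
  next
    case (Cons x w)
    show ?case
    proof (cases "x # w \<in> vertices d")
      case True
      then show ?thesis
        using aut_Cons[of "a i [^]\<^bsub>T\<^esub> m" w x] Cons by (simp add: sec root hanoi_cycle_pow)
    next
      case False
      then show ?thesis using aut_not_vertex[of "a i [^]\<^bsub>T\<^esub> m"] by simp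
    qed
  qed
qed

text \<open>A seed has the same section at \<open>p\<close> and \<open>q\<close> and the trivial section at \<open>s\<close>; nothing is required at
  other letters.  The comparison of \<open>p\<close> with \<open>q\<close> and \<open>s\<close> is what produces opposite pairs, and the exact
  triviality at \<open>s\<close> is what starts the induction for \<open>F(x, Y) = G\<close>.\<close>

definition seed :: "nat \<Rightarrow> bool" where
  "seed j \<longleftrightarrow> (\<exists>u\<in>G1. \<exists>p\<in>X. \<exists>q\<in>X. \<exists>s\<in>X. distinct [p, q, s] \<and>
     sec u p \<in> {a j, inv\<^bsub>T\<^esub> (a j)} \<and> sec u q = sec u p \<and> sec u s = id)"

lemma seedI:
  assumes "u \<in> G" "\<forall>x\<in>X. root_perm u x = x" "p \<in> X" "q \<in> X" "s \<in> X" "distinct [p, q, s]"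
    "sec u p = b" "sec u q = b" "sec u s = id" "b \<in> {a j, inv\<^bsub>T\<^esub> (a j)}"
  shows "seed j"
  unfolding seed_def
proof (intro bexI conjI)
  show "u \<in> G1"
    unfolding G1_iff using assms(1,2) root_outside[OF G_in_T[OF assms(1)]] by blast
  show "distinct [p, q, s]" "sec u p \<in> {a j, inv\<^bsub>T\<^esub> (a j)}" "sec u q = sec u p" "sec u s = id"
    using assms(6-10) by simp_all
qed (use assms in auto)

lemma lm_cases:
  assumes "x \<in> X" "\<And>j. 1 \<le> j \<Longrightarrow> j \<le> d \<Longrightarrow> P (lm (i + j))"
  shows "P x"
  using lm_cover[OF assms(1), of i] assms(2) by blast

text \<open>The seed is the cube of \<open>quot i\<close>.  The only nontrivial section of \<open>quot i\<close> along its three-cycle is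
  \<open>inv a\<^sub>i\<^sub>+\<^sub>1\<close>, at \<open>i + m\<close>, so the cube has this section at all three letters.  The only other letter with
  a nontrivial section is \<open>i\<close>, and the trivial section is found at any fifth letter: \<open>i + 2\<close> is one
  unless \<open>m = 2\<close>, when it belongs to the three-cycle.\<close>

lemma seed_short_cycles:
  assumes d: "5 \<le> d" and m: "m + 1 < d"
  shows "seed (lm (i + 1))"
proof (rule seedI)
  let ?u = "quot i \<otimes>\<^bsub>T\<^esub> quot i \<otimes>\<^bsub>T\<^esub> quot i"
  show "?u \<in> G" by simp
  have root: "root_perm ?u x = root_perm (quot i) (root_perm (quot i) (root_perm (quot i) x))" for x
    by (simp add: root_perm_mult)
  have sec: "sec ?u x = sec (quot i) x \<otimes>\<^bsub>T\<^esub> sec (quot i) (root_perm (quot i) x) \<otimes>\<^bsub>T\<^esub>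
      sec (quot i) (root_perm (quot i) (root_perm (quot i) x))" for x
    by (simp add: sec_mult root_perm_mult)
  show "\<forall>x\<in>X. root_perm ?u x = x"
  proof (rule ballI, erule lm_cases)
    fix j assume j: "1 \<le> j" "j \<le> d"
    consider "j = 1" | "j = m" | "j = m + 1" | "2 \<le> j" "j < m \<or> m + 1 < j \<and> j \<le> d" using j by linarith
    then show "root_perm ?u (lm (i + j)) = lm (i + j)"
      unfolding root by cases (simp_all only: root_quot)
  qed
  show "distinct [lm (i + 1), lm (i + (m + 1)), lm (i + (if m = 2 then 4 else 2))]"
    using d m m_ge lm_shift_eq_iff[of 1 2 i] lm_shift_eq_iff[of 1 4 i] lm_shift_eq_iff[of 1 "m + 1" i]
      lm_shift_eq_iff[of "m + 1" 2 i] lm_shift_eq_iff[of "m + 1" 4 i] by auto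
  have 1: "sec (quot i) (lm (i + 1)) = id" "sec (quot i) (lm (i + (m + 1))) = id"
    "sec (quot i) (lm (i + m)) = inv\<^bsub>T\<^esub> (a (lm (i + 1)))"
    using m m_ge by (subst sec_quot_lm; simp)+
  show "sec ?u (lm (i + 1)) = inv\<^bsub>T\<^esub> (a (lm (i + 1)))" "sec ?u (lm (i + (m + 1))) = inv\<^bsub>T\<^esub> (a (lm (i + 1)))"
    unfolding sec root_quot 1 by simp_all
  show "sec ?u (lm (i + (if m = 2 then 4 else 2))) = id"
  proof -
    let ?j = "if m = 2 then 4 else 2 :: nat"
    have "root_perm (quot i) (lm (i + ?j)) = lm (i + ?j)"
      using d m m_ge by (intro root_quot) auto
    moreover have "sec (quot i) (lm (i + ?j)) = id"
      using d m m_ge by (subst sec_quot_lm) auto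
    ultimately show ?thesis unfolding sec by (simp only: id_mult)
  qed
qed auto

text \<open>For \<open>m = d - 1\<close> the letter \<open>i\<close> belongs to the three-cycle of \<open>quot i\<close>, and the cube has conjugates of
  \<open>a\<^sub>i (inv a\<^sub>i\<^sub>+\<^sub>1)\<close> as sections.  Instead, \<open>quot i\<close> and \<open>quot (i + 1)\<close> act as \<open>(i + 1, i, i - 1)\<close> and
  \<open>(i + 2, i + 1, i)\<close>; their product is an involution on the letters, and its square has section
  \<open>inv a\<^sub>i\<^sub>+\<^sub>2\<close> at \<open>i + 1\<close> and \<open>i + 2\<close>, section \<open>a\<^sub>i\<close> at \<open>i - 1\<close> and \<open>i\<close>, and trivial sections elsewhere,
  in particular at \<open>i + 3\<close>.\<close>

lemma seed_long_cycles:
  assumes d: "5 \<le> d" and m: "m + 1 = d"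
  shows "seed (lm (i + 2))"
proof (rule seedI)
  let ?t = "quot i" and ?s = "quot (i + 1)"
  let ?u = "?t \<otimes>\<^bsub>T\<^esub> ?s \<otimes>\<^bsub>T\<^esub> ?t \<otimes>\<^bsub>T\<^esub> ?s"
  show "?u \<in> G" by simp
  have root: "root_perm ?u x = root_perm ?s (root_perm ?t (root_perm ?s (root_perm ?t x)))" for x
    by (simp add: root_perm_mult)
  have sec: "sec ?u x = sec ?t x \<otimes>\<^bsub>T\<^esub> sec ?s (root_perm ?t x) \<otimes>\<^bsub>T\<^esub>
      sec ?t (root_perm ?s (root_perm ?t x)) \<otimes>\<^bsub>T\<^esub> sec ?s (root_perm ?t (root_perm ?s (root_perm ?t x)))" for x
    by (simp add: sec_mult root_perm_mult)
  have md: "m = d - 1" using m by simp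
  have wrap: "lm (i + 1 + d) = lm (i + 1)" "lm (i + 1 + m) = lm (i + d)"
    using lm_wrap[of "i + 1"] by (simp_all add: add_ac flip: m)
  have t: "root_perm ?t (lm (i + 1)) = lm (i + d)" "root_perm ?t (lm (i + d)) = lm (i + (d - 1))"
    "root_perm ?t (lm (i + (d - 1))) = lm (i + 1)"
    "\<And>j. 2 \<le> j \<Longrightarrow> j < d - 1 \<Longrightarrow> root_perm ?t (lm (i + j)) = lm (i + j)"
  proof -
    show "root_perm ?t (lm (i + j)) = lm (i + j)" if "2 \<le> j" "j < d - 1" for j
      using root_quot(4)[of j i] that m by (simp add: md)
  qed (use root_quot(1-3)[of i] m in \<open>simp_all add: md\<close>)
  have s: "root_perm ?s (lm (i + 2)) = lm (i + 1)" "root_perm ?s (lm (i + 1)) = lm (i + d)"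
    "root_perm ?s (lm (i + d)) = lm (i + 2)"
    "\<And>j. 3 \<le> j \<Longrightarrow> j < d \<Longrightarrow> root_perm ?s (lm (i + j)) = lm (i + j)"
  proof -
    show "root_perm ?s (lm (i + 2)) = lm (i + 1)"
    proof -
      have "i + 1 + (m + 1) = i + 1 + d" using m by simp
      then show ?thesis using root_quot(1)[of "i + 1"] wrap(1) by (simp add: numeral_2_eq_2)
    qed
    show "root_perm ?s (lm (i + 1)) = lm (i + d)"
    proof -
      have "i + 1 + (m + 1) = i + 1 + d" "i + 1 + m = i + d" using m by simp_all
      then show ?thesis using root_quot(3)[of "i + 1"] wrap(1) by metis
    qed
    show "root_perm ?s (lm (i + d)) = lm (i + 2)"
    proof -
      have "i + 1 + 1 = i + 2" by simp
      then show ?thesis using root_quot(2)[of "i + 1"] wrap(2) by metis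
    qed
    show "root_perm ?s (lm (i + j)) = lm (i + j)" if "3 \<le> j" "j < d" for j
    proof -
      have "2 \<le> j - 1" "j - 1 < m" "i + 1 + (j - 1) = i + j" using m that by linarith+
      then show ?thesis using root_quot(4)[of "j - 1" "i + 1"] by simp
    qed
  qed
  have st: "sec ?t (lm (i + j)) = (if j = d - 1 then inv\<^bsub>T\<^esub> (a (lm (i + 1))) else if j = d then a (lm i) else id)"
    if "1 \<le> j" "j \<le> d" for j
    using sec_quot_lm[OF that, of i] by (simp add: md)
  have ss: "sec ?s (lm (i + 1)) = a (lm (i + 1))" "sec ?s (lm (i + d)) = inv\<^bsub>T\<^esub> (a (lm (i + 2)))"
    "\<And>j. 2 \<le> j \<Longrightarrow> j < d \<Longrightarrow> sec ?s (lm (i + j)) = id"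
  proof -
    show "sec ?s (lm (i + 1)) = a (lm (i + 1))"
      using sec_quot_lm[of d "i + 1"] m wrap by auto
    show "sec ?s (lm (i + d)) = inv\<^bsub>T\<^esub> (a (lm (i + 2)))"
      using sec_quot_lm[of m "i + 1"] m wrap m_ge by (simp add: numeral_2_eq_2)
    show "sec ?s (lm (i + j)) = id" if "2 \<le> j" "j < d" for j
    proof -
      have "1 \<le> j - 1" "j - 1 \<le> d" "j - 1 \<noteq> m" "j - 1 \<noteq> d" "i + 1 + (j - 1) = i + j"
        using m that by linarith+
      then show ?thesis using sec_quot_lm[of "j - 1" "i + 1"] by simp
    qed
  qed
  show "\<forall>x\<in>X. root_perm ?u x = x"
  proof (rule ballI, erule lm_cases)
    fix j assume j: "1 \<le> j" "j \<le> d"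
    consider "j = 1" | "j = 2" | "j = d" | "j = d - 1" | "3 \<le> j" "j < d - 1" using j by linarith
    moreover have "root_perm ?t (lm (i + 2)) = lm (i + 2)" "root_perm ?s (lm (i + (d - 1))) = lm (i + (d - 1))"
      using d by (intro t(4) s(4); linarith)+
    moreover have "root_perm ?s (lm (i + j)) = lm (i + j)" "root_perm ?t (lm (i + j)) = lm (i + j)"
      if "3 \<le> j" "j < d - 1" using that by (intro t(4) s(4); linarith)+
    ultimately show "root_perm ?u (lm (i + j)) = lm (i + j)"
      unfolding root by cases (simp_all only: t(1-3) s(1-3))
  qed
  show "distinct [lm (i + 1), lm (i + 2), lm (i + 3)]"
    using lm_shift_eq_iff[of 1 2 i] lm_shift_eq_iff[of 1 3 i] lm_shift_eq_iff[of 2 3 i] d by simp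
  have 1: "sec ?t (lm (i + 1)) = id" "sec ?t (lm (i + 2)) = id" "sec ?t (lm (i + 3)) = id"
  proof -
    have "1 \<noteq> d - 1" "2 \<noteq> d - 1" "3 \<noteq> d - 1" using d by linarith+
    then show "sec ?t (lm (i + 1)) = id" "sec ?t (lm (i + 2)) = id" "sec ?t (lm (i + 3)) = id"
      using d st[of 1] st[of 2] st[of 3] by simp_all
  qed
  have 2: "root_perm ?t (lm (i + 2)) = lm (i + 2)" "root_perm ?t (lm (i + 3)) = lm (i + 3)"
    "root_perm ?s (lm (i + 3)) = lm (i + 3)" "sec ?s (lm (i + 2)) = id" "sec ?s (lm (i + 3)) = id"
    using d by (intro t(4) s(4) ss(3); linarith)+
  show "sec ?u (lm (i + 1)) = inv\<^bsub>T\<^esub> (a (lm (i + 2)))"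
    "sec ?u (lm (i + 2)) = inv\<^bsub>T\<^esub> (a (lm (i + 2)))" "sec ?u (lm (i + 3)) = id"
    unfolding sec t(1-3) s(1-3) 1 2 ss(1,2) by simp_all
qed auto

lemma root_inv_a: "root_perm (inv\<^bsub>T\<^esub> (a i)) x = inv_into UNIV (hanoi_cycle d m i) x"
proof -
  have "root_perm (a i) (root_perm (inv\<^bsub>T\<^esub> (a i)) x) = x" by simp
  then have "hanoi_cycle d m i (root_perm (inv\<^bsub>T\<^esub> (a i)) x) = x" by (simp add: root_a)
  then show ?thesis
    using permutes_inj[OF hanoi_cycle_permutes[OF m_less]] by (metis inv_f_f)
qed

lemmas word_simps = root_perm_mult sec_mult root_a sec_a sec_inv_a

lemma X_4: "d = 4 \<Longrightarrow> X = {1, 2, 3, 4}"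
  unfolding X_def by auto

lemma X_3: "d = 3 \<Longrightarrow> X = {1, 2, 3}"
  unfolding X_def by auto

text \<open>With four letters there is no fifth one to carry the trivial section, and the seeds are found by
  hand.\<close>

lemma hanoi_cycle_four:
  assumes "d = 4"
  shows "m = 2 \<Longrightarrow> i \<in> X \<Longrightarrow> hanoi_cycle d m i x =
      (if i = 1 then if x = 2 then 3 else if x = 3 then 2 else x
       else if i = 2 then if x = 3 then 4 else if x = 4 then 3 else x
       else if i = 3 then if x = 4 then 1 else if x = 1 then 4 else x
       else if x = 1 then 2 else if x = 2 then 1 else x)"
    and "m = 3 \<Longrightarrow> i \<in> X \<Longrightarrow> hanoi_cycle d m i x =
      (if i = 1 then if x = 2 then 3 else if x = 3 then 4 else if x = 4 then 2 else x
       else if i = 2 then if x = 3 then 4 else if x = 4 then 1 else if x = 1 then 3 else x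
       else if i = 3 then if x = 4 then 1 else if x = 1 then 2 else if x = 2 then 4 else x
       else if x = 1 then 2 else if x = 2 then 3 else if x = 3 then 1 else x)"
proof -
  have up: "[1..<2 + 1] = [1, 2::nat]" "[1..<3 + 1] = [1, 2, 3::nat]" by (simp_all add: upt_rec)
  have lm: "letter_mod 4 (Suc (Suc 0)) = 2" "letter_mod 4 (Suc (Suc (Suc 0))) = 3" "letter_mod 4 2 = 2" "letter_mod 4 3 = 3" "letter_mod 4 4 = 4" "letter_mod 4 5 = 1"
    "letter_mod 4 6 = 2" "letter_mod 4 7 = 3" by (simp_all add: letter_mod_def)
  assume "i \<in> X"
  then consider "i = 1" | "i = 2" | "i = 3" | "i = 4" by (auto simp: X_4[OF assms])
  note i = this
  show "hanoi_cycle d m i x =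
      (if i = 1 then if x = 2 then 3 else if x = 3 then 2 else x
       else if i = 2 then if x = 3 then 4 else if x = 4 then 3 else x
       else if i = 3 then if x = 4 then 1 else if x = 1 then 4 else x
       else if x = 1 then 2 else if x = 2 then 1 else x)" if "m = 2"
    using i by cases (simp_all only: hanoi_cycle_def assms that up, simp_all add: lm transpose_def)
  show "hanoi_cycle d m i x =
      (if i = 1 then if x = 2 then 3 else if x = 3 then 4 else if x = 4 then 2 else x
       else if i = 2 then if x = 3 then 4 else if x = 4 then 1 else if x = 1 then 3 else x
       else if i = 3 then if x = 4 then 1 else if x = 1 then 2 else if x = 2 then 4 else x
       else if x = 1 then 2 else if x = 2 then 3 else if x = 3 then 1 else x)" if "m = 3"
    using i by cases (simp_all only: hanoi_cycle_def assms that up, simp_all add: lm transpose_def)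
qed

lemma inv_hanoi_cycle_four:
  assumes d: "d = 4" and m: "m = 3" and i: "i \<in> X"
  shows "inv_into UNIV (hanoi_cycle d m i) x =
      (if i = 1 then if x = 3 then 2 else if x = 4 then 3 else if x = 2 then 4 else x
       else if i = 2 then if x = 4 then 3 else if x = 1 then 4 else if x = 3 then 1 else x
       else if i = 3 then if x = 1 then 4 else if x = 2 then 1 else if x = 4 then 2 else x
       else if x = 2 then 1 else if x = 3 then 2 else if x = 1 then 3 else x)" (is "_ = ?r")
proof (rule inv_f_eq)
  show "inj (hanoi_cycle d m i)" by (rule permutes_inj[OF hanoi_cycle_permutes[OF m_less]])
  show "hanoi_cycle d m i ?r = x" using i by (simp add: hanoi_cycle_four(2)[OF d m i] X_4[OF d])
qed

lemma in_X_4: "d = 4 \<Longrightarrow> 1 \<in> X" "d = 4 \<Longrightarrow> 2 \<in> X" "d = 4 \<Longrightarrow> 3 \<in> X" "d = 4 \<Longrightarrow> 4 \<in> X"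
  unfolding X_def by auto

lemma ball_X_4: "d = 4 \<Longrightarrow> (\<forall>x\<in>X. P x) \<longleftrightarrow> P 1 \<and> P 2 \<and> P 3 \<and> P 4"
  using X_4 by auto

text \<open>The transpositions \<open>(i + 1, i + 2)\<close> close up to a square.  Moving along three sides of it equals the
  fourth side: \<open>a\<^sub>i a\<^sub>i\<^sub>+\<^sub>1 a\<^sub>i\<^sub>+\<^sub>2 a\<^sub>i\<^sub>+\<^sub>1 a\<^sub>i\<close> and \<open>a\<^sub>i\<^sub>+\<^sub>3\<close> have the same action on the letters.  The sections of
  the resulting relator at \<open>i, \<dots>, i + 3\<close> are \<open>a\<^sub>i\<close>, \<open>a\<^sub>i\<close>, \<open>a\<^sub>i\<^sub>+\<^sub>1\<^sup>2 = 1\<close> and \<open>a\<^sub>i\<^sub>+\<^sub>2 a\<^sub>i\<^sub>+\<^sub>3\<close>.\<close>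

lemma seed_four_two:
  assumes d: "d = 4" and m: "m = 2" and j: "j \<in> X"
  shows "seed j"
proof -
  note c = hanoi_cycle_four(1)[OF d m]
  have a_sq: "a i \<otimes>\<^bsub>T\<^esub> a i = id" if "i \<in> X" for i using a_pow_m[OF that] m by (simp add: numeral_2_eq_2 one_T)
  note X = in_X_4[OF d]
  let ?w = "\<lambda>i j k l. a i \<otimes>\<^bsub>T\<^esub> a j \<otimes>\<^bsub>T\<^esub> a k \<otimes>\<^bsub>T\<^esub> a j \<otimes>\<^bsub>T\<^esub> a i \<otimes>\<^bsub>T\<^esub> a l"
  have "seed 1"
    by (rule seedI[of "?w 1 2 3 4" 1 2 3 "a 1"]) (unfold ball_X_4[OF d], simp_all add: X word_simps c T.m_assoc one_T a_sq del: One_nat_def)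
  moreover have "seed 2"
    by (rule seedI[of "?w 2 3 4 1" 2 3 4 "a 2"]) (unfold ball_X_4[OF d], simp_all add: X word_simps c T.m_assoc one_T a_sq del: One_nat_def)
  moreover have "seed 3"
    by (rule seedI[of "?w 3 4 1 2" 3 4 1 "a 3"]) (unfold ball_X_4[OF d], simp_all add: X word_simps c T.m_assoc one_T a_sq del: One_nat_def)
  moreover have "seed 4"
    by (rule seedI[of "?w 4 1 2 3" 4 1 2 "a 4"]) (unfold ball_X_4[OF d], simp_all add: X word_simps c T.m_assoc one_T a_sq del: One_nat_def)
  ultimately show ?thesis using j by (auto simp: X_4[OF d])
qed

text \<open>The words have sections \<open>inv a\<^sub>i\<close> at \<open>i + 2\<close> and \<open>i + 3\<close>, the trivial section at \<open>i + 1\<close>, and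
  \<open>inv a\<^sub>i\<^sub>+\<^sub>1 a\<^sub>i\<^sub>+\<^sub>2\<close> at \<open>i\<close>.  Each is a product of two words of length four that act trivially on the
  letters and whose sections at \<open>i + 1\<close> are \<open>a\<^sub>i\<^sub>+\<^sub>1\<close> and its inverse, which cancel.\<close>

lemma seed_four_three:
  assumes d: "d = 4" and m: "m = 3" and j: "j \<in> X"
  shows "seed j"
proof -
  note c = hanoi_cycle_four(2)[OF d m] root_inv_a inv_hanoi_cycle_four[OF d m]
  note X = in_X_4[OF d]
  let ?i = "\<lambda>j. inv\<^bsub>T\<^esub> (a j)"
  let ?w = "\<lambda>i j k l. a j \<otimes>\<^bsub>T\<^esub> ?i i \<otimes>\<^bsub>T\<^esub> ?i j \<otimes>\<^bsub>T\<^esub> ?i l \<otimes>\<^bsub>T\<^esub> ?i j \<otimes>\<^bsub>T\<^esub> ?i i \<otimes>\<^bsub>T\<^esub> a k \<otimes>\<^bsub>T\<^esub> a l"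
  have "seed 1"
    by (rule seedI[of "?w 1 2 3 4" 3 4 2 "?i 1"]) (unfold ball_X_4[OF d], simp_all add: X word_simps c T.m_assoc one_T del: One_nat_def)
  moreover have "seed 2"
    by (rule seedI[of "?w 2 3 4 1" 4 1 3 "?i 2"]) (unfold ball_X_4[OF d], simp_all add: X word_simps c T.m_assoc one_T del: One_nat_def)
  moreover have "seed 3"
    by (rule seedI[of "?w 3 4 1 2" 1 2 4 "?i 3"]) (unfold ball_X_4[OF d], simp_all add: X word_simps c T.m_assoc one_T del: One_nat_def)
  moreover have "seed 4"
    by (rule seedI[of "?w 4 1 2 3" 2 3 1 "?i 4"]) (unfold ball_X_4[OF d], simp_all add: X word_simps c T.m_assoc one_T del: One_nat_def)
  ultimately show ?thesis using j by (auto simp: X_4[OF d])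
qed

lemma seeds:
  assumes "4 \<le> d" "j \<in> X"
  shows "seed j"
proof -
  have lm: "lm (j + d - k + k) = j" if "k < d" for k
    using assms(2) that lm_wrap[of j] lm_id by simp
  consider "d = 4" "m = 2" | "d = 4" "m = 3" | "5 \<le> d" "m + 1 < d" | "5 \<le> d" "m + 1 = d"
    using assms m_ge m_less by linarith
  then show ?thesis
  proof cases
    case 3
    then show ?thesis using seed_short_cycles[of "j + d - 1"] lm[of 1] by simp
  next
    case 4
    then show ?thesis using seed_long_cycles[of "j + d - 2"] lm[of 2] by simp
  qed (use seed_four_two seed_four_three assms in auto)
qed

section \<open>Strong fractality\<close>

lemma hanoi_cycle_three:
  assumes d: "d = 3"
  shows "hanoi_cycle d m 1 = transpose 2 3" "hanoi_cycle d m 2 = transpose 3 1"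
    "hanoi_cycle d m 3 = transpose 1 2"
proof -
  have m: "m = 2" using d m_ge m_less by simp
  have up: "[1..<2 + 1] = [1, 2::nat]" by (simp_all add: upt_rec)
  have lm: "letter_mod 3 (Suc (Suc 0)) = 2" "letter_mod 3 (Suc (Suc (Suc 0))) = 3"
    "letter_mod 3 3 = 3" "letter_mod 3 4 = 1" "letter_mod 3 5 = 2"
    by (simp_all add: letter_mod_def)
  show "hanoi_cycle d m 1 = transpose 2 3" "hanoi_cycle d m 2 = transpose 3 1"
    "hanoi_cycle d m 3 = transpose 1 2"
    by (simp_all only: hanoi_cycle_def d m up, simp_all add: lm)
qed

text \<open>The generator \<open>a\<^sub>i\<close> acts as the transposition of the two letters other than \<open>i\<close>, and so does the product
  \<open>a\<^sub>i\<^sub>-\<^sub>1 a\<^sub>i a\<^sub>i\<^sub>+\<^sub>1\<close>, which moves \<open>i\<close> around the triangle and has trivial section at \<open>i\<close>.\<close>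

lemma fractal_three_letters:
  assumes d: "d = 3" and j: "j \<in> X"
  shows "\<exists>u\<in>G1. sec u j = a j"
proof -
  note c = hanoi_cycle_three[OF d]
  have X: "1 \<in> X" "2 \<in> X" "3 \<in> X" using X_3[OF d] by auto
  let ?w = "\<lambda>i j k. a i \<otimes>\<^bsub>T\<^esub> a j \<otimes>\<^bsub>T\<^esub> a i \<otimes>\<^bsub>T\<^esub> a k"
  have *: "\<exists>u\<in>G1. sec u j = a j"
    if "u \<in> G" "sec u j = a j" "root_perm u 1 = 1" "root_perm u 2 = 2" "root_perm u 3 = 3" for u j
  proof -
    have "root_perm u x = x" for x
      using that(3-5) root_outside[OF G_in_T[OF that(1)], of x] X_3[OF d] by (cases "x \<in> X") auto
    then show ?thesis using that G1_iff by blast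
  qed
  have "\<exists>u\<in>G1. sec u 1 = a 1"
    by (rule *[of "?w 1 3 2"]) (simp_all add: X word_simps c transpose_def del: One_nat_def)
  moreover have "\<exists>u\<in>G1. sec u 2 = a 2"
    by (rule *[of "?w 2 1 3"]) (simp_all add: X word_simps c transpose_def del: One_nat_def)
  moreover have "\<exists>u\<in>G1. sec u 3 = a 3"
    by (rule *[of "?w 3 2 1"]) (simp_all add: X word_simps c transpose_def del: One_nat_def)
  ultimately show ?thesis using j by (auto simp: X_3[OF d])
qed

lemma G1_in_G [simp]: "g \<in> G1 \<Longrightarrow> g \<in> G"
  by (simp add: G1_iff)

lemma G1_in_T: "g \<in> G1 \<Longrightarrow> g \<in> carrier T"
  by simp

lemma root_G1: "g \<in> G1 \<Longrightarrow> root_perm g x = x"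
  by (simp add: G1_iff)

lemma G1_closed [simp]:
  "g \<in> G1 \<Longrightarrow> h \<in> G1 \<Longrightarrow> g \<otimes>\<^bsub>T\<^esub> h \<in> G1"
  "g \<in> G1 \<Longrightarrow> inv\<^bsub>T\<^esub> g \<in> G1" "id \<in> G1"
proof -
  show "inv\<^bsub>T\<^esub> g \<in> G1" if "g \<in> G1"
    unfolding G1_iff using that root_perm_inv_eq[OF G1_in_T[OF that] root_G1[OF that]] by auto
qed (auto simp: G1_iff root_perm_mult)

lemma G1_conj:
  assumes "g \<in> G1" "s \<in> G"
  shows "inv\<^bsub>T\<^esub> s \<otimes>\<^bsub>T\<^esub> g \<otimes>\<^bsub>T\<^esub> s \<in> G1"
proof -
  have "root_perm (inv\<^bsub>T\<^esub> s \<otimes>\<^bsub>T\<^esub> g \<otimes>\<^bsub>T\<^esub> s) x = x" for x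
    using assms by (simp add: root_perm_mult root_G1)
  then show ?thesis
    using assms G_closed(1,2) G1_in_G by (simp add: G1_iff)
qed

lemma sec_conj:
  assumes "g \<in> G1" "s \<in> G" "root_perm s x = y"
  shows "sec (inv\<^bsub>T\<^esub> s \<otimes>\<^bsub>T\<^esub> g \<otimes>\<^bsub>T\<^esub> s) y = inv\<^bsub>T\<^esub> (sec s x) \<otimes>\<^bsub>T\<^esub> sec g x \<otimes>\<^bsub>T\<^esub> sec s x"
proof -
  have "root_perm (inv\<^bsub>T\<^esub> s) y = x" "sec (inv\<^bsub>T\<^esub> s) y = inv\<^bsub>T\<^esub> (sec s x)"
    using root_perm_inv_eq[OF G_in_T[OF assms(2)] assms(3)]
      sec_inv[OF G_in_T[OF assms(2)] assms(3)] by simp_all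
  then show ?thesis
    using assms(1,2) by (simp add: sec_mult root_perm_mult root_G1)
qed

lemma sec_inv_G1: "g \<in> G1 \<Longrightarrow> sec (inv\<^bsub>T\<^esub> g) x = inv\<^bsub>T\<^esub> (sec g x)"
  by (rule sec_inv) (auto simp: root_G1)

lemma sec_mult_G1: "g \<in> G1 \<Longrightarrow> h \<in> carrier T \<Longrightarrow> sec (g \<otimes>\<^bsub>T\<^esub> h) x = sec g x \<otimes>\<^bsub>T\<^esub> sec h x"
  by (simp add: sec_mult root_G1)

text \<open>The sections at \<open>x\<close> form a group.  It contains \<open>a\<^sub>j\<close> for each \<open>j\<close>, as this is a section at some letter
  \<open>p\<close> and \<open>p\<close> can be moved to \<open>x\<close> with trivial section.\<close>

lemma sections_full:
  assumes x: "x \<in> X" and g: "g \<in> G"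
  shows "\<exists>u\<in>G1. sec u x = g"
proof -
  define S where "S = {sec u x | u. u \<in> G1}"
  have "subgroup S T"
  proof (rule T.subgroupI)
    show "S \<subseteq> carrier T" by (auto simp: S_def)
    show "S \<noteq> {}" using G1_closed(3) unfolding S_def by blast
    show "inv\<^bsub>T\<^esub> h \<in> S" if "h \<in> S" for h
      using that sec_inv_G1[symmetric] G1_closed(2) unfolding S_def by blast
    show "h \<otimes>\<^bsub>T\<^esub> k \<in> S" if hk: "h \<in> S" "k \<in> S" for h k
    proof -
      obtain u v where "u \<in> G1" "v \<in> G1" "h = sec u x" "k = sec v x" using hk unfolding S_def by blast
      then show ?thesis
        using sec_mult_G1[of u v x] G1_closed(1) unfolding S_def by (auto intro: exI[of _ "u \<otimes>\<^bsub>T\<^esub> v"])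
    qed
  qed
  moreover have "a j \<in> S" if j: "j \<in> X" for j
  proof -
    have "\<exists>p\<in>X. \<exists>u\<in>G1. sec u p = a j"
    proof (cases "d = 3")
      case True
      then show ?thesis using fractal_three_letters j by blast
    next
      case False
      then have "seed j" using seeds j d_ge by simp
      then obtain u p where u: "u \<in> G1" "p \<in> X" "sec u p \<in> {a j, inv\<^bsub>T\<^esub> (a j)}"
        unfolding seed_def by blast
      then have "sec u p = a j \<or> sec (inv\<^bsub>T\<^esub> u) p = a j"
        by (auto simp: sec_inv_G1)
      then show ?thesis using u G1_closed(2) by blast
    qed
    then obtain p u where u: "u \<in> G1" "p \<in> X" "sec u p = a j" by blast
    obtain s where s: "s \<in> G" "root_perm s p = x" "sec s p = id"
      using transport_trivially[OF u(2) x] by blast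
    have "sec (inv\<^bsub>T\<^esub> s \<otimes>\<^bsub>T\<^esub> u \<otimes>\<^bsub>T\<^esub> s) x = a j"
      using sec_conj[OF u(1) s(1,2)] by (simp add: u s)
    then show ?thesis
      unfolding S_def using G1_conj[OF u(1) s(1)] by (auto intro!: exI[of _ "inv\<^bsub>T\<^esub> s \<otimes>\<^bsub>T\<^esub> u \<otimes>\<^bsub>T\<^esub> s"])
  qed
  ultimately have "G \<subseteq> S" by (rule G_subset)
  then show ?thesis using g unfolding S_def by blast
qed

lemma strongly_fractal_G: "strongly_fractal d G"
proof -
  have "{tree_section g [x] |g. g \<in> G \<inter> level_one_stab d} = G" if "x \<in> X" for x
    using sections_full[OF that] unfolding G1_def[symmetric] by fastforce
  then show ?thesis
    unfolding strongly_fractal_def using self_similar_G by (simp add: X_def)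
qed

lemma level_transitive_G: "level_transitive d G"
proof -
  have "\<exists>g\<in>G. g u = v" if "u \<in> vertices d" "v \<in> vertices d" "length u = length v" for u v
    using that(3,1,2)
  proof (induction rule: list_induct2)
    case Nil
    then show ?case using G_closed(3) by (metis id_apply)
  next
    case (Cons x u y v)
    then obtain h where h: "h \<in> G" "h u = v" by auto
    obtain w where w: "w \<in> G1" "sec w x = h" using sections_full h Cons by auto
    obtain s where s: "s \<in> G" "root_perm s x = y" "sec s x = id"
      using transport_trivially Cons by auto
    have "(w \<otimes>\<^bsub>T\<^esub> s) (x # u) = y # v"
    proof -
      have "w (x # u) = x # v"
        using aut_Cons[of w u x] w h Cons.prems by (simp add: root_G1)
      moreover have "s (x # v) = y # v"
        using aut_Cons[of s v x] s Cons.prems by simp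
      ultimately show ?thesis by (simp add: mult_T)
    qed
    moreover have "w \<otimes>\<^bsub>T\<^esub> s \<in> G" using w s by simp
    ultimately show ?case by blast
  qed
  then show ?thesis by (auto simp: level_transitive_def)
qed

section \<open>The commutator subgroup\<close>

abbreviation TG where "TG \<equiv> T\<lparr>carrier := G\<rparr>"
definition K where "K = derived T G"
abbreviation A where "A \<equiv> TG Mod K"

text \<open>Calculations with sections modulo \<open>K\<close> are done in the abelian group \<open>A\<close>.\<close>

definition coset :: "(nat list \<Rightarrow> nat list) \<Rightarrow> (nat list \<Rightarrow> nat list) set" where
  "coset g = K #>\<^bsub>TG\<^esub> g"

sublocale TG: group TG
  by (rule subgroup.subgroup_is_group[OF G_subgroup T.is_group])

lemma inv_TG: "g \<in> G \<Longrightarrow> inv\<^bsub>TG\<^esub> g = inv\<^bsub>T\<^esub> g"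
  using T.m_inv_consistent[OF G_subgroup] by simp

lemma K_eq: "K = derived TG (carrier TG)"
  unfolding K_def using T.derived_consistent[of G G] G_subgroup by simp

sublocale KG: normal K TG
  unfolding K_eq by (rule TG.derived_self_is_normal)

sublocale A: comm_group A
  unfolding K_eq by (rule TG.derived_quot_is_comm_group)

lemma K_in_G [simp]: "k \<in> K \<Longrightarrow> k \<in> G"
  using KG.subset by auto

lemma K_closed [simp]:
  "k \<in> K \<Longrightarrow> l \<in> K \<Longrightarrow> k \<otimes>\<^bsub>T\<^esub> l \<in> K"
  "k \<in> K \<Longrightarrow> inv\<^bsub>T\<^esub> k \<in> K" "id \<in> K"
  using KG.m_closed[of k l] KG.m_inv_closed[of k] KG.one_closed inv_TG[of k] by (auto simp: one_T)

lemma K_subgroup: "subgroup K T"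
  proof (rule T.subgroupI)
  show "K \<noteq> {}" using K_closed(3) by blast
qed auto

lemma K_conj: "k \<in> K \<Longrightarrow> g \<in> G \<Longrightarrow> inv\<^bsub>T\<^esub> g \<otimes>\<^bsub>T\<^esub> k \<otimes>\<^bsub>T\<^esub> g \<in> K"
  using KG.inv_op_closed1[of g k] inv_TG by simp

lemma comm_in_K: "g \<in> G \<Longrightarrow> h \<in> G \<Longrightarrow> comm g h \<in> K"
  unfolding K_def derived_def by (rule generate.incl) blast

lemma K_subset:
  assumes "subgroup H T" "\<And>g h. g \<in> G \<Longrightarrow> h \<in> G \<Longrightarrow> comm g h \<in> H"
  shows "K \<subseteq> H"
  unfolding K_def derived_def using assms by (intro T.generate_subgroup_incl) auto

text \<open>These simplification rules would replace the unit and the product of \<open>A\<close> by sets, on which the laws of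
  the group \<open>A\<close> do not apply any more.\<close>

declare one_FactGroup [simp del] mult_FactGroup [simp del]

lemma coset_closed [simp]: "g \<in> G \<Longrightarrow> coset g \<in> carrier A"
  by (auto simp: coset_def carrier_FactGroup)

lemma coset_mult: "g \<in> G \<Longrightarrow> h \<in> G \<Longrightarrow> coset (g \<otimes>\<^bsub>T\<^esub> h) = coset g \<otimes>\<^bsub>A\<^esub> coset h"
  using hom_mult[OF KG.r_coset_hom_Mod, of g h] by (simp add: coset_def)

lemma coset_hom: "group_hom TG A coset"
  using KG.r_coset_hom_Mod by unfold_locales (simp add: coset_def[abs_def])

lemma coset_inv: "g \<in> G \<Longrightarrow> coset (inv\<^bsub>T\<^esub> g) = inv\<^bsub>A\<^esub> (coset g)"
  using group_hom.hom_inv[OF coset_hom, of g] inv_TG by simp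

lemma coset_eq_one: "g \<in> G \<Longrightarrow> coset g = \<one>\<^bsub>A\<^esub> \<longleftrightarrow> g \<in> K"
  unfolding coset_def one_FactGroup
  using TG.coset_join1[of K g] TG.coset_join2[of g K] KG.subset KG.subgroup_axioms by auto

lemma coset_K [simp]: "k \<in> K \<Longrightarrow> coset k = \<one>\<^bsub>A\<^esub>"
  by (simp add: coset_eq_one)

lemma coset_id [simp]: "coset id = \<one>\<^bsub>A\<^esub>"
  by simp

lemma nat_pow_in_G [simp]: "g \<in> G \<Longrightarrow> g [^]\<^bsub>T\<^esub> (n :: nat) \<in> G"
  by (induction n) (auto simp: one_T G_closed(3)[unfolded id_def])

lemma coset_pow: "g \<in> G \<Longrightarrow> coset (g [^]\<^bsub>T\<^esub> (n :: nat)) = coset g [^]\<^bsub>A\<^esub> n"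
proof (induction n)
  case 0
  then show ?case by (metis T.nat_pow_0 A.nat_pow_0 one_T coset_id)
qed (simp add: coset_mult)

text \<open>Every element is congruent to a product of powers of the generators; with \<open>a_pow_m\<close> the exponents can
  be taken below \<open>m\<close>.\<close>

lemma coset_finprod:
  assumes "g \<in> G"
  shows "\<exists>c :: nat \<Rightarrow> nat. coset g = finprod A (\<lambda>i. coset (a i) [^]\<^bsub>A\<^esub> c i) X"
  using assms
proof (induction rule: G_induct)
  case id
  have "finprod A (\<lambda>i. coset (a i) [^]\<^bsub>A\<^esub> (0 :: nat)) X = \<one>\<^bsub>A\<^esub>"
    by (rule A.finprod_one_eqI) simp
  then have "coset id = finprod A (\<lambda>i. coset (a i) [^]\<^bsub>A\<^esub> (0 :: nat)) X"
    by (simp only: coset_id)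
  then show ?case by (rule exI[of _ "\<lambda>i. 0"])
next
  case (gen i)
  have "finprod A (\<lambda>j. coset (a j) [^]\<^bsub>A\<^esub> (if j = i then 1 else 0 :: nat)) X
      = finprod A (\<lambda>j. if i = j then coset (a j) else \<one>\<^bsub>A\<^esub>) X"
    by (rule A.finprod_cong') (simp_all add: Pi_iff)
  also have "\<dots> = coset (a i)"
    using gen by (intro A.finprod_singleton[of i X "\<lambda>j. coset (a j)"] finite_X) (simp_all add: Pi_iff)
  finally show ?case by (intro exI) (rule sym)
next
  case (inv i)
  have "a i [^]\<^bsub>T\<^esub> Suc (m - 1) = id" using a_pow_m[OF inv] m_ge by simp
  then have "a i [^]\<^bsub>T\<^esub> (m - 1) \<otimes>\<^bsub>T\<^esub> a i = \<one>\<^bsub>T\<^esub>" by (simp add: one_T)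
  then have eq: "inv\<^bsub>T\<^esub> (a i) = a i [^]\<^bsub>T\<^esub> (m - 1)" by (intro T.inv_equality) simp_all
  have "finprod A (\<lambda>j. coset (a j) [^]\<^bsub>A\<^esub> (if j = i then m - 1 else 0 :: nat)) X
      = finprod A (\<lambda>j. if i = j then coset (a j) [^]\<^bsub>A\<^esub> (m - 1) else \<one>\<^bsub>A\<^esub>) X"
    by (rule A.finprod_cong') (simp_all add: Pi_iff)
  also have "\<dots> = coset (a i) [^]\<^bsub>A\<^esub> (m - 1)"
    using inv by (intro A.finprod_singleton[of i X "\<lambda>j. coset (a j) [^]\<^bsub>A\<^esub> (m - 1)"] finite_X) (simp_all add: Pi_iff)
  also have "\<dots> = coset (inv\<^bsub>T\<^esub> (a i))" using inv by (simp add: eq coset_pow)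
  finally show ?case by (intro exI) (rule sym)
next
  case (mult g h)
  then obtain c e :: "nat \<Rightarrow> nat" where
    "coset g = finprod A (\<lambda>i. coset (a i) [^]\<^bsub>A\<^esub> c i) X"
    "coset h = finprod A (\<lambda>i. coset (a i) [^]\<^bsub>A\<^esub> e i) X" by blast
  then have "coset (g \<otimes>\<^bsub>T\<^esub> h) =
      finprod A (\<lambda>i. coset (a i) [^]\<^bsub>A\<^esub> c i \<otimes>\<^bsub>A\<^esub> coset (a i) [^]\<^bsub>A\<^esub> e i) X"
    using mult by (simp add: coset_mult A.finprod_multf)
  also have "\<dots> = finprod A (\<lambda>i. coset (a i) [^]\<^bsub>A\<^esub> (c i + e i)) X"
    by (rule A.finprod_cong') (auto simp: A.nat_pow_mult)
  finally show ?case by (rule exI[of _ "\<lambda>i. c i + e i"])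
qed

lemma finite_abelianization: "finite (carrier A)"
proof -
  let ?P = "\<lambda>c :: nat \<Rightarrow> nat. finprod A (\<lambda>i. coset (a i) [^]\<^bsub>A\<^esub> c i) X"
  have "coset g \<in> ?P ` (X \<rightarrow>\<^sub>E {..<m} :: (nat \<Rightarrow> nat) set)" if g: "g \<in> G" for g
  proof -
    obtain c :: "nat \<Rightarrow> nat" where c: "coset g = ?P c" using coset_finprod[OF g] by blast
    have mod: "coset (a i) [^]\<^bsub>A\<^esub> n = coset (a i) [^]\<^bsub>A\<^esub> (n mod m)" if "i \<in> X" for i n
    proof -
      have "coset (a i) [^]\<^bsub>A\<^esub> m = \<one>\<^bsub>A\<^esub>"
        using coset_pow[of "a i" m] a_pow_m[OF that] that by simp
      moreover have "coset (a i) [^]\<^bsub>A\<^esub> (m * (n div m) + n mod m)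
          = (coset (a i) [^]\<^bsub>A\<^esub> m) [^]\<^bsub>A\<^esub> (n div m) \<otimes>\<^bsub>A\<^esub> coset (a i) [^]\<^bsub>A\<^esub> (n mod m)"
        using that by (simp only: A.nat_pow_mult A.nat_pow_pow coset_closed a_in_G)
      ultimately have "coset (a i) [^]\<^bsub>A\<^esub> (m * (n div m) + n mod m) = coset (a i) [^]\<^bsub>A\<^esub> (n mod m)"
        using that by (simp only: A.nat_pow_one A.l_one A.nat_pow_closed coset_closed a_in_G)
      then show ?thesis by (simp only: mult_div_mod_eq)
    qed
    have "?P c = ?P (\<lambda>i\<in>X. c i mod m)"
      by (rule A.finprod_cong') (simp_all add: Pi_iff mod[symmetric])
    moreover have "(\<lambda>i\<in>X. c i mod m) \<in> X \<rightarrow>\<^sub>E {..<m}" using m_ge by auto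
    ultimately show ?thesis unfolding c by (rule image_eqI)
  qed
  then have "carrier A \<subseteq> ?P ` (X \<rightarrow>\<^sub>E {..<m})"
    by (auto simp: carrier_FactGroup coset_def)
  moreover have "finite (X \<rightarrow>\<^sub>E {..<m})" by (intro finite_PiE finite_X) auto
  ultimately show ?thesis using finite_subset by blast
qed

section \<open>The group is branching over its commutator subgroup\<close>

text \<open>This is the group \<open>F(x, Y)\<close>: it measures how freely the section at \<open>x\<close> can be chosen while those on \<open>Y\<close>
  are trivial.\<close>

definition free_sections :: "nat \<Rightarrow> nat set \<Rightarrow> (nat list \<Rightarrow> nat list) set" where
  "free_sections x Y = {sec u x | u. u \<in> G1 \<and> (\<forall>y\<in>Y. sec u y = id)}"

lemma free_sectionsI: "u \<in> G1 \<Longrightarrow> sec u x = g \<Longrightarrow> (\<And>y. y \<in> Y \<Longrightarrow> sec u y = id) \<Longrightarrow> g \<in> free_sections x Y"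
  by (auto simp: free_sections_def)

lemma free_sectionsE:
  assumes "g \<in> free_sections x Y"
  obtains u where "u \<in> G1" "sec u x = g" "\<And>y. y \<in> Y \<Longrightarrow> sec u y = id"
  using assms by (auto simp: free_sections_def)

lemma free_sections_in_G: "free_sections x Y \<subseteq> G"
  by (auto simp: free_sections_def)

lemma free_sections_subgroup: "subgroup (free_sections x Y) T"
proof (rule T.subgroupI)
  show "free_sections x Y \<subseteq> carrier T" using free_sections_in_G G_in_T by blast
  have "id \<in> free_sections x Y" by (rule free_sectionsI[of id]) simp_all
  then show "free_sections x Y \<noteq> {}" by blast
  show "inv\<^bsub>T\<^esub> g \<in> free_sections x Y" if "g \<in> free_sections x Y" for g
    using that
  proof (rule free_sectionsE)
    fix u assume "u \<in> G1" "sec u x = g" "\<And>y. y \<in> Y \<Longrightarrow> sec u y = id"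
    then show ?thesis by (intro free_sectionsI[of "inv\<^bsub>T\<^esub> u"]) (simp_all add: sec_inv_G1)
  qed
  show "g \<otimes>\<^bsub>T\<^esub> h \<in> free_sections x Y" if g: "g \<in> free_sections x Y" and h: "h \<in> free_sections x Y" for g h
  proof -
    obtain u where u: "u \<in> G1" "sec u x = g" "\<And>y. y \<in> Y \<Longrightarrow> sec u y = id"
      using free_sectionsE[OF g] by metis
    obtain v where v: "v \<in> G1" "sec v x = h" "\<And>y. y \<in> Y \<Longrightarrow> sec v y = id"
      using free_sectionsE[OF h] by metis
    show ?thesis
      using u v by (intro free_sectionsI[of "u \<otimes>\<^bsub>T\<^esub> v"]) (simp_all add: sec_mult_G1)
  qed
qed

text \<open>Since all sections occur in the stabilizer, every permutation of the letters that is induced by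
  \<open>G\<close> is induced by an element with trivial section at \<open>x\<close>.  Conjugating by it moves \<open>F(x, Y)\<close> without
  changing the group.\<close>

lemma adjust_section:
  assumes "x \<in> X" "s \<in> G"
  shows "\<exists>t\<in>G. sec t x = id \<and> (\<forall>y. root_perm t y = root_perm s y)"
proof -
  obtain u where u: "u \<in> G1" "sec u x = inv\<^bsub>T\<^esub> (sec s x)"
    using sections_full[OF assms(1), of "inv\<^bsub>T\<^esub> (sec s x)"] assms(2) by auto
  have "u \<otimes>\<^bsub>T\<^esub> s \<in> G" "sec (u \<otimes>\<^bsub>T\<^esub> s) x = id" "\<forall>y. root_perm (u \<otimes>\<^bsub>T\<^esub> s) y = root_perm s y"
    using u assms(2) by (simp_all add: sec_mult_G1 root_perm_mult root_G1 one_T)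
  then show ?thesis by blast
qed

lemma free_sections_move:
  assumes x: "x \<in> X" and s: "s \<in> G" and g: "g \<in> free_sections x Y"
  shows "g \<in> free_sections (root_perm s x) (root_perm s ` Y)"
proof -
  obtain t where t: "t \<in> G" "sec t x = id" "\<And>y. root_perm t y = root_perm s y"
    using adjust_section[OF x s] by blast
  obtain u where u: "u \<in> G1" "sec u x = g" "\<And>y. y \<in> Y \<Longrightarrow> sec u y = id"
    using free_sectionsE[OF g] by metis
  show ?thesis
  proof (rule free_sectionsI)
    show "inv\<^bsub>T\<^esub> t \<otimes>\<^bsub>T\<^esub> u \<otimes>\<^bsub>T\<^esub> t \<in> G1" using u t by (simp add: G1_conj)
    show "sec (inv\<^bsub>T\<^esub> t \<otimes>\<^bsub>T\<^esub> u \<otimes>\<^bsub>T\<^esub> t) (root_perm s x) = g"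
      using sec_conj[OF u(1) t(1) t(3), of x] by (simp add: t(2) u(2))
    fix z assume "z \<in> root_perm s ` Y"
    then obtain y where y: "y \<in> Y" "z = root_perm s y" by blast
    show "sec (inv\<^bsub>T\<^esub> t \<otimes>\<^bsub>T\<^esub> u \<otimes>\<^bsub>T\<^esub> t) z = id"
      using sec_conj[OF u(1) t(1) t(3), of y] t(1) by (simp add: y u(3) one_T)
  qed
qed

lemma comm_id [simp]:
  "g \<in> carrier T \<Longrightarrow> comm g id = id" "g \<in> carrier T \<Longrightarrow> comm id g = id"
  by (simp_all add: one_T)

lemma sec_comm: "u \<in> G1 \<Longrightarrow> v \<in> G1 \<Longrightarrow> sec (comm u v) x = comm (sec u x) (sec v x)"
  by (simp add: sec_mult_G1 sec_inv_G1)

lemma comm_in_free_sections: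
  assumes "g \<in> free_sections x Y" "h \<in> free_sections x Z"
  shows "comm g h \<in> free_sections x (Y \<union> Z)"
proof -
  obtain u where u: "u \<in> G1" "sec u x = g" "\<And>y. y \<in> Y \<Longrightarrow> sec u y = id"
    using free_sectionsE[OF assms(1)] by metis
  obtain v where v: "v \<in> G1" "sec v x = h" "\<And>y. y \<in> Z \<Longrightarrow> sec v y = id"
    using free_sectionsE[OF assms(2)] by metis
  show ?thesis
  proof (rule free_sectionsI)
    show "comm u v \<in> G1" using u(1) v(1) by simp
    show "sec (comm u v) x = comm g h" using u v by (simp only: sec_comm)
    show "sec (comm u v) y = id" if "y \<in> Y \<union> Z" for y
      using that u v sec_comm[OF u(1) v(1), of y] by (auto simp: one_T)
  qed
qed

lemma K_in_free_sections:
  assumes "G \<subseteq> free_sections x Y" "G \<subseteq> free_sections x Z"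
  shows "K \<subseteq> free_sections x (Y \<union> Z)"
  by (rule K_subset[OF free_sections_subgroup])
    (rule comm_in_free_sections[OF subsetD[OF assms(1)] subsetD[OF assms(2)]])

text \<open>Sections that lie in \<open>K\<close> can be cleared one letter after the other: the factor that clears \<open>y\<close> is
  trivial at \<open>x\<close> and at the other letters of \<open>Y\<close>, so it does not disturb what has been achieved.\<close>

lemma kill_sections:
  assumes "finite Y" "\<And>y. y \<in> Y \<Longrightarrow> K \<subseteq> free_sections y (insert x (Y - {y}))"
    and "u \<in> G1" "\<And>y. y \<in> Y \<Longrightarrow> sec u y \<in> K"
  shows "\<exists>v\<in>G1. sec v x = sec u x \<and> (\<forall>y\<in>Y. sec v y = id)"
proof -
  \<comment> \<open>On \<open>Z\<close> the sections have been cleared already.\<close>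
  define P where "P Z \<longleftrightarrow> (\<exists>v\<in>G1. sec v x = sec u x \<and> (\<forall>y\<in>Z. sec v y = id) \<and>
    (\<forall>y\<in>Y - Z. sec v y = sec u y))" for Z
  have "P Z" if "finite Z" "Z \<subseteq> Y" for Z
    using that
  proof (induction rule: finite_induct)
    case empty
    then show ?case using assms(3) by (auto simp: P_def)
  next
    case (insert z Z)
    then have "P Z" by simp
    then obtain v where v: "v \<in> G1" "sec v x = sec u x" "\<And>y. y \<in> Z \<Longrightarrow> sec v y = id"
      "\<And>y. y \<in> Y - Z \<Longrightarrow> sec v y = sec u y" unfolding P_def by blast
    have "inv\<^bsub>T\<^esub> (sec u z) \<in> free_sections z (insert x (Y - {z}))"
      using assms(2)[of z] assms(4)[of z] insert by auto
    then obtain w where w: "w \<in> G1" "sec w z = inv\<^bsub>T\<^esub> (sec u z)" "sec w x = id"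
      "\<And>y. y \<in> Y - {z} \<Longrightarrow> sec w y = id"
      by (metis free_sectionsE insertI1 insertI2)
    have z: "z \<in> Y - Z" using insert by auto
    have "v \<otimes>\<^bsub>T\<^esub> w \<in> G1" using v w by simp
    moreover have "sec (v \<otimes>\<^bsub>T\<^esub> w) x = sec u x"
      using v w by (simp add: sec_mult_G1)
    moreover have "sec (v \<otimes>\<^bsub>T\<^esub> w) y = id" if "y \<in> insert z Z" for y
      using v w that z insert.prems assms(3) by (cases "y = z") (auto simp: sec_mult_G1 one_T)
    moreover have "sec (v \<otimes>\<^bsub>T\<^esub> w) y = sec u y" if "y \<in> Y - insert z Z" for y
      using v w that by (simp add: sec_mult_G1)
    ultimately show ?case unfolding P_def by blast
  qed
  from this[OF assms(1)] show ?thesis by (auto simp: P_def)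
qed

lemma three_cycle_exists:
  assumes "x \<in> X" "y \<in> X" "z \<in> X" "x \<noteq> y" "x \<noteq> z" "y \<noteq> z"
  obtains c where "c \<in> G" "root_perm c x = y" "root_perm c y = z" "root_perm c z = x"
    "\<And>u. u \<notin> {x, y, z} \<Longrightarrow> root_perm c u = u"
  using all_three_cycles[OF assms(1-3)] assms(4-6)
  unfolding has_three_cycle_def three_cycle_def by auto

text \<open>A fourth letter makes it possible to move one letter and fix another by a three-cycle.\<close>

lemma two_transitive:
  assumes d: "4 \<le> d" and X: "p \<in> X" "s \<in> X" "p' \<in> X" "s' \<in> X" and "p \<noteq> s" "p' \<noteq> s'"
  shows "\<exists>c\<in>G. root_perm c p = p' \<and> root_perm c s = s'"
proof -
  have avoid: "\<exists>z\<in>X. z \<notin> {x, y, w}" for x y w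
    using d by (intro letter_outside) (simp_all add: card_insert_if)
  have move: "\<exists>c\<in>G. root_perm c x = y \<and> root_perm c w = w"
    if xy: "x \<in> X" "y \<in> X" "w \<in> X" "x \<noteq> w" "y \<noteq> w" for x y w
  proof (cases "x = y")
    case True
    then show ?thesis using G_closed(3) root_perm_id by blast
  next
    case False
    obtain z where z: "z \<in> X" "z \<noteq> x" "z \<noteq> y" "z \<noteq> w" using avoid[of x y w] by blast
    obtain c where c: "c \<in> G" "root_perm c x = y" "\<And>u. u \<notin> {x, y, z} \<Longrightarrow> root_perm c u = u"
      by (rule three_cycle_exists[of x y z]) (use z xy False in auto)
    have "w \<notin> {x, y, z}" using z xy by simp
    then show ?thesis using c by blast
  qed
  have compose: "\<exists>c\<in>G. root_perm c p1 = p3 \<and> root_perm c s1 = s3"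
    if bc: "\<exists>c\<in>G. root_perm c p1 = p2 \<and> root_perm c s1 = s2"
      "\<exists>c\<in>G. root_perm c p2 = p3 \<and> root_perm c s2 = s3" for p1 p2 p3 s1 s2 s3
  proof -
    obtain b c where "b \<in> G" "root_perm b p1 = p2" "root_perm b s1 = s2"
      "c \<in> G" "root_perm c p2 = p3" "root_perm c s2 = s3" using bc by blast
    then have "b \<otimes>\<^bsub>T\<^esub> c \<in> G" "root_perm (b \<otimes>\<^bsub>T\<^esub> c) p1 = p3" "root_perm (b \<otimes>\<^bsub>T\<^esub> c) s1 = s3"
      by (auto simp: root_perm_mult)
    then show ?thesis by blast
  qed
  obtain z where z: "z \<in> X" "z \<noteq> p" "z \<noteq> s" "z \<noteq> p'" using avoid[of p s p'] by blast
  have 1: "\<exists>c\<in>G. root_perm c p = p \<and> root_perm c s = z"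
    using move[of s z p] z X assms by blast
  have 2: "\<exists>c\<in>G. root_perm c p = p' \<and> root_perm c z = z"
    using move[of p p' z] z X by blast
  have 3: "\<exists>c\<in>G. root_perm c p' = p' \<and> root_perm c z = s'"
    using move[of z s' p'] z X assms by blast
  show ?thesis using compose[OF compose[OF 1 2] 3] .
qed

lemma free_from_one_letter:
  assumes d: "4 \<le> d" and "x \<in> X" "y \<in> X" "x \<noteq> y"
  shows "G \<subseteq> free_sections x {y}"
proof (rule G_subset[OF free_sections_subgroup])
  fix j assume j: "j \<in> X"
  obtain u p s where u: "u \<in> G1" "p \<in> X" "s \<in> X" "p \<noteq> s"
    "sec u p \<in> {a j, inv\<^bsub>T\<^esub> (a j)}" "sec u s = id"
    using seeds[OF d j] unfolding seed_def by fastforce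
  obtain c where c: "c \<in> G" "root_perm c p = x" "root_perm c s = y"
    using two_transitive[OF d u(2,3) assms(2,3) u(4) assms(4)] by blast
  have "sec u p \<in> free_sections p {s}" using u by (intro free_sectionsI[of u]) auto
  then have *: "sec u p \<in> free_sections x {y}"
    using free_sections_move[OF u(2) c(1)] c by fastforce
  then have "inv\<^bsub>T\<^esub> (sec u p) \<in> free_sections x {y}"
    by (rule subgroup.m_inv_closed[OF free_sections_subgroup])
  then show "a j \<in> free_sections x {y}" using * u(5) by auto
qed

text \<open>Requiring the witness \<open>u\<close> to lie in \<open>K\<close> costs nothing, because it arises as a commutator, and shows in the
  end that \<open>J\<close> is contained even in \<open>K\<close>.\<close>

definition opposite_pair :: "nat \<Rightarrow> nat \<Rightarrow> (nat list \<Rightarrow> nat list) set" where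
  "opposite_pair p s = {g \<in> G. \<exists>u\<in>G1. u \<in> K \<and> coset (sec u p) = coset g \<and>
     coset (sec u s) = inv\<^bsub>A\<^esub> (coset g) \<and> (\<forall>y. y \<notin> {p, s} \<longrightarrow> sec u y \<in> K)}"

lemma opposite_pairI:
  assumes "g \<in> G" "u \<in> G1" "u \<in> K" "coset (sec u p) = coset g" "coset (sec u s) = inv\<^bsub>A\<^esub> (coset g)"
    "\<And>y. y \<notin> {p, s} \<Longrightarrow> coset (sec u y) = \<one>\<^bsub>A\<^esub>"
  shows "g \<in> opposite_pair p s"
  unfolding opposite_pair_def using assms(1-5) assms(6)
  by (auto intro!: bexI[of _ u] simp: coset_eq_one)

lemma opposite_pairE:
  assumes "g \<in> opposite_pair p s"
  obtains u where "g \<in> G" "u \<in> G1" "u \<in> K" "coset (sec u p) = coset g" "coset (sec u s) = inv\<^bsub>A\<^esub> (coset g)"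
    "\<And>y. y \<notin> {p, s} \<Longrightarrow> coset (sec u y) = \<one>\<^bsub>A\<^esub>"
  using assms unfolding opposite_pair_def by auto

lemma opposite_pair_subgroup: "subgroup (opposite_pair p s) T"
proof (rule T.subgroupI)
  show "opposite_pair p s \<subseteq> carrier T" by (auto simp: opposite_pair_def)
  have "id \<in> opposite_pair p s" by (rule opposite_pairI[of _ id]) simp_all
  then show "opposite_pair p s \<noteq> {}" by blast
  show "inv\<^bsub>T\<^esub> g \<in> opposite_pair p s" if "g \<in> opposite_pair p s" for g
    using that
  proof (rule opposite_pairE)
    fix u assume "g \<in> G" "u \<in> G1" "u \<in> K" "coset (sec u p) = coset g" "coset (sec u s) = inv\<^bsub>A\<^esub> (coset g)"
      "\<And>y. y \<notin> {p, s} \<Longrightarrow> coset (sec u y) = \<one>\<^bsub>A\<^esub>"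
    then show ?thesis
      by (intro opposite_pairI[of _ "inv\<^bsub>T\<^esub> u"]) (simp_all add: sec_inv_G1 coset_inv)
  qed
  show "g \<otimes>\<^bsub>T\<^esub> h \<in> opposite_pair p s" if g: "g \<in> opposite_pair p s" and h: "h \<in> opposite_pair p s" for g h
  proof -
    obtain u where u: "g \<in> G" "u \<in> G1" "u \<in> K" "coset (sec u p) = coset g" "coset (sec u s) = inv\<^bsub>A\<^esub> (coset g)"
      "\<And>y. y \<notin> {p, s} \<Longrightarrow> coset (sec u y) = \<one>\<^bsub>A\<^esub>" using opposite_pairE[OF g] by metis
    obtain v where v: "h \<in> G" "v \<in> G1" "v \<in> K" "coset (sec v p) = coset h" "coset (sec v s) = inv\<^bsub>A\<^esub> (coset h)"
      "\<And>y. y \<notin> {p, s} \<Longrightarrow> coset (sec v y) = \<one>\<^bsub>A\<^esub>" using opposite_pairE[OF h] by metis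
    show ?thesis
      using u v by (intro opposite_pairI[of _ "u \<otimes>\<^bsub>T\<^esub> v"])
        (simp_all add: sec_mult_G1 coset_mult A.inv_mult)
  qed
qed

lemma coset_sec_conj:
  assumes "u \<in> G1" "s \<in> G" "root_perm s x = y"
  shows "coset (sec (inv\<^bsub>T\<^esub> s \<otimes>\<^bsub>T\<^esub> u \<otimes>\<^bsub>T\<^esub> s) y) = coset (sec u x)"
proof -
  have "coset (sec (inv\<^bsub>T\<^esub> s \<otimes>\<^bsub>T\<^esub> u \<otimes>\<^bsub>T\<^esub> s) y) = inv\<^bsub>A\<^esub> (coset (sec s x)) \<otimes>\<^bsub>A\<^esub> coset (sec u x) \<otimes>\<^bsub>A\<^esub> coset (sec s x)"
    unfolding sec_conj[OF assms] using assms by (simp add: coset_mult coset_inv)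
  also have "inv\<^bsub>A\<^esub> (coset (sec s x)) \<otimes>\<^bsub>A\<^esub> coset (sec u x) = coset (sec u x) \<otimes>\<^bsub>A\<^esub> inv\<^bsub>A\<^esub> (coset (sec s x))"
    using assms by (simp add: A.m_comm)
  also have "coset (sec u x) \<otimes>\<^bsub>A\<^esub> inv\<^bsub>A\<^esub> (coset (sec s x)) \<otimes>\<^bsub>A\<^esub> coset (sec s x)
      = coset (sec u x) \<otimes>\<^bsub>A\<^esub> (inv\<^bsub>A\<^esub> (coset (sec s x)) \<otimes>\<^bsub>A\<^esub> coset (sec s x))"
    using assms by (intro A.m_assoc) simp_all
  finally show ?thesis using assms by simp
qed

lemma opposite_pair_move:
  assumes s: "c \<in> G" and g: "g \<in> opposite_pair p s"
  shows "g \<in> opposite_pair (root_perm c p) (root_perm c s)"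
proof -
  obtain u where u: "g \<in> G" "u \<in> G1" "u \<in> K" "coset (sec u p) = coset g" "coset (sec u s) = inv\<^bsub>A\<^esub> (coset g)"
      "\<And>y. y \<notin> {p, s} \<Longrightarrow> coset (sec u y) = \<one>\<^bsub>A\<^esub>" using opposite_pairE[OF g] by metis
  show ?thesis
  proof (rule opposite_pairI)
    show "inv\<^bsub>T\<^esub> c \<otimes>\<^bsub>T\<^esub> u \<otimes>\<^bsub>T\<^esub> c \<in> G1" using G1_conj u s by blast
    show "inv\<^bsub>T\<^esub> c \<otimes>\<^bsub>T\<^esub> u \<otimes>\<^bsub>T\<^esub> c \<in> K" by (rule K_conj[OF u(3) s])
    fix y assume y: "y \<notin> {root_perm c p, root_perm c s}"
    define x where "x = root_perm (inv\<^bsub>T\<^esub> c) y"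
    have x: "root_perm c x = y" using s by (simp add: x_def)
    then have "x \<notin> {p, s}" using y by auto
    then show "coset (sec (inv\<^bsub>T\<^esub> c \<otimes>\<^bsub>T\<^esub> u \<otimes>\<^bsub>T\<^esub> c) y) = \<one>\<^bsub>A\<^esub>"
      using coset_sec_conj[OF u(2) s x] u(6) by simp
  qed (use u coset_sec_conj[OF u(2) s refl] in simp_all)
qed

text \<open>Let \<open>u\<close> be a seed with section \<open>b\<close> at \<open>p\<close> and \<open>q\<close> and trivial section at \<open>s\<close>, and let \<open>v\<close> be its conjugate
  by an element \<open>c\<close> that acts as \<open>(p q s)\<close>.  Modulo \<open>K\<close>, the conjugate has the same sections in permuted
  order, so \<open>inv u v\<close> has \<open>inv b\<close> at \<open>p\<close>, \<open>b\<close> at \<open>s\<close> and the identity elsewhere.\<close>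

lemma all_opposite_pairs:
  assumes d: "4 \<le> d" and "x \<in> X" "y \<in> X" "x \<noteq> y"
  shows "G \<subseteq> opposite_pair x y"
proof (rule G_subset[OF opposite_pair_subgroup])
  fix j assume j: "j \<in> X"
  obtain u p q s where u: "u \<in> G1" "p \<in> X" "q \<in> X" "s \<in> X" "p \<noteq> q" "p \<noteq> s" "q \<noteq> s"
    "sec u p \<in> {a j, inv\<^bsub>T\<^esub> (a j)}" "sec u q = sec u p" "sec u s = id"
    using seeds[OF d j] unfolding seed_def by fastforce
  define b where "b = sec u p"
  have b: "b \<in> G" using u by (simp add: b_def)
  obtain c where c: "c \<in> G" "root_perm c p = q" "root_perm c q = s" "root_perm c s = p"
    "\<And>x. x \<notin> {p, q, s} \<Longrightarrow> root_perm c x = x"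
    using three_cycle_exists[OF u(2-7)] by metis
  define v where "v = inv\<^bsub>T\<^esub> c \<otimes>\<^bsub>T\<^esub> u \<otimes>\<^bsub>T\<^esub> c"
  have v: "v \<in> G1" using u(1) c(1) by (simp add: v_def G1_conj)
  have coset_v: "coset (sec v (root_perm c z)) = coset (sec u z)" for z
    unfolding v_def by (rule coset_sec_conj[OF u(1) c(1) refl])
  have w: "coset (sec (inv\<^bsub>T\<^esub> u \<otimes>\<^bsub>T\<^esub> v) z) = inv\<^bsub>A\<^esub> (coset (sec u z)) \<otimes>\<^bsub>A\<^esub> coset (sec v z)" for z
    using u(1) v by (simp add: sec_mult_G1 sec_inv_G1 coset_mult coset_inv)
  have "b \<in> opposite_pair s p"
  proof (rule opposite_pairI)
    show "inv\<^bsub>T\<^esub> u \<otimes>\<^bsub>T\<^esub> v \<in> G1" using u(1) v by simp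
    have "comm (inv\<^bsub>T\<^esub> u) (inv\<^bsub>T\<^esub> c) \<in> K" using u(1) c(1) by (intro comm_in_K) simp_all
    then show "inv\<^bsub>T\<^esub> u \<otimes>\<^bsub>T\<^esub> v \<in> K" using u(1) c(1) by (simp add: v_def T.m_assoc)
    show "coset (sec (inv\<^bsub>T\<^esub> u \<otimes>\<^bsub>T\<^esub> v) s) = coset b"
      using w[of s] coset_v[of q] u b by (simp add: c b_def)
    show "coset (sec (inv\<^bsub>T\<^esub> u \<otimes>\<^bsub>T\<^esub> v) p) = inv\<^bsub>A\<^esub> (coset b)"
      using w[of p] coset_v[of s] u b by (simp add: c b_def)
    fix z assume z: "z \<notin> {s, p}"
    have "coset (sec v z) = coset (sec u z)"
      using coset_v[of p] coset_v[of z] c u z by (cases "z = q") auto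
    then show "coset (sec (inv\<^bsub>T\<^esub> u \<otimes>\<^bsub>T\<^esub> v) z) = \<one>\<^bsub>A\<^esub>"
      using w[of z] u(1) by simp
  qed (rule b)
  moreover obtain e where e: "e \<in> G" "root_perm e s = x" "root_perm e p = y"
    using two_transitive[OF d u(4,2) assms(2,3)] u(6) assms(4) by metis
  ultimately have *: "b \<in> opposite_pair x y" using opposite_pair_move[OF e(1)] by fastforce
  then have "inv\<^bsub>T\<^esub> b \<in> opposite_pair x y"
    by (rule subgroup.m_inv_closed[OF opposite_pair_subgroup])
  then show "a j \<in> opposite_pair x y" using * u(8) by (auto simp: b_def)
qed

text \<open>Induction on the size of \<open>Y\<close>.  By the induction hypothesis and \<open>K_in_free_sections\<close>, all of \<open>K\<close> occurs for
  sets of the present size.  For \<open>g\<close> in \<open>G\<close>, take an element with section congruent to \<open>g\<close> at \<open>x\<close>, to its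
  inverse at a letter \<open>s\<close> outside of \<open>Y\<close>, and to the identity elsewhere, and clear its sections on \<open>Y\<close>.
  This shows that \<open>g\<close> occurs up to a factor in \<open>K\<close>, and that factor occurs as well.\<close>

lemma sections_free_of_others:
  assumes d: "4 \<le> d" and "x \<in> X" "Y \<subseteq> X" "x \<notin> Y" "card Y \<le> d - 2"
  shows "G \<subseteq> free_sections x Y"
  using assms(2-)
proof (induction "card Y" arbitrary: x Y)
  case 0
  then have "Y = {}" using finite_subset[OF _ finite_X] by (metis card_0_eq)
  then show ?case using sections_full[OF 0(2)] by (auto simp: free_sections_def)
next
  case (Suc k)
  have fin: "finite Y" using Suc finite_subset[OF _ finite_X] by blast
  show ?case
  proof (cases "k = 0")
    case True
    then obtain y where "Y = {y}" using Suc(2) by (metis One_nat_def card_1_singletonE)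
    then show ?thesis using free_from_one_letter[OF d Suc(3), of y] Suc by auto
  next
    case False
    have K: "K \<subseteq> free_sections y Z"
      if yZ: "y \<in> X" "Z \<subseteq> X" "y \<notin> Z" "card Z = Suc k" for y Z
    proof -
      obtain z where z: "z \<in> Z" using yZ(4) by fastforce
      then have "card (Z - {z}) = k" using yZ(4) by simp
      then have "G \<subseteq> free_sections y (Z - {z})"
        using Suc.hyps(1)[of "Z - {z}" y] yZ Suc.prems(4) Suc.hyps(2) by auto
      moreover have "G \<subseteq> free_sections y {z}"
        using free_from_one_letter[OF d yZ(1), of z] z yZ by auto
      ultimately have "K \<subseteq> free_sections y (Z - {z} \<union> {z})" by (rule K_in_free_sections)
      then show ?thesis using z by (simp add: insert_absorb)
    qed
    have "card (insert x Y) < d"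
      using Suc.prems(4) Suc.prems(3) fin d by simp
    then obtain s where s: "s \<in> X" "s \<noteq> x" "s \<notin> Y"
      using letter_outside[of "insert x Y"] fin by auto
    show ?thesis
    proof
      fix g assume g: "g \<in> G"
      then have "g \<in> opposite_pair x s"
        using all_opposite_pairs[OF d Suc.prems(1) s(1)] s(2) by auto
      then obtain u where u: "u \<in> G1" "coset (sec u x) = coset g"
        "\<And>y. y \<notin> {x, s} \<Longrightarrow> coset (sec u y) = \<one>\<^bsub>A\<^esub>" using opposite_pairE by metis
      have "\<exists>v\<in>G1. sec v x = sec u x \<and> (\<forall>y\<in>Y. sec v y = id)"
      proof (rule kill_sections[OF fin _ u(1)])
        fix y assume y: "y \<in> Y"
        then have "y \<notin> {x, s}" using s Suc.prems by auto
        then show "sec u y \<in> K" using u coset_eq_one[of "sec u y"] by simp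
        have "card (insert x (Y - {y})) = Suc k"
          using y fin Suc.hyps(2) Suc.prems(3) by (simp add: card_Suc_Diff1)
        then show "K \<subseteq> free_sections y (insert x (Y - {y}))"
          using y Suc.prems by (intro K) auto
      qed
      then have *: "sec u x \<in> free_sections x Y" by (metis free_sectionsI)
      have "coset (g \<otimes>\<^bsub>T\<^esub> inv\<^bsub>T\<^esub> (sec u x)) = \<one>\<^bsub>A\<^esub>"
        using g u(1,2) by (simp add: coset_mult coset_inv)
      then have "g \<otimes>\<^bsub>T\<^esub> inv\<^bsub>T\<^esub> (sec u x) \<in> K"
        using g u(1) coset_eq_one[of "g \<otimes>\<^bsub>T\<^esub> inv\<^bsub>T\<^esub> (sec u x)"] by simp
      then have "g \<otimes>\<^bsub>T\<^esub> inv\<^bsub>T\<^esub> (sec u x) \<in> free_sections x Y"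
        using K[OF Suc.prems(1-3)] Suc.hyps(2) by auto
      then have "g \<otimes>\<^bsub>T\<^esub> inv\<^bsub>T\<^esub> (sec u x) \<otimes>\<^bsub>T\<^esub> sec u x \<in> free_sections x Y"
        using * subgroup.m_closed[OF free_sections_subgroup] by blast
      then show "g \<in> free_sections x Y" using g u by (simp add: T.m_assoc)
    qed
  qed
qed

text \<open>Letting \<open>y\<close> be a letter other than \<open>x\<close>, the commutator of an element that is trivial outside \<open>{x, y}\<close> and
  one that is trivial at \<open>y\<close> is trivial outside \<open>{x}\<close>.\<close>

lemma branching_large:
  assumes d: "4 \<le> d" and x: "x \<in> X" and k: "k \<in> K"
  shows "single x k \<in> K"
proof -
  have "K \<subseteq> {k \<in> carrier T. single x k \<in> K}"
  proof (rule K_subset[OF single_preimage_subgroup[OF K_subgroup x]])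
    fix g h assume g: "g \<in> G" and h: "h \<in> G"
    obtain y where y: "y \<in> X" "y \<noteq> x" using letter_outside[of "{x}"] d by auto
    have "card (X - {x, y}) = d - 2" using x y card_X finite_X by (simp add: card_Diff_subset)
    then have "g \<in> free_sections x (X - {x, y})"
      using sections_free_of_others[OF d x, of "X - {x, y}"] g by auto
    moreover have "h \<in> free_sections x {y}" using free_from_one_letter[OF d x y(1)] y h by auto
    ultimately obtain u v where u: "u \<in> G1" "sec u x = g" "\<And>z. z \<in> X - {x, y} \<Longrightarrow> sec u z = id"
      and v: "v \<in> G1" "sec v x = h" "sec v y = id"
      by (metis free_sectionsE singletonI)
    have "comm u v = single x (comm g h)"
    proof (rule T_eqI)
      show "root_perm (comm u v) z = root_perm (single x (comm g h)) z" for z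
        using root_G1[of "comm u v"] u v by simp
      show "sec (comm u v) z = sec (single x (comm g h)) z" if "z \<in> X" for z
        using u v that sec_comm[OF u(1) v(1), of z] comm_id
        by (cases "z = x"; cases "z = y") (auto simp: one_T id_def)
    qed (use u v g h x in simp_all)
    moreover have "comm u v \<in> K" using u v by (intro comm_in_K) simp_all
    ultimately show "comm g h \<in> {k \<in> carrier T. single x k \<in> K}" using g h by simp
  qed
  then show ?thesis using k by auto
qed

lemma K_normal: "K \<lhd> TG"
  by (rule KG.normal_axioms)

lemma single_move:
  assumes N: "N \<lhd> TG" and "x \<in> X" "y \<in> X" "k \<in> carrier T" "single x k \<in> N"
  shows "single y k \<in> N"
proof -
  obtain s where s: "s \<in> G" "root_perm s x = y" "sec s x = id"
    using transport_trivially[OF assms(2,3)] by blast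
  have "inv\<^bsub>T\<^esub> s \<otimes>\<^bsub>T\<^esub> single x k \<otimes>\<^bsub>T\<^esub> s = single y k"
    using single_conj[OF assms(2,4) G_in_T[OF s(1)] s(2)] s(3) by (simp only: inv_id id_mult)
  then show ?thesis
    using normal.inv_op_closed1[OF N, of s "single x k"] assms(5) s(1) inv_TG by simp
qed

text \<open>Commutators of generators generate \<open>K\<close> as a normal subgroup, by the identities
  \<open>[inv g, h] = inv g [h, g] g\<close> and \<open>[g g', h] = g [g', h] (inv g) [g, h]\<close>.\<close>

lemma K_subset_gens:
  assumes N: "subgroup N T"
    and conj: "\<And>k g. k \<in> N \<Longrightarrow> g \<in> G \<Longrightarrow> inv\<^bsub>T\<^esub> g \<otimes>\<^bsub>T\<^esub> k \<otimes>\<^bsub>T\<^esub> g \<in> N"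
    and gens: "\<And>i j. i \<in> X \<Longrightarrow> j \<in> X \<Longrightarrow> comm (a i) (a j) \<in> N"
  shows "K \<subseteq> N"
proof -
  have sym: "comm h g \<in> N" if "comm g h \<in> N" "g \<in> G" "h \<in> G" for g h
    using subgroup.m_inv_closed[OF N that(1)] that(2,3) by (simp add: T.inv_mult_group T.m_assoc)
  have "G \<subseteq> {g \<in> G. comm g h \<in> N}" if h: "h \<in> G" and hg: "\<And>i. i \<in> X \<Longrightarrow> comm (a i) h \<in> N" for h
  proof (rule G_subset)
    show "subgroup {g \<in> G. comm g h \<in> N} T"
    proof (rule T.subgroupI)
      have "comm id h = id" using h by (simp add: one_T)
      then show "{g \<in> G. comm g h \<in> N} \<noteq> {}"
        using subgroup.one_closed[OF N] G_closed(3) one_T by (metis (mono_tags, lifting) empty_iff mem_Collect_eq)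
      show "inv\<^bsub>T\<^esub> g \<in> {g \<in> G. comm g h \<in> N}" if "g \<in> {g \<in> G. comm g h \<in> N}" for g
      proof -
        have g: "g \<in> G" "comm g h \<in> N" using that by auto
        have "inv\<^bsub>T\<^esub> g \<otimes>\<^bsub>T\<^esub> comm h g \<otimes>\<^bsub>T\<^esub> g \<in> N" by (rule conj[OF sym[OF g(2,1) h] g(1)])
        also have "inv\<^bsub>T\<^esub> g \<otimes>\<^bsub>T\<^esub> comm h g \<otimes>\<^bsub>T\<^esub> g = comm (inv\<^bsub>T\<^esub> g) h"
          using g h by (simp add: T.m_assoc)
        finally show ?thesis using g by simp
      qed
      show "g \<otimes>\<^bsub>T\<^esub> g' \<in> {g \<in> G. comm g h \<in> N}"
        if "g \<in> {g \<in> G. comm g h \<in> N}" "g' \<in> {g \<in> G. comm g h \<in> N}" for g g'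
      proof -
        have g: "g \<in> G" "comm g h \<in> N" "g' \<in> G" "comm g' h \<in> N" using that by auto
        have "inv\<^bsub>T\<^esub> (inv\<^bsub>T\<^esub> g) \<otimes>\<^bsub>T\<^esub> comm g' h \<otimes>\<^bsub>T\<^esub> inv\<^bsub>T\<^esub> g \<otimes>\<^bsub>T\<^esub> comm g h \<in> N"
          using subgroup.m_closed[OF N conj[OF g(4), of "inv\<^bsub>T\<^esub> g"] g(2)] g(1) by simp
        also have "inv\<^bsub>T\<^esub> (inv\<^bsub>T\<^esub> g) \<otimes>\<^bsub>T\<^esub> comm g' h \<otimes>\<^bsub>T\<^esub> inv\<^bsub>T\<^esub> g \<otimes>\<^bsub>T\<^esub> comm g h = comm (g \<otimes>\<^bsub>T\<^esub> g') h"
          using g h by (simp add: T.m_assoc T.inv_mult_group)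
        finally show ?thesis using g by simp
      qed
    qed auto
  qed (use hg in simp)
  note * = this
  have "comm g (a i) \<in> N" if "g \<in> G" "i \<in> X" for g i
    using *[of "a i"] gens that by auto
  then have "comm g h \<in> N" if "g \<in> G" "h \<in> G" for g h
    using *[of h] sym that by auto
  then show ?thesis by (rule K_subset[OF N])
qed

text \<open>For \<open>d = 3\<close> the element \<open>v = a\<^sub>k a\<^sub>j a\<^sub>k\<close> acts on the letters like \<open>a\<^sub>i\<close>, has section \<open>a\<^sub>j\<close> at \<open>i\<close> and the same
  section \<open>a\<^sub>k\<close> at the two letters that are exchanged.  Away from \<open>i\<close> it therefore commutes with \<open>a\<^sub>i\<close>, so
  \<open>[a\<^sub>i, v]\<close> is \<open>[a\<^sub>i, a\<^sub>j]\<close> at \<open>i\<close> and trivial elsewhere.\<close>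

lemma branching_three:
  assumes d: "d = 3" and x: "x \<in> X" and k: "k \<in> K"
  shows "single x k \<in> K"
proof -
  have X: "1 \<in> X" "2 \<in> X" "3 \<in> X" using X_3[OF d] by auto
  note c = hanoi_cycle_three[OF d]
  have ci: "root_perm (inv\<^bsub>T\<^esub> (a i)) x = hanoi_cycle d m i x" if "i \<in> X" for i x
    using that by (intro root_perm_inv_eq) (auto simp: root_a c X_3[OF d] transpose_def simp del: One_nat_def)
  let ?B = "{k \<in> carrier T. single 1 k \<in> K}"
  have comm_single: "single p g \<in> K"
    if "u \<in> G" "v \<in> G" "p \<in> X" "g \<in> carrier T" "\<forall>x\<in>X. root_perm (comm u v) x = x"
      "\<forall>x\<in>X. sec (comm u v) x = (if x = p then g else id)" for p g u v
  proof -
    have "comm u v = single p g"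
    proof (rule T_eqI)
      show "single p g \<in> carrier T" by (rule single_in_T[OF that(3,4)])
      show "root_perm (comm u v) x = root_perm (single p g) x" if "x \<in> X" for x
        using \<open>\<forall>x\<in>X. root_perm (comm u v) x = x\<close> that by (simp only: root_perm_diag)
      show "sec (comm u v) x = sec (single p g) x" if "x \<in> X" for x
        using \<open>\<forall>x\<in>X. sec (comm u v) x = (if x = p then g else id)\<close> that by (simp only: sec_diag)
    qed (use that(1,2) in simp)
    then show ?thesis using comm_in_K[OF that(1,2)] by simp
  qed
  have ball: "(\<forall>x\<in>X. P x) \<longleftrightarrow> P 1 \<and> P 2 \<and> P 3" for P using X_3[OF d] by auto
  let ?v = "\<lambda>i j. a i \<otimes>\<^bsub>T\<^esub> a j \<otimes>\<^bsub>T\<^esub> a i"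
  have 12: "single 1 (comm (a 1) (a 2)) \<in> K"
    by (rule comm_single[of "a 1" "?v 3 2"], unfold ball)
      (simp_all add: X word_simps c ci T.inv_mult_group transpose_def one_T T.m_assoc del: One_nat_def)
  have 13: "single 1 (comm (a 1) (a 3)) \<in> K"
    by (rule comm_single[of "a 1" "?v 2 3"], unfold ball)
      (simp_all add: X word_simps c ci T.inv_mult_group transpose_def one_T T.m_assoc del: One_nat_def)
  have "single 2 (comm (a 2) (a 3)) \<in> K"
    by (rule comm_single[of "a 2" "?v 1 3"], unfold ball)
      (simp_all add: X word_simps c ci T.inv_mult_group transpose_def one_T T.m_assoc del: One_nat_def)
  then have 23: "single 1 (comm (a 2) (a 3)) \<in> K" by (intro single_move[OF K_normal X(2,1)]) simp_all
  note B = single_preimage_subgroup[OF K_subgroup X(1)]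
  have sym: "comm h g \<in> ?B" if "single 1 (comm g h) \<in> K" "g \<in> carrier T" "h \<in> carrier T" for g h
  proof -
    have "comm g h \<in> ?B" using that by simp
    then have "inv\<^bsub>T\<^esub> (comm g h) \<in> ?B" by (rule subgroup.m_inv_closed[OF B])
    also have "inv\<^bsub>T\<^esub> (comm g h) = comm h g" using that(2,3) by (simp add: T.inv_mult_group T.m_assoc)
    finally show ?thesis .
  qed
  have "K \<subseteq> ?B"
  proof (rule K_subset_gens[OF B])
    fix k g assume k: "k \<in> ?B" and g: "g \<in> G"
    obtain u where u: "u \<in> G1" "sec u 1 = g" using sections_full[OF X(1) g] by blast
    have "inv\<^bsub>T\<^esub> u \<otimes>\<^bsub>T\<^esub> single 1 k \<otimes>\<^bsub>T\<^esub> u = single 1 (inv\<^bsub>T\<^esub> g \<otimes>\<^bsub>T\<^esub> k \<otimes>\<^bsub>T\<^esub> g)"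
      using single_conj[OF X(1) _ G1_in_T[OF u(1)] root_G1[OF u(1)], of k] k unfolding u(2) by blast
    then show "inv\<^bsub>T\<^esub> g \<otimes>\<^bsub>T\<^esub> k \<otimes>\<^bsub>T\<^esub> g \<in> ?B"
      using K_conj[of "single 1 k" u] k g u(1) by simp
  next
    have diag: "comm (a i) (a i) \<in> ?B" for i
      using subgroup.one_closed[OF B] by (simp add: T.m_assoc)
    fix i j assume "i \<in> X" "j \<in> X"
    then have "i = 1 \<or> i = 2 \<or> i = 3" "j = 1 \<or> j = 2 \<or> j = 3" using X_3[OF d] by auto
    then show "comm (a i) (a j) \<in> ?B"
      using 12 13 23 sym[OF 12] sym[OF 13] sym[OF 23] diag[of 1] diag[of 2] diag[of 3]
      by (elim disjE) (simp_all del: One_nat_def)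
  qed
  then have "single 1 k \<in> K" using k by blast
  then show ?thesis using single_move[OF K_normal X(1) x] k by simp
qed

lemma branching:
  assumes "x \<in> X" "k \<in> K"
  shows "single x k \<in> K"
proof (cases "d = 3")
  case False
  then show ?thesis using branching_large d_ge assms by simp
qed (use branching_three assms in simp)

lemma regular_branch_G: "regular_branch_over d G K"
proof -
  have "subgroup K TG" by (rule KG.subgroup_axioms)
  moreover have "finite (rcosets\<^bsub>TG\<^esub> K)"
    using finite_abelianization by (simp add: FactGroup_def)
  moreover have "(f, id) \<in> psi d ` (K \<inter> level_one_stab d)" if f: "f \<in> {1..d} \<rightarrow>\<^sub>E K" for f
  proof -
    define g where "g x = (if x \<in> X then f x else id)" for x
    have gK: "g x \<in> K" for x using f by (auto simp: g_def X_def)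
    have "diag g \<in> K"
    proof (rule diag_in_subgroup[OF K_subgroup])
      show "single x (g x) \<in> K" if "x \<in> X" for x by (rule branching[OF that gK])
      show "g x \<in> carrier T" for x using gK by simp
    qed (simp add: g_def)
    moreover from this have "diag g \<in> level_one_stab d" by (simp add: level_one_stab_iff)
    moreover have "psi d (diag g) = (f, id)"
      using f by (auto simp: psi_def g_def X_def fun_eq_iff PiE_def extensional_def)
    ultimately show ?thesis by (metis IntI image_eqI)
  qed
  ultimately show ?thesis
    using G_subgroup level_transitive_G unfolding regular_branch_over_def by auto
qed

section \<open>Opposite pairs of sections\<close>

definition opposite :: "nat \<Rightarrow> nat \<Rightarrow> (nat list \<Rightarrow> nat list) \<Rightarrow> nat list \<Rightarrow> nat list" where
  "opposite p q h = diag (\<lambda>x. if x = p then h else if x = q then inv\<^bsub>T\<^esub> h else id)"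

lemma opposite_in_T: "p \<in> X \<Longrightarrow> q \<in> X \<Longrightarrow> h \<in> carrier T \<Longrightarrow> opposite p q h \<in> carrier T"
  unfolding opposite_def by (rule diag_in_T) auto

text \<open>The opposite pair differs from an element of \<open>K\<close> by an element of the first level stabilizer with
  sections in \<open>K\<close>, which lies in \<open>K\<close> by branching.\<close>

lemma opposite_in_K:
  assumes d: "4 \<le> d" and X: "p \<in> X" "q \<in> X" "p \<noteq> q" and h: "h \<in> G"
  shows "opposite p q h \<in> K"
proof -
  define f where "f x = (if x = p then h else if x = q then inv\<^bsub>T\<^esub> h else id)" for x
  have fG: "f x \<in> G" for x using h by (simp add: f_def)
  have DT: "diag f \<in> carrier T" using opposite_in_T[OF X(1,2), of h] h by (simp add: opposite_def f_def[abs_def])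
  have "h \<in> opposite_pair p q" using all_opposite_pairs[OF d X] h by blast
  then obtain u where u: "u \<in> G1" "u \<in> K" "coset (sec u p) = coset h"
    "coset (sec u q) = inv\<^bsub>A\<^esub> (coset h)" "\<And>y. y \<notin> {p, q} \<Longrightarrow> coset (sec u y) = \<one>\<^bsub>A\<^esub>"
    using opposite_pairE by metis
  have coset_f: "coset (f x) = coset (sec u x)" for x
    using u(3-5) X(3) h coset_inv[OF h] by (simp add: f_def)
  define k where "k = inv\<^bsub>T\<^esub> u \<otimes>\<^bsub>T\<^esub> diag f"
  have k: "k \<in> level_one_stab d"
    using u(1) DT root_G1[of "inv\<^bsub>T\<^esub> u"] by (simp add: k_def level_one_stab_iff root_perm_mult)
  have sec_k: "sec k x \<in> K" for x
  proof -
    have "sec k x = inv\<^bsub>T\<^esub> (sec u x) \<otimes>\<^bsub>T\<^esub> f x"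
      using u(1) DT by (simp add: k_def sec_mult_G1 sec_inv_G1)
    moreover from this have "coset (sec k x) = \<one>\<^bsub>A\<^esub>"
      using u(1) fG[of x] by (simp add: coset_mult coset_inv coset_f)
    ultimately show ?thesis
      using coset_eq_one[of "sec k x"] u(1) fG[of x] by simp
  qed
  have "diag (sec k) \<in> K"
  proof (rule diag_in_subgroup[OF K_subgroup])
    show "sec k x = id" if "x \<notin> X" for x
      using k that by (intro sec_outside) (simp_all add: level_one_stab_iff)
  qed (use sec_k branching in simp_all)
  then have "k \<in> K" using eq_diag[OF k] by simp
  moreover have "diag f = u \<otimes>\<^bsub>T\<^esub> k" using u(1) DT by (simp add: k_def)
  ultimately show ?thesis using u(2) by (simp add: opposite_def f_def[abs_def])
qed

lemma hanoi_J_subgroup: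
  assumes d: "4 \<le> d"
  shows "subgroup (hanoi_J d m) TG"
proof -
  have gen: "g \<in> G" if g: "g \<in> level_one_stab d" and h: "h \<in> G" and p: "p \<in> {1..d}" "q \<in> {1..d}" "p \<noteq> q"
    and psi: "psi d g = (\<lambda>x\<in>{1..d}. if x = p then h else if x = q then inv\<^bsub>T\<^esub> h else id, id)"
    for g h p q
  proof -
    have pX: "p \<in> X" "q \<in> X" using p by (simp_all add: X_def)
    have s: "(\<lambda>x\<in>{1..d}. sec g x) = (\<lambda>x\<in>{1..d}. if x = p then h else if x = q then inv\<^bsub>T\<^esub> h else id)"
      using psi by (simp only: psi_def prod.inject)
    have "g = opposite p q h"
    proof (rule T_eqI)
      show "g \<in> carrier T" using g by (simp add: level_one_stab_iff)
      show "opposite p q h \<in> carrier T" using opposite_in_T[OF pX] h by simp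
      show "root_perm g x = root_perm (opposite p q h) x" for x
        using g by (simp add: level_one_stab_iff opposite_def)
      show "sec g x = sec (opposite p q h) x" if "x \<in> X" for x
        using fun_cong[OF s, of x] that by (simp add: X_def opposite_def)
    qed
    then show ?thesis using opposite_in_K[OF d pX p(3) h] by simp
  qed
  let ?S = "{g \<in> level_one_stab d. \<exists>h\<in>G. \<exists>p\<in>{1..d}. \<exists>q\<in>{1..d}. p \<noteq> q \<and>
        psi d g = (\<lambda>x\<in>{1..d}. if x = p then h else if x = q then inv\<^bsub>T\<^esub> h else id, id)}"
  have S: "?S \<subseteq> G" using gen by blast
  have "?S \<subseteq> carrier T" using S G_in_T by blast
  then have "subgroup (generate T ?S) T" by (rule T.generate_is_subgroup)
  moreover have "generate T ?S \<subseteq> G" by (rule T.generate_subgroup_incl[OF S G_subgroup])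
  ultimately show ?thesis
    unfolding hanoi_J_def by (intro T.subgroup_incl[OF _ G_subgroup])
qed

section \<open>Just infiniteness\<close>

text \<open>This is \<open>M \<times> \<dots> \<times> M\<close>.  The base of the iterated powers is always \<open>K\<close>, and these form a decreasing chain
  of subgroups of finite index.\<close>

definition delta :: "(nat list \<Rightarrow> nat list) set \<Rightarrow> (nat list \<Rightarrow> nat list) set" where
  "delta M = {g \<in> level_one_stab d. \<forall>x\<in>X. sec g x \<in> M}"

lemma deltaI: "g \<in> carrier T \<Longrightarrow> (\<And>x. root_perm g x = x) \<Longrightarrow> (\<And>x. x \<in> X \<Longrightarrow> sec g x \<in> M) \<Longrightarrow> g \<in> delta M"
  by (simp add: delta_def level_one_stab_iff)

lemma delta_mono: "M \<subseteq> N \<Longrightarrow> delta M \<subseteq> delta N"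
  by (auto simp: delta_def)

lemma single_in_delta:
  assumes "x \<in> X" "k \<in> M" "id \<in> M" "k \<in> carrier T"
  shows "single x k \<in> delta M"
  by (rule deltaI) (use assms in simp_all)

lemma delta_subset:
  assumes H: "subgroup H T" and single: "\<And>x k. x \<in> X \<Longrightarrow> k \<in> M \<Longrightarrow> single x k \<in> H"
  shows "delta M \<subseteq> H"
proof
  fix g assume g: "g \<in> delta M"
  then have g1: "g \<in> level_one_stab d" "g \<in> carrier T" by (simp_all add: delta_def level_one_stab_iff)
  have "diag (sec g) \<in> H"
    by (rule diag_in_subgroup[OF H]) (use g g1 single sec_outside in \<open>simp_all add: delta_def\<close>)
  then show "g \<in> H" using eq_diag[OF g1(1)] by simp
qed

lemma delta_subgroup:
  assumes M: "subgroup M T"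
  shows "subgroup (delta M) T"
proof (rule T.subgroupI)
  show "delta M \<subseteq> carrier T" by (auto simp: delta_def level_one_stab_iff)
  have "id \<in> delta M" using subgroup.one_closed[OF M] by (intro deltaI) (simp_all add: one_T)
  then show "delta M \<noteq> {}" by blast
  have root: "root_perm g x = x" "g \<in> carrier T" "x \<in> X \<Longrightarrow> sec g x \<in> M" if "g \<in> delta M" for g x
    using that by (auto simp: delta_def level_one_stab_iff)
  show "inv\<^bsub>T\<^esub> g \<in> delta M" if g: "g \<in> delta M" for g
  proof (rule deltaI)
    show "root_perm (inv\<^bsub>T\<^esub> g) x = x" for x
      by (rule root_perm_inv_eq) (use root[OF g] in auto)
    show "sec (inv\<^bsub>T\<^esub> g) x \<in> M" if "x \<in> X" for x
      using sec_inv[OF root(2)[OF g] root(1)[OF g], of x] subgroup.m_inv_closed[OF M root(3)[OF g that]]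
      by simp
  qed (use root[OF g] in simp)
  show "g \<otimes>\<^bsub>T\<^esub> h \<in> delta M" if g: "g \<in> delta M" and h: "h \<in> delta M" for g h
  proof (rule deltaI)
    show "root_perm (g \<otimes>\<^bsub>T\<^esub> h) x = x" for x
      using root[OF g] root[OF h] by (simp add: root_perm_mult)
    show "sec (g \<otimes>\<^bsub>T\<^esub> h) x \<in> M" if "x \<in> X" for x
      using root[OF g] root[OF h] subgroup.m_closed[OF M root(3)[OF g that] root(3)[OF h that]]
      by (simp add: sec_mult)
  qed (use root[OF g] root[OF h] in simp)
qed

lemma delta_pow_subgroup: "subgroup ((delta ^^ l) K) T"
proof (induction l)
  case 0
  then show ?case using K_subgroup by simp
qed (simp add: delta_subgroup)

lemma delta_pow_subset: "(delta ^^ l) K \<subseteq> K"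
proof (induction l)
  case (Suc l)
  have "delta K \<subseteq> K" by (rule delta_subset[OF K_subgroup branching])
  then show ?case using delta_mono[OF Suc] by simp
qed simp

text \<open>For \<open>l = 0\<close>: if \<open>x\<close>, \<open>y\<close>, \<open>z\<close> are distinct, the commutator of the opposite pair of \<open>g\<close> at \<open>x\<close>, \<open>y\<close> and that of
  \<open>h\<close> at \<open>x\<close>, \<open>z\<close> is \<open>[g, h]\<close> at \<open>x\<close>.  The statement is about any subgroup \<open>H\<close> with these commutators so that
  the induction can be applied to the preimage of \<open>H\<close> under \<open>single x\<close>.\<close>

lemma commutators_contain_delta:
  assumes d: "4 \<le> d"
  shows "subgroup H T \<Longrightarrow> (\<And>s t. s \<in> (delta ^^ l) K \<Longrightarrow> t \<in> (delta ^^ l) K \<Longrightarrow> comm s t \<in> H)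
    \<Longrightarrow> (delta ^^ Suc l) K \<subseteq> H"
proof (induction l arbitrary: H)
  case 0
  have "single x k \<in> H" if x: "x \<in> X" and k: "k \<in> K" for x k
  proof -
    have "K \<subseteq> {k \<in> carrier T. single x k \<in> H}"
    proof (rule K_subset[OF single_preimage_subgroup[OF 0(1) x]])
      fix g h assume g: "g \<in> G" and h: "h \<in> G"
      obtain y where y: "y \<in> X" "y \<noteq> x" using letter_outside[of "{x}"] d by auto
      obtain z where z: "z \<in> X" "z \<noteq> x" "z \<noteq> y"
        using letter_outside[of "{x, y}"] d y(2) by auto
      let ?u = "opposite x y g" and ?v = "opposite x z h"
      have u: "?u \<in> K" "?v \<in> K" using opposite_in_K[OF d x] y z g h by auto
      then have uv: "?u \<in> G1" "?v \<in> G1" by (simp_all add: G1_iff opposite_def)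
      have "comm ?u ?v = single x (comm g h)"
      proof (rule T_eqI)
        show "root_perm (comm ?u ?v) w = root_perm (single x (comm g h)) w" for w
          using root_G1[of "comm ?u ?v"] uv by simp
        show "sec (comm ?u ?v) w = sec (single x (comm g h)) w" if "w \<in> X" for w
          unfolding sec_comm[OF uv] using y z g h by (simp add: opposite_def one_T)
      qed (use uv x g h in simp_all)
      then show "comm g h \<in> {k \<in> carrier T. single x k \<in> H}"
        using 0(2)[of ?u ?v] u g h by simp
    qed
    then show ?thesis using k by blast
  qed
  then have "delta K \<subseteq> H" using delta_subset[OF 0(1)] by blast
  then show ?case by simp
next
  case (Suc l)
  have sub: "subgroup ((delta ^^ l) K) T" by (rule delta_pow_subgroup)
  have "single x k \<in> H" if x: "x \<in> X" and k: "k \<in> (delta ^^ Suc l) K" for x k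
  proof -
    have "(delta ^^ Suc l) K \<subseteq> {k \<in> carrier T. single x k \<in> H}"
    proof (rule Suc.IH[OF single_preimage_subgroup[OF Suc.prems(1) x]])
      fix s t assume st: "s \<in> (delta ^^ l) K" "t \<in> (delta ^^ l) K"
      then have stT: "s \<in> carrier T" "t \<in> carrier T" using subgroup.mem_carrier[OF sub] by auto
      have "id \<in> (delta ^^ l) K" using subgroup.one_closed[OF sub] by (simp add: one_T)
      then have "single x s \<in> (delta ^^ Suc l) K" "single x t \<in> (delta ^^ Suc l) K"
        using single_in_delta[OF x] st stT by simp_all
      then have "comm (single x s) (single x t) \<in> H" by (rule Suc.prems(2))
      moreover have "comm (single x s) (single x t) = single x (comm s t)"
        using comm_single[OF x stT(2) single_in_T[OF x stT(1)]] unfolding sec_diag by simp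
      ultimately show "comm s t \<in> {k \<in> carrier T. single x k \<in> H}" using stT by simp
    qed
    then show ?thesis using k by blast
  qed
  then have "delta ((delta ^^ Suc l) K) \<subseteq> H" using delta_subset[OF Suc.prems(1)] by blast
  then show ?case by simp
qed

text \<open>Finitely many right translates of \<open>M\<close> by elements of \<open>G\<close> cover \<open>G\<close>.  In terms of translates, passing to
  a larger \<open>M\<close> is trivial.\<close>

definition has_finite_index :: "(nat list \<Rightarrow> nat list) set \<Rightarrow> bool" where
  "has_finite_index M \<longleftrightarrow> (\<exists>F. finite F \<and> F \<subseteq> G \<and> (\<forall>g\<in>G. \<exists>f\<in>F. g \<otimes>\<^bsub>T\<^esub> inv\<^bsub>T\<^esub> f \<in> M))"

lemma finite_indexI:
  assumes "finite (key ` G)" "\<And>g f. g \<in> G \<Longrightarrow> f \<in> G \<Longrightarrow> key g = key f \<Longrightarrow> g \<otimes>\<^bsub>T\<^esub> inv\<^bsub>T\<^esub> f \<in> M"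
  shows "has_finite_index M"
proof -
  define rep where "rep c = (SOME f. f \<in> G \<and> key f = c)" for c
  have rep: "rep (key g) \<in> G" "key (rep (key g)) = key g" if "g \<in> G" for g
    using someI[of "\<lambda>f. f \<in> G \<and> key f = key g" g] that by (simp_all add: rep_def)
  show ?thesis
    unfolding has_finite_index_def
  proof (intro exI conjI ballI)
    show "finite (rep ` key ` G)" using assms(1) by simp
    show "rep ` key ` G \<subseteq> G" using rep(1) by blast
    show "\<exists>f\<in>rep ` key ` G. g \<otimes>\<^bsub>T\<^esub> inv\<^bsub>T\<^esub> f \<in> M" if "g \<in> G" for g
      using assms(2)[OF that rep(1)[OF that]] rep(2)[OF that] that by auto
  qed
qed

lemma finite_index_K: "has_finite_index K"
proof (rule finite_indexI[of coset])
  show "finite (coset ` G)"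
    by (rule finite_subset[OF _ finite_abelianization]) (rule image_subsetI, rule coset_closed)
  show "g \<otimes>\<^bsub>T\<^esub> inv\<^bsub>T\<^esub> f \<in> K" if "g \<in> G" "f \<in> G" "coset g = coset f" for g f
    using that coset_eq_one[of "g \<otimes>\<^bsub>T\<^esub> inv\<^bsub>T\<^esub> f"] by (simp add: coset_mult coset_inv)
qed

text \<open>A coset of \<open>delta M\<close> is determined by the action on the letters and the cosets of the sections.\<close>

lemma finite_index_delta:
  assumes M: "subgroup M T" and fin: "has_finite_index M"
  shows "has_finite_index (delta M)"
proof -
  obtain F where F: "finite F" "F \<subseteq> G" "\<forall>g\<in>G. \<exists>f\<in>F. g \<otimes>\<^bsub>T\<^esub> inv\<^bsub>T\<^esub> f \<in> M"
    using fin unfolding has_finite_index_def by blast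
  then obtain r where r: "\<And>g. g \<in> G \<Longrightarrow> r g \<in> F" "\<And>g. g \<in> G \<Longrightarrow> g \<otimes>\<^bsub>T\<^esub> inv\<^bsub>T\<^esub> (r g) \<in> M"
    by metis
  define key where "key g = (\<lambda>x\<in>X. root_perm g x, \<lambda>x\<in>X. r (sec g x))" for g
  show ?thesis
  proof (rule finite_indexI[of key])
    have "key ` G \<subseteq> (X \<rightarrow>\<^sub>E X) \<times> (X \<rightarrow>\<^sub>E F)"
      using r(1) root_in_X' by (auto simp: key_def)
    moreover have "finite ((X \<rightarrow>\<^sub>E X) \<times> (X \<rightarrow>\<^sub>E F))"
      using finite_X F(1) by (intro finite_cartesian_product finite_PiE) auto
    ultimately show "finite (key ` G)" by (rule finite_subset)
    fix g f assume g: "g \<in> G" and f: "f \<in> G" and key: "key g = key f"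
    have gT: "g \<in> carrier T" and fT: "f \<in> carrier T" using g f by simp_all
    have root: "root_perm g x = root_perm f x" and rs: "r (sec g x) = r (sec f x)" if "x \<in> X" for x
    proof -
      have "(\<lambda>x\<in>X. root_perm g x) = (\<lambda>x\<in>X. root_perm f x)" "(\<lambda>x\<in>X. r (sec g x)) = (\<lambda>x\<in>X. r (sec f x))"
        using key by (simp_all add: key_def)
      then show "root_perm g x = root_perm f x" "r (sec g x) = r (sec f x)"
        using that by (auto dest: fun_cong[of _ _ x])
    qed
    have root: "root_perm g x = root_perm f x" for x
      using root root_outside[OF gT] root_outside[OF fT] by (cases "x \<in> X") auto
    show "g \<otimes>\<^bsub>T\<^esub> inv\<^bsub>T\<^esub> f \<in> delta M"
    proof (rule deltaI)
      show "root_perm (g \<otimes>\<^bsub>T\<^esub> inv\<^bsub>T\<^esub> f) x = x" for x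
        using gT fT root[of x] by (simp add: root_perm_mult)
      fix x assume x: "x \<in> X"
      let ?r = "r (sec f x)"
      have rT: "?r \<in> carrier T" using r(1)[of "sec f x"] f F(2) by auto
      have "sec g x \<otimes>\<^bsub>T\<^esub> inv\<^bsub>T\<^esub> ?r \<in> M" "sec f x \<otimes>\<^bsub>T\<^esub> inv\<^bsub>T\<^esub> ?r \<in> M"
        using r(2)[of "sec g x"] r(2)[of "sec f x"] g f rs[OF x] by simp_all
      then have "sec g x \<otimes>\<^bsub>T\<^esub> inv\<^bsub>T\<^esub> ?r \<otimes>\<^bsub>T\<^esub> inv\<^bsub>T\<^esub> (sec f x \<otimes>\<^bsub>T\<^esub> inv\<^bsub>T\<^esub> ?r) \<in> M"
        using subgroup.m_closed[OF M] subgroup.m_inv_closed[OF M] by blast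
      also have "sec g x \<otimes>\<^bsub>T\<^esub> inv\<^bsub>T\<^esub> ?r \<otimes>\<^bsub>T\<^esub> inv\<^bsub>T\<^esub> (sec f x \<otimes>\<^bsub>T\<^esub> inv\<^bsub>T\<^esub> ?r) = sec g x \<otimes>\<^bsub>T\<^esub> inv\<^bsub>T\<^esub> (sec f x)"
        using gT fT rT by (simp add: T.inv_mult_group T.m_assoc)
      also have "\<dots> = sec (g \<otimes>\<^bsub>T\<^esub> inv\<^bsub>T\<^esub> f) x"
        using gT fT sec_inv[OF fT root[symmetric], of x] by (simp add: sec_mult)
      finally show "sec (g \<otimes>\<^bsub>T\<^esub> inv\<^bsub>T\<^esub> f) x \<in> M" .
    qed (use gT fT in simp)
  qed
qed

lemma finite_index_delta_pow: "has_finite_index ((delta ^^ l) K)"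
  by (induction l) (simp_all add: finite_index_K finite_index_delta delta_pow_subgroup)

lemma finite_quotient:
  assumes "has_finite_index M" "M \<subseteq> N" "N \<lhd> TG"
  shows "finite (carrier (TG Mod N))"
proof -
  interpret N: normal N TG by (rule assms(3))
  obtain F where F: "finite F" "F \<subseteq> G" "\<forall>g\<in>G. \<exists>f\<in>F. g \<otimes>\<^bsub>T\<^esub> inv\<^bsub>T\<^esub> f \<in> M"
    using assms(1) unfolding has_finite_index_def by blast
  have "carrier (TG Mod N) \<subseteq> (\<lambda>f. N #>\<^bsub>TG\<^esub> f) ` F"
  proof
    fix C assume "C \<in> carrier (TG Mod N)"
    then obtain g where g: "g \<in> G" "C = N #>\<^bsub>TG\<^esub> g" by (auto simp: carrier_FactGroup)
    then obtain f where f: "f \<in> F" "f \<in> G" "g \<otimes>\<^bsub>T\<^esub> inv\<^bsub>T\<^esub> f \<in> N" using F assms(2) by blast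
    have "g = (g \<otimes>\<^bsub>T\<^esub> inv\<^bsub>T\<^esub> f) \<otimes>\<^bsub>T\<^esub> f" using f(2) g(1) by (simp add: T.m_assoc)
    then have "g \<in> N #>\<^bsub>TG\<^esub> f" using f(3) unfolding r_coset_def by auto
    then have "N #>\<^bsub>TG\<^esub> f = N #>\<^bsub>TG\<^esub> g"
      using TG.repr_independence[OF _ _ N.subgroup_axioms, of g f] f(2) by simp
    then show "C \<in> (\<lambda>f. N #>\<^bsub>TG\<^esub> f) ` F" using f(1) g(2) by blast
  qed
  then show ?thesis using finite_subset F(1) by blast
qed

lemma infinite_G: "infinite G"
proof
  assume fin: "finite G"
  define n where "n = card G"
  define u where "u = replicate n (1 :: nat)"
  define L where "L = {v. set v \<subseteq> X \<and> length v = n}"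
  have u: "u \<in> vertices d" using d_ge by (auto simp: u_def vertices_def)
  have "L \<subseteq> (\<lambda>g. g u) ` G"
  proof
    fix v assume "v \<in> L"
    then have "v \<in> vertices d" "length u = length v" by (auto simp: L_def vertices_def u_def X_def)
    then obtain g where "g \<in> G" "g u = v"
      using level_transitive_G u unfolding level_transitive_def by blast
    then show "v \<in> (\<lambda>g. g u) ` G" by blast
  qed
  then have "card L \<le> n"
    using card_mono[OF finite_imageI[OF fin]] card_image_le[OF fin] unfolding n_def by (meson le_trans)
  moreover have "card L = d ^ n"
    using card_lists_length_eq[OF finite_X, of n] by (simp add: L_def card_X)
  moreover have "2 ^ n \<le> d ^ n" using d_ge by (intro power_mono) auto
  ultimately show False using less_exp[of n] by linarith
qed

text \<open>Induction on the length of a word \<open>w\<close> moved by some \<open>g\<close> in \<open>N\<close>.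

  If \<open>g\<close> moves a letter \<open>x\<close> to \<open>y\<close>, then the commutator of \<open>g\<close> with \<open>s\<close> at \<open>x\<close> is an element of \<open>N\<close> with section
  \<open>s\<close> at \<open>x\<close> and some section at \<open>y\<close>; its commutator with \<open>t\<close> at \<open>x\<close> is \<open>[s, t]\<close> at \<open>x\<close>.  So \<open>N\<close>
  contains \<open>[s, t]\<close> at \<open>x\<close> for all \<open>s\<close>, \<open>t\<close> in \<open>K\<close>.

  Otherwise a section of \<open>g\<close> moves a shorter word.  The sections at \<open>x\<close> of elements of \<open>N\<close> in the first level
  stabilizer form a normal subgroup \<open>N'\<close> of \<open>G\<close>, to which the induction hypothesis applies.  Commutators
  of elements of \<open>N\<close> with \<open>t\<close> at \<open>x\<close> show that \<open>N\<close> contains \<open>[s, t]\<close> at \<open>x\<close> for all \<open>s\<close> in \<open>N'\<close>, \<open>t\<close> in \<open>K\<close>.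

  In both cases \<open>finish\<close> concludes from commutators at one letter by \<open>commutators_contain_delta\<close>, which costs
  one level, and by transport to the other letters, which costs another one.\<close>

lemma normal_contains_delta_pow:
  assumes d: "4 \<le> d"
  shows "N \<lhd> TG \<Longrightarrow> g \<in> N \<Longrightarrow> w \<in> vertices d \<Longrightarrow> g w \<noteq> w \<Longrightarrow> \<exists>l. (delta ^^ l) K \<subseteq> N"
proof (induction "length w" arbitrary: N g w rule: less_induct)
  case less
  have sub: "subgroup N TG" using less.prems(1) by (rule normal_imp_subgroup)
  then have NG: "N \<subseteq> G" using subgroup.subset by fastforce
  have NT: "subgroup N T" using T.incl_subgroup[OF G_subgroup sub] .
  have conj: "inv\<^bsub>T\<^esub> s \<otimes>\<^bsub>T\<^esub> h \<otimes>\<^bsub>T\<^esub> s \<in> N" if "h \<in> N" "s \<in> G" for h s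
    using normal.inv_op_closed1[OF less.prems(1), of s h] that inv_TG by simp
  have conj': "s \<otimes>\<^bsub>T\<^esub> h \<otimes>\<^bsub>T\<^esub> inv\<^bsub>T\<^esub> s \<in> N" if "h \<in> N" "s \<in> G" for h s
    using conj[of h "inv\<^bsub>T\<^esub> s"] that by simp
  have g: "g \<in> G" "g \<in> carrier T" using less.prems NG by auto
  have comm: "comm h s \<in> N" if "h \<in> N" "s \<in> G" for h s
  proof -
    have "h \<otimes>\<^bsub>T\<^esub> (s \<otimes>\<^bsub>T\<^esub> inv\<^bsub>T\<^esub> h \<otimes>\<^bsub>T\<^esub> inv\<^bsub>T\<^esub> s) \<in> N"
      using that by (intro subgroup.m_closed[OF NT] conj' subgroup.m_inv_closed[OF NT])
    then show ?thesis using that NG by (simp add: T.m_assoc subset_iff)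
  qed
  have finish: "\<exists>l. (delta ^^ l) K \<subseteq> N"
    if x: "x \<in> X" and c: "\<And>s t. s \<in> (delta ^^ l) K \<Longrightarrow> t \<in> (delta ^^ l) K \<Longrightarrow> single x (comm s t) \<in> N" for x l
  proof -
    have "(delta ^^ Suc l) K \<subseteq> {k \<in> carrier T. single x k \<in> N}"
    proof (rule commutators_contain_delta[OF d single_preimage_subgroup[OF NT x]])
      fix s t assume st: "s \<in> (delta ^^ l) K" "t \<in> (delta ^^ l) K"
      then have "s \<in> carrier T" "t \<in> carrier T" using delta_pow_subset[of l] by auto
      then show "comm s t \<in> {k \<in> carrier T. single x k \<in> N}" using c[OF st] by simp
    qed
    then have "single y k \<in> N" if "y \<in> X" "k \<in> (delta ^^ Suc l) K" for y k
      using single_move[OF less.prems(1) x that(1), of k] that(2) by blast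
    then have "delta ((delta ^^ Suc l) K) \<subseteq> N" using delta_subset[OF NT] by blast
    then have "(delta ^^ Suc (Suc l)) K \<subseteq> N" by simp
    then show ?thesis by blast
  qed
  show ?case
  proof (cases "\<exists>x\<in>X. root_perm g x \<noteq> x")
    case True
    then obtain x where x: "x \<in> X" "root_perm g x \<noteq> x" by blast
    have "single x (comm s t) \<in> N" if s: "s \<in> (delta ^^ 0) K" and t: "t \<in> (delta ^^ 0) K" for s t
    proof -
      have st: "s \<in> K" "t \<in> K" "s \<in> carrier T" "t \<in> carrier T" using s t by simp_all
      define y where "y = root_perm g x"
      have y: "y \<in> X" "y \<noteq> x" using x root_in_X'[OF g(2) x(1)] by (simp_all add: y_def)
      define k where "k = inv\<^bsub>T\<^esub> (sec g x) \<otimes>\<^bsub>T\<^esub> inv\<^bsub>T\<^esub> s \<otimes>\<^bsub>T\<^esub> sec g x"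
      have kT: "k \<in> carrier T" using g st by (simp add: k_def)
      have sK: "single x s \<in> G" "single x t \<in> G" "single x (inv\<^bsub>T\<^esub> s) \<in> G"
        using branching[OF x(1)] st by simp_all
      define c where "c = single x s \<otimes>\<^bsub>T\<^esub> single y k"
      have c_eq: "c = (single x s \<otimes>\<^bsub>T\<^esub> inv\<^bsub>T\<^esub> g \<otimes>\<^bsub>T\<^esub> inv\<^bsub>T\<^esub> (single x s)) \<otimes>\<^bsub>T\<^esub> g"
        using single_conj[OF x(1), of "inv\<^bsub>T\<^esub> s" g y] g st single_inv[OF x(1) st(3)] sK(1,3)
        unfolding c_def k_def y_def by (simp add: T.m_assoc)
      have "c \<in> N"
        unfolding c_eq using sK less.prems(2)
        by (intro subgroup.m_closed[OF NT] conj' subgroup.m_inv_closed[OF NT])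
      then have "comm c (single x t) \<in> N" using comm sK by blast
      moreover have "comm c (single x t) = single x (comm (sec c x) t)"
      proof (rule comm_single[OF x(1) st(4)])
        show "c \<in> carrier T" using \<open>c \<in> N\<close> NG by auto
        show "root_perm c x = x"
          using single_in_T[OF x(1) st(3)] single_in_T[OF y(1) kT] by (simp add: c_def root_perm_mult)
      qed
      moreover have sec_c: "sec c x = s"
        using single_in_T[OF x(1) st(3)] single_in_T[OF y(1) kT] y(2) by (simp add: c_def sec_mult id_mult[unfolded id_def])
      ultimately show ?thesis unfolding sec_c by simp
    qed
    then show ?thesis by (rule finish[OF x(1)])
  next
    case False
    then have root: "root_perm g x = x" for x using root_outside[OF g(2)] by blast
    obtain x v where w: "w = x # v" using less.prems(4) in_T(2)[OF g(2)] by (cases w) auto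
    have v: "v \<in> vertices d" "x \<in> X" using less.prems(3) w by auto
    have moved: "sec g x v \<noteq> v" using aut_Cons[OF g(2) v(1), of x] less.prems(4) w root by auto
    define N' where "N' = {sec u x | u. u \<in> N \<inter> G1}"
    have N'I: "h \<in> N'" if "u \<in> N \<inter> G1" "sec u x = h" for u h
      using that by (auto simp: N'_def)
    have "N' \<lhd> TG"
      unfolding TG.normal_inv_iff
    proof (intro conjI ballI)
      show "subgroup N' TG"
      proof (rule TG.subgroupI)
        show "N' \<subseteq> carrier TG" by (auto simp: N'_def)
        have "id \<in> N'" using subgroup.one_closed[OF NT] G1_closed(3)
          by (auto simp: N'_def one_T intro!: exI[of _ id])
        then show "N' \<noteq> {}" by blast
        show "inv\<^bsub>TG\<^esub> h \<in> N'" if h: "h \<in> N'" for h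
        proof -
          obtain u where u: "u \<in> N" "u \<in> G1" "h = sec u x" using h by (auto simp: N'_def)
          then have "inv\<^bsub>T\<^esub> u \<in> N \<inter> G1" "sec (inv\<^bsub>T\<^esub> u) x = inv\<^bsub>TG\<^esub> h"
            using subgroup.m_inv_closed[OF NT] by (simp_all add: sec_inv_G1 inv_TG)
          then show ?thesis by (rule N'I)
        qed
        show "h \<otimes>\<^bsub>TG\<^esub> k \<in> N'" if h: "h \<in> N'" and k: "k \<in> N'" for h k
        proof -
          obtain u where u: "u \<in> N" "u \<in> G1" "h = sec u x" using h by (auto simp: N'_def)
          obtain v where v: "v \<in> N" "v \<in> G1" "k = sec v x" using k by (auto simp: N'_def)
          have "u \<otimes>\<^bsub>T\<^esub> v \<in> N \<inter> G1" "sec (u \<otimes>\<^bsub>T\<^esub> v) x = h \<otimes>\<^bsub>TG\<^esub> k"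
            using u v subgroup.m_closed[OF NT] by (simp_all add: sec_mult_G1)
          then show ?thesis by (rule N'I)
        qed
      qed
      fix s h assume s: "s \<in> carrier TG" and h: "h \<in> N'"
      obtain u where u: "u \<in> N" "u \<in> G1" "h = sec u x" using h by (auto simp: N'_def)
      obtain v where v: "v \<in> G1" "sec v x = s" using sections_full[OF v(2), of s] s by auto
      have "v \<otimes>\<^bsub>T\<^esub> u \<otimes>\<^bsub>T\<^esub> inv\<^bsub>T\<^esub> v \<in> N \<inter> G1"
        using conj'[OF u(1) G1_in_G[OF v(1)]] u v by simp
      moreover have "sec (v \<otimes>\<^bsub>T\<^esub> u \<otimes>\<^bsub>T\<^esub> inv\<^bsub>T\<^esub> v) x = s \<otimes>\<^bsub>TG\<^esub> h \<otimes>\<^bsub>TG\<^esub> inv\<^bsub>TG\<^esub> s"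
        using u v s by (simp add: sec_mult_G1 sec_inv_G1 inv_TG)
      ultimately show "s \<otimes>\<^bsub>TG\<^esub> h \<otimes>\<^bsub>TG\<^esub> inv\<^bsub>TG\<^esub> s \<in> N'" by (rule N'I)
    qed
    moreover have "sec g x \<in> N'" using less.prems(2) g root by (auto simp: N'_def G1_iff)
    moreover have "length v < length w" by (simp add: w)
    ultimately obtain l where l: "(delta ^^ l) K \<subseteq> N'" using less.hyps v(1) moved by blast
    have "single x (comm s t) \<in> N" if s: "s \<in> (delta ^^ l) K" and t': "t \<in> (delta ^^ l) K" for s t
    proof -
      have t: "t \<in> K" "t \<in> carrier T" using t' delta_pow_subset[of l] by auto
      obtain u where u: "u \<in> N" "u \<in> G1" "s = sec u x" using s l by (auto simp: N'_def)
      have "comm u (single x t) \<in> N" using comm[OF u(1)] branching[OF v(2) t(1)] by simp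
      then show ?thesis
        using comm_single[OF v(2) t(2) G1_in_T[OF u(2)] root_G1[OF u(2)]] unfolding u(3) by simp
    qed
    then show ?thesis by (rule finish[OF v(2)])
  qed
qed

lemma just_infinite_G:
  assumes d: "4 \<le> d"
  shows "just_infinite TG"
  unfolding just_infinite_def
proof (intro conjI allI impI)
  show "infinite (carrier TG)" using infinite_G by simp
  fix N assume N: "N \<lhd> TG" "N \<noteq> {\<one>\<^bsub>TG\<^esub>}"
  have sub: "subgroup N TG" using N(1) by (rule normal_imp_subgroup)
  then have "\<one>\<^bsub>TG\<^esub> \<in> N" by (rule subgroup.one_closed)
  then obtain g where g: "g \<in> N" "g \<noteq> id" using N(2) one_T by auto
  then obtain w where w: "g w \<noteq> w" by (metis eq_id_iff)
  have "g \<in> carrier T" using g sub subgroup.subset by fastforce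
  then have "w \<in> vertices d" using w aut_not_vertex by blast
  then obtain l where "(delta ^^ l) K \<subseteq> N" using normal_contains_delta_pow[OF d N(1) g(1) _ w] by blast
  then show "finite (carrier (TG Mod N))"
    using finite_quotient[OF finite_index_delta_pow _ N(1)] by blast
qed

end

section \<open>The infinite dihedral quotient for three letters\<close>

text \<open>The reflections by which the generators act on the integers; the third one acts trivially.\<close>

fun flip :: "nat \<Rightarrow> int \<Rightarrow> int" where
  "flip i n = (if i = 1 then - n else if i = 2 then 1 - n else n)"

fun flips :: "nat list \<Rightarrow> int \<Rightarrow> int" where
  "flips [] n = n"
| "flips (i # w) n = flips w (flip i n)"

lemma flip_flip [simp]: "flip i (flip i n) = n"
  by simp

declare flip.simps [simp del]

lemma flips_append: "flips (v @ w) n = flips w (flips v n)"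
  by (induction v arbitrary: n) simp_all

lemma flips_rev [simp]: "flips (rev w) (flips w n) = n"
  by (induction w arbitrary: n) (simp_all add: flips_append)

lemma flips_rev' [simp]: "flips w (flips (rev w) n) = n"
  using flips_rev[of "rev w" n] by simp

text \<open>Each generator acts on the form as it acts on the integers: on triples, \<open>a\<^sub>1\<close> negates \<open>x\<^sub>1\<close> and exchanges
  \<open>x\<^sub>2\<close> with \<open>x\<^sub>3\<close>, which negates the form; \<open>a\<^sub>2\<close> replaces \<open>x\<^sub>2\<close> by \<open>1 - x\<^sub>2\<close> and exchanges \<open>x\<^sub>1\<close> with \<open>x\<^sub>3\<close>, which
  replaces the form \<open>f\<close> by \<open>1 - f\<close>; and \<open>a\<^sub>3\<close> exchanges \<open>x\<^sub>1\<close> with \<open>x\<^sub>2\<close>, which preserves it.\<close>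

definition balance :: "(nat \<Rightarrow> int) \<Rightarrow> int" where
  "balance x = x 1 + x 2 - x 3"

locale hanoi_three = hanoi_group +
  assumes d_eq: "d = 3"
begin

lemma m_eq: "m = 2"
  using d_eq m_ge m_less by simp

lemma X_eq: "X = {1, 2, 3}"
  using X_3[OF d_eq] .

lemma in_X_3: "1 \<in> X" "2 \<in> X" "3 \<in> X"
  by (simp_all add: X_eq)

text \<open>The generator exchanges the two letters different from \<open>i\<close>, and the three letters add up to \<open>6\<close>.\<close>

lemma root_a_three:
  assumes "i \<in> X" "x \<in> X"
  shows "root_perm (a i) x = (if x = i then x else 6 - i - x)"
proof -
  note c = hanoi_cycle_three[OF d_eq]
  have "i = 1 \<or> i = 2 \<or> i = 3" "x = 1 \<or> x = 2 \<or> x = 3" using assms by (auto simp: X_eq)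
  then show ?thesis
    by (elim disjE) (simp_all add: root_a c transpose_def del: One_nat_def)
qed

lemma a_square: "i \<in> X \<Longrightarrow> a i \<otimes>\<^bsub>T\<^esub> a i = id"
  using a_pow_m[of i] m_eq by (simp add: numeral_2_eq_2 one_T)

lemma a_square': "i \<in> X \<Longrightarrow> h \<in> carrier T \<Longrightarrow> a i \<otimes>\<^bsub>T\<^esub> (a i \<otimes>\<^bsub>T\<^esub> h) = h"
  using a_square[of i] by (simp add: T.m_assoc[symmetric])

lemma inv_a: "i \<in> X \<Longrightarrow> inv\<^bsub>T\<^esub> (a i) = a i"
  using a_square[of i] by (intro T.inv_equality) (simp_all add: one_T)

lemma root_a_involution: "i \<in> X \<Longrightarrow> root_perm (a i) (root_perm (a i) x) = x"
  using root_perm_mult[of "a i" "a i" x] a_square[of i] by simp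

text \<open>Since the generators are involutions, positive words suffice.  Working with words is necessary because
  the action on the integers is a priori only defined for them.\<close>

fun word_prod :: "nat list \<Rightarrow> nat list \<Rightarrow> nat list" where
  "word_prod [] = id"
| "word_prod (i # w) = a i \<otimes>\<^bsub>T\<^esub> word_prod w"

fun word_sec :: "nat list \<Rightarrow> nat \<Rightarrow> nat list" where
  "word_sec [] x = []"
| "word_sec (i # w) x = (if x = i then [i] else []) @ word_sec w (root_perm (a i) x)"

lemma word_prod_in_T [simp]: "word_prod w \<in> carrier T"
proof (induction w)
  case Nil
  show ?case using id_in_T by (simp only: word_prod.simps)
qed simp

lemma word_prod_in_G [simp]: "w \<in> lists X \<Longrightarrow> word_prod w \<in> G"
proof (induction w)
  case Nil
  show ?case using G_closed(3) by (simp only: word_prod.simps)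
qed simp

lemma word_prod_append: "word_prod (v @ w) = word_prod v \<otimes>\<^bsub>T\<^esub> word_prod w"
proof (induction v)
  case Nil
  show ?case by (simp only: word_prod.simps id_mult append_Nil)
qed (simp add: T.m_assoc)

lemma word_prod_single: "word_prod [i] = a i"
  by (simp only: word_prod.simps id_mult)

lemma word_prod_rev: "w \<in> lists X \<Longrightarrow> word_prod (rev w) = inv\<^bsub>T\<^esub> (word_prod w)"
proof (induction w)
  case Nil
  show ?case by (simp only: word_prod.simps inv_id rev.simps)
next
  case (Cons i w)
  then show ?case by (simp add: word_prod_append T.inv_mult_group inv_a word_prod_single del: word_prod.simps) (simp add: T.inv_mult_group inv_a)
qed

lemma word_sec_in_lists: "w \<in> lists X \<Longrightarrow> word_sec w x \<in> lists X"
  by (induction w arbitrary: x) auto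

lemma sec_word_prod: "w \<in> lists X \<Longrightarrow> sec (word_prod w) x = word_prod (word_sec w x)"
proof (induction w arbitrary: x)
  case Nil
  show ?case by (simp only: word_prod.simps word_sec.simps sec_id)
next
  case (Cons i w)
  then show ?case by (simp add: sec_mult sec_a id_mult[unfolded id_def])
qed

lemma root_word_prod_Cons: "root_perm (word_prod (i # w)) x = root_perm (word_prod w) (root_perm (a i) x)"
  by (simp add: root_perm_mult)

lemma G_eq_word_prod:
  assumes "g \<in> G"
  shows "\<exists>w\<in>lists X. word_prod w = g"
  using assms
proof (induction rule: G_induct)
  case id
  have "word_prod [] = id" by simp
  then show ?case by (metis lists.Nil word_prod.simps(1))
next
  case (gen i)
  then show ?case by (intro bexI[of _ "[i]"]) (simp_all add: word_prod_single del: word_prod.simps)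
next
  case (inv i)
  then show ?case by (intro bexI[of _ "[i]"]) (simp_all add: word_prod_single inv_a del: word_prod.simps)
next
  case (mult g h)
  then obtain v w where "v \<in> lists X" "word_prod v = g" "w \<in> lists X" "word_prod w = h" by blast
  then show ?case by (intro bexI[of _ "v @ w"]) (simp_all add: word_prod_append)
qed

text \<open>A word \<open>w\<close> carries the integer \<open>x v\<close> at the letter \<open>v\<close> along to the image of \<open>v\<close> and applies the
  section of \<open>w\<close> at \<open>v\<close> to it.  The form \<open>balance\<close> then changes by the action of \<open>w\<close> itself.\<close>

lemma balance_equivariant:
  assumes "w \<in> lists X" "\<And>v. v \<in> X \<Longrightarrow> y (root_perm (word_prod w) v) = flips (word_sec w v) (x v)"
  shows "balance y = flips w (balance x)"
  using assms
proof (induction w arbitrary: x rule: list.induct)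
  case Nil
  have root: "root_perm (word_prod []) v = v" for v by (simp only: word_prod.simps root_perm_id)
  have "y v = x v" if "v \<in> X" for v using Nil(2)[OF that] unfolding root by simp
  then show ?case by (simp add: balance_def X_eq)
next
  case (Cons i w)
  have i: "i \<in> X" and w: "w \<in> lists X" using Cons.prems(1) by auto
  define x' where "x' u = (if u = i then flip i (x i) else x (root_perm (a i) u))" for u
  have self: "root_perm (a i) u = i \<longleftrightarrow> u = i" for u
    using root_a_self[OF i] root_perm_inj[OF a_in_T, of i u i] by auto
  have "balance y = flips w (balance x')"
  proof (rule Cons.IH[OF w])
    fix u assume u: "u \<in> X"
    define v where "v = root_perm (a i) u"
    have v: "v \<in> X" "root_perm (a i) v = u"
      using root_in_X'[OF a_in_T u] root_a_involution[OF i] by (simp_all add: v_def)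
    have "y (root_perm (word_prod w) u) = flips (word_sec (i # w) v) (x v)"
      using Cons.prems(2)[OF v(1)] v(2) by (simp only: root_word_prod_Cons)
    also have "\<dots> = flips (word_sec w u) (x' u)"
      using v self[of v] root_a_self[OF i] by (cases "v = i") (auto simp: x'_def v_def[symmetric])
    finally show "y (root_perm (word_prod w) u) = flips (word_sec w u) (x' u)" .
  qed
  also have "balance x' = flip i (balance x)"
  proof -
    have "i = 1 \<or> i = 2 \<or> i = 3" using i by (auto simp: X_eq)
    then show ?thesis
      using in_X_3 by (elim disjE)
        (simp_all add: balance_def x'_def root_a_three flip.simps flip: One_nat_def)
  qed
  finally show ?case by simp
qed

lemma length_word_sec: "length (word_sec w x) \<le> length w"
proof (induction w arbitrary: x)
  case (Cons i w)
  have "length (word_sec w (root_perm (a i) x)) \<le> length w" by (rule Cons)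
  then show ?case by auto
qed simp

text \<open>A letter survives in the section at \<open>x\<close> only if the path of \<open>x\<close> is at that letter, where it then stays.\<close>

lemma word_sec_full_length:
  assumes "w \<in> lists X" "length (word_sec w x) = length w"
  shows "w = replicate (length w) x"
  using assms
proof (induction w rule: list.induct)
  case (Cons i w)
  have "x = i" using Cons.prems(2) length_word_sec[of w "root_perm (a i) x"] by (cases "x = i") auto
  then show ?case using Cons root_a_self by simp
qed simp

lemma a_neq_id: "i \<in> X \<Longrightarrow> a i \<noteq> id"
proof
  assume i: "i \<in> X" and id: "a i = id"
  have "root_perm (a i) x = x" for x using id by simp
  then show False using root_a_three[OF i] i in_X_3 by (force simp: X_eq)
qed

text \<open>If all sections of \<open>w\<close> are shorter than \<open>w\<close>, they act trivially on the integers by the induction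
  hypothesis, and so does \<open>w\<close> by \<open>balance_equivariant\<close>.  Otherwise \<open>w\<close> is a power of a single letter, and
  two equal letters cancel.\<close>

lemma flips_trivial:
  "w \<in> lists X \<Longrightarrow> word_prod w = id \<Longrightarrow> flips w n = n"
proof (induction "length w" arbitrary: w n rule: less_induct)
  case less
  show ?case
  proof (cases "\<forall>v\<in>X. length (word_sec w v) < length w")
    case True
    \<comment> \<open>Some triple on which \<open>balance\<close> takes the value \<open>n\<close>.\<close>
    define x where "x v = (if v = 1 then n else 0)" for v :: nat
    have "flips (word_sec w v) (x v) = x v" if "v \<in> X" for v
    proof (rule less.hyps)
      show "length (word_sec w v) < length w" using True that by simp
      show "word_sec w v \<in> lists X" using less.prems(1) by (rule word_sec_in_lists)
      show "word_prod (word_sec w v) = id"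
        using sec_word_prod[OF less.prems(1), of v] less.prems(2) sec_id[of v] by metis
    qed
    moreover have "root_perm (word_prod w) v = v" for v unfolding less.prems(2) by (rule root_perm_id)
    ultimately have "balance x = flips w (balance x)"
      using less.prems(1) by (intro balance_equivariant) simp_all
    moreover have "balance x = n" by (simp add: balance_def x_def)
    ultimately show ?thesis by simp
  next
    case False
    then obtain v where v: "v \<in> X" "length (word_sec w v) = length w"
      using length_word_sec[of w] by (metis le_neq_implies_less)
    then have w: "w = replicate (length w) v" using word_sec_full_length less.prems(1) by blast
    consider "w = []" | "w = [v]" | w' where "w = v # v # w'"
      using w by (metis length_Cons list.exhaust list.size(3) replicate_Suc replicate_0 list.sel(1,3))
    then show ?thesis
    proof cases
      case 2
      then show ?thesis using less.prems(2) a_neq_id[OF v(1)] word_prod_single by metis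
    next
      case 3
      then have "word_prod w' = id" using less.prems(2) a_square'[OF v(1), of "word_prod w'"] by simp
      then have "flips w' n = n" using less.prems(1) 3 by (intro less.hyps) auto
      then show ?thesis by (simp add: 3)
    qed simp
  qed
qed

lemma flips_cong:
  assumes "v \<in> lists X" "w \<in> lists X" "word_prod v = word_prod w"
  shows "flips v = flips w"
proof
  fix n
  have "word_prod (v @ rev w) = id"
    using assms word_prod_rev[OF assms(2)] T.r_inv[of "word_prod w"] by (simp only: word_prod_append one_T word_prod_in_T)
  then have "flips (v @ rev w) n = n" using assms by (intro flips_trivial) auto
  then have "flips (rev w) (flips v n) = n" by (simp add: flips_append)
  then show "flips v n = flips w n" by (metis flips_rev')
qed

definition word_of :: "(nat list \<Rightarrow> nat list) \<Rightarrow> nat list" where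
  "word_of g = (SOME w. w \<in> lists X \<and> word_prod w = g)"

definition dihedral :: "(nat list \<Rightarrow> nat list) \<Rightarrow> int \<Rightarrow> int" where
  "dihedral g = flips (word_of g)"

lemma word_of: "g \<in> G \<Longrightarrow> word_of g \<in> lists X" "g \<in> G \<Longrightarrow> word_prod (word_of g) = g"
  using someI_ex[of "\<lambda>w. w \<in> lists X \<and> word_prod w = g"] G_eq_word_prod[of g] unfolding word_of_def by blast+

lemma dihedral_word_prod: "w \<in> lists X \<Longrightarrow> dihedral (word_prod w) = flips w"
  unfolding dihedral_def using word_of[of "word_prod w"] by (intro flips_cong) simp_all

lemma dihedral_mult:
  assumes "g \<in> G" "h \<in> G"
  shows "dihedral (g \<otimes>\<^bsub>T\<^esub> h) n = dihedral h (dihedral g n)"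
proof -
  have "word_prod (word_of g @ word_of h) = g \<otimes>\<^bsub>T\<^esub> h" using word_of assms by (simp add: word_prod_append)
  moreover have "word_of g @ word_of h \<in> lists X" using word_of assms by simp
  ultimately have "dihedral (g \<otimes>\<^bsub>T\<^esub> h) = flips (word_of g @ word_of h)" using dihedral_word_prod by metis
  then show ?thesis by (simp add: flips_append dihedral_def)
qed

lemma dihedral_id: "dihedral id n = n"
  using dihedral_word_prod[of "[]"] by simp

lemma dihedral_inv:
  assumes "g \<in> G"
  shows "dihedral (inv\<^bsub>T\<^esub> g) (dihedral g n) = n" "dihedral g (dihedral (inv\<^bsub>T\<^esub> g) n) = n"
  using dihedral_mult[of g "inv\<^bsub>T\<^esub> g" n] dihedral_mult[of "inv\<^bsub>T\<^esub> g" g n] assms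
  by (simp_all add: dihedral_id one_T)

definition dihedral_kernel :: "(nat list \<Rightarrow> nat list) set" where
  "dihedral_kernel = {g \<in> G. \<forall>n. dihedral g n = n}"

lemma dihedral_kernel_normal: "dihedral_kernel \<lhd> TG"
  unfolding TG.normal_inv_iff
proof (intro conjI ballI)
  show "subgroup dihedral_kernel TG"
  proof (rule TG.subgroupI)
    have "id \<in> dihedral_kernel" using G_closed(3) dihedral_id by (simp only: dihedral_kernel_def mem_Collect_eq) simp
    then show "dihedral_kernel \<noteq> {}" by blast
    show "inv\<^bsub>TG\<^esub> g \<in> dihedral_kernel" if "g \<in> dihedral_kernel" for g
    proof -
      have g: "g \<in> G" "\<And>n. dihedral g n = n" using that by (auto simp: dihedral_kernel_def)
      then have "dihedral (inv\<^bsub>T\<^esub> g) n = n" for n using dihedral_inv(1)[OF g(1), of n] by simp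
      then show ?thesis using g(1) by (simp add: dihedral_kernel_def inv_TG)
    qed
  qed (auto simp: dihedral_kernel_def dihedral_mult)
  fix s g assume "s \<in> carrier TG" "g \<in> dihedral_kernel"
  then show "s \<otimes>\<^bsub>TG\<^esub> g \<otimes>\<^bsub>TG\<^esub> inv\<^bsub>TG\<^esub> s \<in> dihedral_kernel"
    using dihedral_inv(1)[of s] by (simp add: dihedral_kernel_def inv_TG dihedral_mult)
qed

text \<open>The product \<open>a\<^sub>1 a\<^sub>2\<close> acts as the translation \<open>n \<mapsto> n + 1\<close>.\<close>

lemma infinite_dihedral_image: "infinite (dihedral ` G)"
proof -
  define t where "t n = concat (replicate n [1, 2 :: nat])" for n
  have t: "t n \<in> lists X" for n using in_X_3 by (induction n) (auto simp: t_def)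
  have flips_t: "flips (t n) k = k + int n" for n k
    by (induction n arbitrary: k) (simp_all add: t_def flip.simps)
  have "inj (\<lambda>n. dihedral (word_prod (t n)))"
  proof (rule injI)
    fix n k assume "dihedral (word_prod (t n)) = dihedral (word_prod (t k))"
    then have "flips (t n) 0 = flips (t k) 0" using t by (simp add: dihedral_word_prod)
    then show "n = k" by (simp add: flips_t)
  qed
  then have "infinite (range (\<lambda>n. dihedral (word_prod (t n))))" 
    using finite_imageD[of "\<lambda>n. dihedral (word_prod (t n))" UNIV] infinite_UNIV_nat by blast
  moreover have "range (\<lambda>n. dihedral (word_prod (t n))) \<subseteq> dihedral ` G" using t by auto
  ultimately show ?thesis using finite_subset by blast
qed

lemma not_just_infinite: "\<not> just_infinite TG"
proof
  assume "just_infinite TG"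
  moreover have "dihedral_kernel \<noteq> {\<one>\<^bsub>TG\<^esub>}"
  proof -
    have "dihedral (a 3) n = n" for n
      using dihedral_word_prod[of "[3]"] in_X_3 by (simp add: word_prod_single flip.simps del: word_prod.simps)
    then have "a 3 \<in> dihedral_kernel" using in_X_3 by (simp add: dihedral_kernel_def)
    then show ?thesis using a_neq_id[OF in_X_3(3)] one_T by auto
  qed
  ultimately have fin: "finite (carrier (TG Mod dihedral_kernel))"
    using dihedral_kernel_normal unfolding just_infinite_def by blast
  interpret N: normal dihedral_kernel TG by (rule dihedral_kernel_normal)
  have "dihedral ` G \<subseteq> (\<lambda>C. dihedral (SOME g. g \<in> C)) ` carrier (TG Mod dihedral_kernel)"
  proof
    fix r assume "r \<in> dihedral ` G"
    then obtain g where g: "g \<in> G" "r = dihedral g" by blast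
    define C where "C = dihedral_kernel #>\<^bsub>TG\<^esub> g"
    have "g \<in> C" using TG.rcos_self[of g dihedral_kernel] g N.subgroup_axioms by (simp add: C_def)
    then have "(SOME g. g \<in> C) \<in> C" by (rule someI[of "\<lambda>g. g \<in> C"])
    then obtain k where k: "k \<in> dihedral_kernel" "(SOME g. g \<in> C) = k \<otimes>\<^bsub>T\<^esub> g"
      unfolding C_def r_coset_def by auto
    then have "dihedral (SOME g. g \<in> C) = dihedral g"
      using g by (auto simp: dihedral_kernel_def dihedral_mult)
    moreover have "C \<in> carrier (TG Mod dihedral_kernel)" using g by (auto simp: C_def carrier_FactGroup)
    ultimately show "r \<in> (\<lambda>C. dihedral (SOME g. g \<in> C)) ` carrier (TG Mod dihedral_kernel)"
      using g(2) by (metis image_eqI)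
  qed
  then show False using finite_surj[OF fin] infinite_dihedral_image by blast
qed

text \<open>Suppose that \<open>G\<close> contains the element with sections \<open>a\<^sub>1\<close>, \<open>inv a\<^sub>1 = a\<^sub>1\<close>, \<open>1\<close>.  By \<open>balance_equivariant\<close>,
  \<open>-x\<^sub>1 - x\<^sub>2 - x\<^sub>3\<close> would be a function of \<open>x\<^sub>1 + x\<^sub>2 - x\<^sub>3\<close>.  The triples \<open>(0, 0, 0)\<close> and \<open>(1, 0, 1)\<close> contradict this.\<close>

lemma hanoi_J_not_subgroup: "\<not> subgroup (hanoi_J d m) TG"
proof
  assume "subgroup (hanoi_J d m) TG"
  then have JG: "hanoi_J d m \<subseteq> G" using subgroup.subset by fastforce
  define g where "g = opposite 1 2 (a 1)"
  have gT: "g \<in> carrier T" using in_X_3 by (simp add: g_def opposite_in_T)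
  have "g \<in> level_one_stab d" using gT by (simp add: level_one_stab_iff g_def opposite_def)
  moreover have "psi d g = (\<lambda>x\<in>{1..d}. if x = 1 then a 1 else if x = 2 then inv\<^bsub>T\<^esub> (a 1) else id, id)"
    by (auto simp: psi_def g_def opposite_def fun_eq_iff)
  ultimately have "g \<in> {g \<in> level_one_stab d. \<exists>h\<in>G. \<exists>p\<in>{1..d}. \<exists>q\<in>{1..d}. p \<noteq> q \<and>
        psi d g = (\<lambda>x\<in>{1..d}. if x = p then h else if x = q then inv\<^bsub>T\<^esub> h else id, id)}"
    using a_in_G[OF in_X_3(1)] in_X_3(1,2)
    by (intro CollectI conjI bexI[of _ "a 1"] bexI[of _ 1] bexI[of _ 2]) (simp_all add: X_def)
  then have "g \<in> hanoi_J d m" unfolding hanoi_J_def by (rule generate.incl)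
  then have gG: "g \<in> G" using JG by blast
  define w where "w = word_of g"
  have w: "w \<in> lists X" "word_prod w = g" using word_of[OF gG] by (simp_all add: w_def)
  have flips_sec: "flips (word_sec w v) = dihedral (sec g v)" for v
    using dihedral_word_prod[OF word_sec_in_lists[OF w(1), of v]] sec_word_prod[OF w(1), of v] w(2) by simp
  have dih: "dihedral (a 1) n = - n" for n
    using dihedral_word_prod[of "[1]"] in_X_3 by (simp add: word_prod_single flip.simps del: word_prod.simps)
  have eq: "balance (\<lambda>v. if v = 3 then x v else - x v) = flips w (balance x)" for x
  proof (rule balance_equivariant[OF w(1)])
    fix v assume "v \<in> X"
    then have "v = 1 \<or> v = 2 \<or> v = 3" by (auto simp: X_eq)
    then show "(if root_perm (word_prod w) v = 3 then x (root_perm (word_prod w) v) else - x (root_perm (word_prod w) v)) =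
        flips (word_sec w v) (x v)"
      using in_X_3 unfolding w(2) flips_sec
      by (elim disjE) (simp_all add: g_def opposite_def inv_a dih dihedral_id dihedral_id[unfolded id_def] del: One_nat_def)
  qed
  show False
    using eq[of "\<lambda>v. 0"] eq[of "\<lambda>v. if v = 2 then 0 else 1"] by (simp add: balance_def)
qed

end

theorem theorem3:
  fixes d m :: nat
  assumes "3 \<le> d" and "2 \<le> m" and "m \<le> d - 1"
  shows "strongly_fractal d (hanoi d m) \<and>
    regular_branch_over d (hanoi d m) (derived (tree_aut d) (hanoi d m)) \<and>
    (subgroup (hanoi_J d m) (tree_aut d\<lparr>carrier := hanoi d m\<rparr>) \<longleftrightarrow> 4 \<le> d) \<and>
    (just_infinite (tree_aut d\<lparr>carrier := hanoi d m\<rparr>) \<longleftrightarrow> 4 \<le> d)"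
proof -
  interpret H: hanoi_group d m
    using assms by unfold_locales simp_all
  have "\<not> subgroup (hanoi_J d m) (tree_aut d\<lparr>carrier := hanoi d m\<rparr>) \<and>
      \<not> just_infinite (tree_aut d\<lparr>carrier := hanoi d m\<rparr>)" if "\<not> 4 \<le> d"
  proof -
    interpret H3: hanoi_three d m
      using assms that by unfold_locales simp
    show ?thesis using H3.hanoi_J_not_subgroup H3.not_just_infinite by blast
  qed
  then show ?thesis
    using H.strongly_fractal_G H.regular_branch_G H.hanoi_J_subgroup H.just_infinite_G
    unfolding H.K_def by blast
qed

end
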